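(* For every $z\in\mathbb{C}$ there exists a unique probability measure $\nu_z$ on $\mathbb{R}_+=[0,\infty)$, absolutely continuous with respect to Lebesgue measure and depending only on $z$, such that the following holds. Whenever, for every $n\ge2$, $\mathbf{x}^{(n)}=(\mathbf{x}^{(n)}_{ij})_{1\le i,j\le n}$ is a deterministic real matrix with $\sum_{i,j=1}^n \mathbf{x}^{(n)}_{ij}=0$, $\sum_{i,j=1}^n |\mathbf{x}^{(n)}_{ij}|^2=n^2$, and $K_n=\max_{1\le i,j\le n}|\mathbf{x}^{(n)}_{ij}|$ satisfies $K_n=o(n^{1/2})$ as $n\to\infty$, and $X^{(n)}_{ij}=\mathbf{x}^{(n)}_{\pi_n(i,j)}$ with $\pi_n$ a uniform random permutation of $[n]\times[n]$, $A^{(n)}=\frac{1}{\sqrt n}X^{(n)}$, then for every $z\in\mathbb{C}$: (j) the random probability measures $\frac1n\sum_{k=1}^n\delta_{s_k(A^{(n)}-z\,\mathrm{Id}_n)}$ converge weakly in probability to $\nu_z$ as $n\to\infty$; (jj) $$-\int_{\mathbb{R}_+}\log(s)\,\nu_z(ds)=\begin{cases}-\log|z| & \text{if } |z|>1,\\ \frac{1-|z|^2}{2}&\text{otherwise.}\end{cases}$$ Furthermore, for $z=0$, $\nu_0$ has Lebesgue density $x\mapsto\frac1\pi\sqrt{4-x^2}\,\mathbf{1}_{[0,2]}(x)$.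
   Context: $[n]=\{1,\dots,n\}$ and $\mathrm{Id}_n$ is the $n\times n$ identity matrix. For an $n\times n$ complex matrix $A$, $s_1(A)\ge\dots\ge s_n(A)$ are its singular values, i.e. the eigenvalues of $\sqrt{AA^*}$. Random probability measures $\nu_n$ on $\mathbb{R}$ converge weakly in probability to a probability measure $\nu$ if for every bounded continuous $f:\mathbb{R}\to\mathbb{R}$ and every $\varepsilon>0$, $\lim_{n\to\infty}\mathbb{P}(|\int f\,d\nu_n-\int f\,d\nu|\ge\varepsilon)=0$. *)

theory Defs
  imports
    "HOL-Probability.Probability"
    "HOL-Library.Landau_Symbols"
    "HOL-Computational_Algebra.Fundamental_Theorem_Algebra"
    "Jordan_Normal_Form.Schur_Decomposition"
begin

text \<open>Matrices are Jordan-Normal-Form matrices, so the index set is \<open>{0..<n}\<close> instead of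
  \<open>{1..n}\<close>, and the $k$-th largest singular value is entry \<open>k - 1\<close> of the list of singular values.\<close>

definition psd_mat :: "complex mat \<Rightarrow> bool" where
  "psd_mat A \<longleftrightarrow> square_mat A \<and> mat_adjoint A = A \<and>
     (\<forall>v \<in> carrier_vec (dim_row A). 0 \<le> Re ((A *\<^sub>v v) \<bullet>c v))"

text \<open>The unique positive semidefinite square root; only meaningful for positive semidefinite
  arguments.\<close>

definition mat_sqrt :: "complex mat \<Rightarrow> complex mat" where
  "mat_sqrt A = (THE B. psd_mat B \<and> dim_row B = dim_row A \<and> B * B = A)"

text \<open>The eigenvalues of \<open>mat_sqrt (A * mat_adjoint A)\<close> in decreasing order, repeated according
  to multiplicity. They are roots of a complex polynomial, but real since the matrix is Hermitian.\<close>

definition singular_values :: "complex mat \<Rightarrow> real list" where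
  "singular_values A =
     rev (sorted_list_of_multiset
       (image_mset Re (proots (char_poly (mat_sqrt (A * mat_adjoint A))))))"

definition singular_value_dist :: "complex mat \<Rightarrow> real measure" where
  "singular_value_dist A =
     distr (uniform_count_measure {..<dim_row A}) borel (\<lambda>k. singular_values A ! k)"

text \<open>The probability spaces are discrete, so there are no measurability conditions on the
  random measures.\<close>

definition weak_conv_in_prob ::
    "(nat \<Rightarrow> 'a pmf) \<Rightarrow> (nat \<Rightarrow> 'a \<Rightarrow> real measure) \<Rightarrow> real measure \<Rightarrow> bool" where
  "weak_conv_in_prob P N \<nu> \<longleftrightarrow>
     (\<forall>f :: real \<Rightarrow> real. continuous_on UNIV f \<longrightarrow> bounded (range f) \<longrightarrow>
       (\<forall>\<epsilon>>0. (\<lambda>n. measure_pmf.prob (P n)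
                  {\<omega>. \<bar>(\<integral>s. f s \<partial>N n \<omega>) - (\<integral>s. f s \<partial>\<nu>)\<bar> \<ge> \<epsilon>}) \<longlonglongrightarrow> 0))"

definition unif_perm :: "nat \<Rightarrow> (nat \<times> nat \<Rightarrow> nat \<times> nat) pmf" where
  "unif_perm n = pmf_of_set {\<pi>. \<pi> permutes ({..<n} \<times> {..<n})}"

definition admissible_array :: "(nat \<Rightarrow> real mat) \<Rightarrow> bool" where
  "admissible_array x \<longleftrightarrow>
     (\<forall>n\<ge>2. x n \<in> carrier_mat n n \<and>
        (\<Sum>i<n. \<Sum>j<n. x n $$ (i, j)) = 0 \<and>
        (\<Sum>i<n. \<Sum>j<n. \<bar>x n $$ (i, j)\<bar>\<^sup>2) = (real n)\<^sup>2) \<and>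
     (\<lambda>n. Max ((\<lambda>(i, j). \<bar>x n $$ (i, j)\<bar>) ` ({..<n} \<times> {..<n}))) \<in> o(\<lambda>n. sqrt (real n))"

definition perm_mat :: "real mat \<Rightarrow> nat \<Rightarrow> (nat \<times> nat \<Rightarrow> nat \<times> nat) \<Rightarrow> complex mat" where
  "perm_mat x n \<pi> = mat n n (\<lambda>ij. of_real (1 / sqrt (real n) * x $$ (\<pi> ij)))"

definition is_limit_law :: "complex \<Rightarrow> real measure \<Rightarrow> bool" where
  "is_limit_law z \<nu> \<longleftrightarrow>
     prob_space \<nu> \<and> sets \<nu> = sets borel \<and> emeasure \<nu> {..<0} = 0 \<and>
     absolutely_continuous lborel \<nu> \<and>
     (\<forall>x. admissible_array x \<longrightarrow>
        weak_conv_in_prob unif_perm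
          (\<lambda>n \<pi>. singular_value_dist (perm_mat (x n) n \<pi> - z \<cdot>\<^sub>m 1\<^sub>m n)) \<nu> \<and>
        set_integrable \<nu> {0..} ln \<and>
        - (LINT s:{0..}|\<nu>. ln s) = (if cmod z > 1 then - ln (cmod z) else (1 - (cmod z)\<^sup>2) / 2))"

end

theory Submission
  imports Defs "HOL-Complex_Analysis.Complex_Analysis" "HOL-Combinatorics.Transposition" "HOL-Real_Asymp.Real_Asymp"
begin

text \<open>Let \<open>G\<close> be the resolvent at \<open>\<i> t\<close> of the Hermitization of \<open>A - z\<close>. A centred entry of the
  array is the average of its differences with all other entries, and exchanging two entries
  preserves the law of the array; this exchange replaces Gaussian integration by parts and shows that
  the normalized block traces \<open>g\<close>, \<open>b\<close> of \<open>G\<close> solve \<open>1 + z b + \<i> t g + g\<^sup>2 = 0\<close> and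
  \<open>cnj z g + \<i> t b + g b = 0\<close> up to an error that is \<open>O(K_n / sqrt n + 1 / n)\<close> in mean square.
  Writing \<open>g = \<i> h\<close>, \<open>w = t + h\<close> and eliminating \<open>b\<close>, the limiting equation is
  \<open>w - w / (w\<^sup>2 + \<bar>z\<bar>\<^sup>2) = t\<close>, whose positive solution is unique and stable for every \<open>t > 0\<close>.
  So \<open>h\<close>, the integral of \<open>t / (s\<^sup>2 + t\<^sup>2)\<close> against the singular value distribution, converges in
  probability for every \<open>t > 0\<close>. By the Weierstrass theorem these integrals determine weak
  convergence, and tightness yields a limit law. Analytic continuation of the equation to the upper half
  plane bounds the imaginary part of the Cauchy transform by \<open>1\<close>, whence the law is absolutely
  continuous. Its logarithmic integral comes from an explicit primitive of \<open>h\<close> in the variable \<open>w\<close>,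
  and for \<open>z = 0\<close> the quarter circle law is recognized by integrating \<open>t / (s\<^sup>2 + t\<^sup>2)\<close>.\<close>

section \<open>Singular values\<close>

text \<open>The entries of the permuted array are dependent and only \<open>K_n = o(sqrt n)\<close>
  is known, so moments beyond the second are out of control. The exchange identity produces the
  factor (X a - X b)^2, whose average over b is (X a)^2 + 1 instead of a constant. The fluctuation
  (X a)^2 - 1 is again a centred array, because the squares sum to n^2, so the exchange is applied a
  second time, to it. Each application costs at most a factor K_n, absorbed by the 1 / sqrt n in the
  derivative of G. Concentration comes for free: the averaged identity admits a test function that
  varies little under one exchange, and choosing the conjugate of the defect itself turns the
  identity into a mean square bound. Normalized traces qualify, since one exchange moves them by
  O(K_n / n^(3/2)). All resolvent estimates rest on one fact: rows and columns of G have l^2 norm at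
  most 1 / t. The law has no explicit density for general z, which is why it is obtained by
  compactness and studied through its transform alone. One concrete admissible array is exhibited,
  both as the source of the limit and to make uniqueness meaningful.\<close>

lemma mat_adjoint_dim [simp]:
  "dim_row (mat_adjoint A) = dim_col A" "dim_col (mat_adjoint A) = dim_row A"
  by (simp_all add: mat_adjoint_def)

lemma mat_adjoint_index [simp]:
  fixes A :: "complex mat"
  assumes "i < dim_col A" "j < dim_row A"
  shows "mat_adjoint A $$ (i, j) = cnj (A $$ (j, i))"
  using assms by (simp add: mat_adjoint_def mat_of_rows_def)

lemma mat_adjoint_carrier [simp]:
  "A \<in> carrier_mat n m \<Longrightarrow> mat_adjoint A \<in> carrier_mat m n"
  by (intro carrier_matI) auto

lemma index_mult_mat_sum:
  assumes "A \<in> carrier_mat n m" "B \<in> carrier_mat m k" "i < n" "j < k"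
  shows "(A * B) $$ (i, j) = (\<Sum>l<m. A $$ (i, l) * B $$ (l, j))"
  using assms by (simp add: scalar_prod_def atLeast0LessThan)

lemma mat_adjoint_adjoint [simp]: "mat_adjoint (mat_adjoint (A :: complex mat)) = A"
  by (rule eq_matI) auto

lemma mat_adjoint_one [simp]: "mat_adjoint (1\<^sub>m n :: complex mat) = 1\<^sub>m n"
  by (rule eq_matI) auto

lemma mat_adjoint_mult:
  fixes A :: "complex mat"
  assumes "A \<in> carrier_mat n m" "B \<in> carrier_mat m k"
  shows "mat_adjoint (A * B) = mat_adjoint B * mat_adjoint A"
proof (rule eq_matI)
  fix i j assume ij: "i < dim_row (mat_adjoint B * mat_adjoint A)" "j < dim_col (mat_adjoint B * mat_adjoint A)"
  then have i: "i < k" and j: "j < n" using assms by auto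
  have "mat_adjoint (A * B) $$ (i, j) = cnj ((A * B) $$ (j, i))"
    using assms i j by (intro mat_adjoint_index) auto
  also have "\<dots> = (\<Sum>l<m. cnj (A $$ (j, l)) * cnj (B $$ (l, i)))"
    by (simp add: index_mult_mat_sum[OF assms j i] del: index_mult_mat)
  also have "\<dots> = (\<Sum>l<m. mat_adjoint B $$ (i, l) * mat_adjoint A $$ (l, j))"
    using assms i j by (intro sum.cong) auto
  also have "\<dots> = (mat_adjoint B * mat_adjoint A) $$ (i, j)"
    using assms i j by (intro index_mult_mat_sum[symmetric]) auto
  finally show "mat_adjoint (A * B) $$ (i, j) = (mat_adjoint B * mat_adjoint A) $$ (i, j)" .
qed (use assms in auto)

section \<open>Diagonal and block diagonal matrices\<close>

definition diagm :: "nat \<Rightarrow> (nat \<Rightarrow> complex) \<Rightarrow> complex mat" where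
  "diagm n d = mat n n (\<lambda>(i, j). if i = j then d i else 0)"

lemma diagm_carrier [simp]: "diagm n d \<in> carrier_mat n n"
  by (simp add: diagm_def)

lemma diagm_dim [simp]: "dim_row (diagm n d) = n" "dim_col (diagm n d) = n"
  by (simp_all add: diagm_def)

lemma diagm_index [simp]: "i < n \<Longrightarrow> j < n \<Longrightarrow> diagm n d $$ (i, j) = (if i = j then d i else 0)"
  by (simp add: diagm_def)

lemma diagm_mult: "diagm n d * diagm n e = diagm n (\<lambda>i. d i * e i)"
proof (rule eq_matI)
  fix i j assume "i < dim_row (diagm n (\<lambda>i. d i * e i))" "j < dim_col (diagm n (\<lambda>i. d i * e i))"
  then have ij: "i < n" "j < n" by auto
  have "(diagm n d * diagm n e) $$ (i, j) = (\<Sum>l<n. if l = i then (if i = j then d i * e i else 0) else 0)"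
    unfolding index_mult_mat_sum[OF diagm_carrier diagm_carrier ij] using ij
    by (intro sum.cong) auto
  then show "(diagm n d * diagm n e) $$ (i, j) = diagm n (\<lambda>i. d i * e i) $$ (i, j)"
    using ij by simp
qed auto

lemma mat_adjoint_diagm: "mat_adjoint (diagm n d) = diagm n (\<lambda>i. cnj (d i))"
  by (rule eq_matI) auto

text \<open>The block diagonal matrix with blocks \<open>x\<close> and \<open>B\<close>. It lifts
  the inductive hypothesis of the spectral theorem from size \<open>n\<close> to
  \<open>Suc n\<close>.\<close>

definition corner_mat :: "complex \<Rightarrow> complex mat \<Rightarrow> nat \<Rightarrow> complex mat" where
  "corner_mat x B n = mat (Suc n) (Suc n)
     (\<lambda>(i, j). if i = 0 \<and> j = 0 then x else if i = 0 \<or> j = 0 then 0 else B $$ (i - 1, j - 1))"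

lemma corner_mat_carrier [simp]: "corner_mat x B n \<in> carrier_mat (Suc n) (Suc n)"
  by (simp add: corner_mat_def)

lemma corner_mat_dim [simp]: "dim_row (corner_mat x B n) = Suc n" "dim_col (corner_mat x B n) = Suc n"
  by (simp_all add: corner_mat_def)

lemma corner_mat_mult:
  assumes "B \<in> carrier_mat n n" "C \<in> carrier_mat n n"
  shows "corner_mat x B n * corner_mat y C n = corner_mat (x * y) (B * C) n"
proof (rule eq_matI)
  fix i j assume "i < dim_row (corner_mat (x * y) (B * C) n)" "j < dim_col (corner_mat (x * y) (B * C) n)"
  then have ij: "i < Suc n" "j < Suc n" by auto
  show "(corner_mat x B n * corner_mat y C n) $$ (i, j) = corner_mat (x * y) (B * C) n $$ (i, j)"
    unfolding index_mult_mat_sum[OF corner_mat_carrier corner_mat_carrier ij]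
    unfolding sum.lessThan_Suc_shift
    using ij by (cases i; cases j)
      (auto simp: corner_mat_def index_mult_mat_sum[OF assms] simp del: index_mult_mat)
qed auto

lemma mat_adjoint_corner:
  assumes "B \<in> carrier_mat n n"
  shows "mat_adjoint (corner_mat x B n) = corner_mat (cnj x) (mat_adjoint B) n"
proof (rule eq_matI)
  fix i j assume "i < dim_row (corner_mat (cnj x) (mat_adjoint B) n)" "j < dim_col (corner_mat (cnj x) (mat_adjoint B) n)"
  then have "i < Suc n" "j < Suc n" by auto
  then show "mat_adjoint (corner_mat x B n) $$ (i, j) = corner_mat (cnj x) (mat_adjoint B) n $$ (i, j)"
    using assms by (cases i; cases j) (auto simp: corner_mat_def)
qed auto

lemma corner_mat_one: "corner_mat 1 (1\<^sub>m n) n = 1\<^sub>m (Suc n)"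
proof (rule eq_matI)
  fix i j assume "i < dim_row (1\<^sub>m (Suc n))" "j < dim_col (1\<^sub>m (Suc n))"
  then show "corner_mat 1 (1\<^sub>m n) n $$ (i, j) = 1\<^sub>m (Suc n) $$ (i, j)"
    by (cases i; cases j) (auto simp: corner_mat_def)
qed auto

text \<open>One deflation step: an eigenvector, which exists because the characteristic polynomial
  has a complex root, is completed to a basis and orthonormalized.\<close>

lemma unitary_extending_eigenvector:
  fixes A :: "complex mat"
  assumes A: "A \<in> carrier_mat n n" and n: "n > 0"
  shows "\<exists>W e. W \<in> carrier_mat n n \<and> mat_adjoint W * W = 1\<^sub>m n \<and>
    (\<forall>i<n. (mat_adjoint W * (A * W)) $$ (i, 0) = (if i = 0 then e else 0))"
proof -
  have "degree (char_poly A) = n" using degree_monic_char_poly[OF A] by simp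
  then have "\<not> constant (poly (char_poly A))" using n by (simp add: constant_degree)
  from Fundamental_Theorem_Algebra.fundamental_theorem_of_algebra[OF this] obtain e where "poly (char_poly A) e = 0" by blast
  then have "eigenvalue A e" using eigenvalue_root_char_poly[OF A] by simp
  then obtain v where "eigenvector A v e" unfolding eigenvalue_def by blast
  then have v: "v \<in> carrier_vec n" and v0: "v \<noteq> 0\<^sub>v n" and Av: "A *\<^sub>v v = e \<cdot>\<^sub>v v"
    using A unfolding eigenvector_def by auto
  interpret cof_vec_space n "TYPE(complex)" .
  define b where "b = basis_completion v"
  from basis_completion[OF v v0, folded b_def]
  have dist_b: "distinct b" and indep: "\<not> lin_dep (set b)" and b: "set b \<subseteq> carrier_vec n"
    and hdb: "hd b = v" and len_b: "length b = n" by auto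
  from hdb len_b n obtain vs where bv: "b = v # vs" by (cases b) auto
  define ws where "ws = gram_schmidt n b"
  from gram_schmidt_result[OF b dist_b indep refl, folded ws_def]
  have ws: "set ws \<subseteq> carrier_vec n" "corthogonal ws" "length ws = n" by (auto simp: len_b)
  \<comment> \<open>Gram-Schmidt leaves the first vector unchanged, so it is still an
    eigenvector.\<close>
  have hdws: "hd ws = v" using gram_schmidt_hd[OF v, of vs, folded bv] unfolding ws_def .
  have w0: "ws ! 0 = v" using hdws ws(3) n by (cases ws) auto
  have wc: "ws ! i \<in> carrier_vec n" if "i < n" for i using ws that by auto
  define r where "r i = (\<Sum>l<n. (cmod (vec_index (ws ! i) l))\<^sup>2)" for i
  have ip: "(ws ! i) \<bullet>c (ws ! j) = (\<Sum>l<n. vec_index (ws ! i) l * cnj (vec_index (ws ! j) l))"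
    if "i < n" "j < n" for i j
    using wc[OF that(1)] wc[OF that(2)] by (simp add: scalar_prod_def atLeast0LessThan)
  have orth: "(\<Sum>l<n. vec_index (ws ! i) l * cnj (vec_index (ws ! j) l)) = (if i = j then of_real (r i) else 0)"
    if "i < n" "j < n" for i j
  proof (cases "i = j")
    case True then show ?thesis unfolding r_def of_real_sum complex_norm_square by simp
  next
    case False then show ?thesis using corthogonalD[OF ws(2), of i j] that ws(3) ip[OF that] by auto
  qed
  have r0: "r i > 0" if "i < n" for i
  proof -
    have "ws ! i \<bullet>c ws ! i \<noteq> 0" using corthogonalD[OF ws(2), of i i] that ws(3) by auto
    then have "r i \<noteq> 0" using ip[OF that that] orth[OF that that] by auto
    moreover have "r i \<ge> 0" unfolding r_def by (intro sum_nonneg) auto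
    ultimately show ?thesis by simp
  qed
  \<comment> \<open>\<open>gram_schmidt\<close> yields orthogonal vectors that need not have unit
    length, hence the division by the lengths.\<close>
  define W where "W = mat n n (\<lambda>(l, i). vec_index (ws ! i) l / of_real (sqrt (r i)))"
  have W: "W \<in> carrier_mat n n" by (simp add: W_def)
  have WW: "mat_adjoint W * W = 1\<^sub>m n"
  proof (rule eq_matI)
    fix i j assume "i < dim_row (1\<^sub>m n)" "j < dim_col (1\<^sub>m n)"
    then have ij: "i < n" "j < n" by auto
    have "(mat_adjoint W * W) $$ (i, j) = (\<Sum>l<n. (vec_index (ws ! j) l * cnj (vec_index (ws ! i) l)) / of_real (sqrt (r i) * sqrt (r j)))"
      unfolding index_mult_mat_sum[OF mat_adjoint_carrier[OF W] W ij] using ij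
      by (intro sum.cong) (auto simp: W_def)
    also have "\<dots> = (if j = i then of_real (r j) else 0) / of_real (sqrt (r i) * sqrt (r j))"
      by (simp add: sum_divide_distrib[symmetric] orth[OF ij(2,1)])
    also have "\<dots> = 1\<^sub>m n $$ (i, j)" using ij r0[OF ij(1)] by (auto simp flip: of_real_mult of_real_divide)
    finally show "(mat_adjoint W * W) $$ (i, j) = 1\<^sub>m n $$ (i, j)" .
  qed (use W in auto)
  have AW: "(A * W) $$ (l, 0) = e * W $$ (l, 0)" if l: "l < n" for l
  proof -
    have "(A * W) $$ (l, 0) = (\<Sum>k<n. A $$ (l, k) * vec_index v k) / of_real (sqrt (r 0))"
      unfolding index_mult_mat_sum[OF A W l n] sum_divide_distrib using n
      by (intro sum.cong) (auto simp: W_def w0)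
    also have "(\<Sum>k<n. A $$ (l, k) * vec_index v k) = vec_index (A *\<^sub>v v) l"
      using A v l by (simp add: scalar_prod_def atLeast0LessThan)
    also have "\<dots> = e * vec_index v l" using Av v l by simp
    finally show ?thesis using l n by (simp add: W_def w0)
  qed
  have "(mat_adjoint W * (A * W)) $$ (i, 0) = (if i = 0 then e else 0)" if i: "i < n" for i
  proof -
    have "(mat_adjoint W * (A * W)) $$ (i, 0) = (\<Sum>l<n. mat_adjoint W $$ (i, l) * (A * W) $$ (l, 0))"
      using A W i n by (intro index_mult_mat_sum) auto
    also have "\<dots> = e * (\<Sum>l<n. mat_adjoint W $$ (i, l) * W $$ (l, 0))"
      unfolding sum_distrib_left by (intro sum.cong) (auto simp: AW)
    also have "(\<Sum>l<n. mat_adjoint W $$ (i, l) * W $$ (l, 0)) = (mat_adjoint W * W) $$ (i, 0)"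
      using A W i n by (intro index_mult_mat_sum[symmetric]) auto
    finally show ?thesis using WW i n by auto
  qed
  then show ?thesis using W WW by blast
qed

lemma unitary_left_right:
  fixes U :: "complex mat"
  assumes "U \<in> carrier_mat n n" "mat_adjoint U * U = 1\<^sub>m n"
  shows "U * mat_adjoint U = 1\<^sub>m n"
  using mat_mult_left_right_inverse[of "mat_adjoint U" n U] assms by simp

text \<open>Induction on the size: in the basis of the deflation step the matrix splits into a real
  1 by 1 block and a Hermitian block of size one less.\<close>

theorem hermitian_spectral:
  fixes A :: "complex mat"
  assumes "A \<in> carrier_mat n n" "mat_adjoint A = A"
  shows "\<exists>U d. U \<in> carrier_mat n n \<and> mat_adjoint U * U = 1\<^sub>m n \<and>
     A = U * diagm n (\<lambda>i. complex_of_real (d i)) * mat_adjoint U"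
  using assms
proof (induction n arbitrary: A)
  case 0
  then show ?case by (intro exI[of _ "1\<^sub>m 0"] exI[of _ "\<lambda>_. 0"]) (auto intro!: eq_matI)
next
  case (Suc n)
  note A = Suc.prems(1) and herm = Suc.prems(2)
  obtain W e where W: "W \<in> carrier_mat (Suc n) (Suc n)" and WW: "mat_adjoint W * W = 1\<^sub>m (Suc n)"
    and col: "\<forall>i<Suc n. (mat_adjoint W * (A * W)) $$ (i, 0) = (if i = 0 then e else 0)"
    using unitary_extending_eigenvector[OF A] by auto
  have W': "mat_adjoint W \<in> carrier_mat (Suc n) (Suc n)" using W by simp
  have AW: "A * W \<in> carrier_mat (Suc n) (Suc n)" using A W by simp
  define A' where "A' = mat_adjoint W * (A * W)"
  have A': "A' \<in> carrier_mat (Suc n) (Suc n)" using W' AW by (simp add: A'_def)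
  have hA': "mat_adjoint A' = A'"
    unfolding A'_def mat_adjoint_mult[OF W' AW] mat_adjoint_mult[OF A W] mat_adjoint_adjoint herm
    by (rule assoc_mult_mat[OF W' A W])
  have swap: "A' $$ (i, j) = cnj (A' $$ (j, i))" if "i < Suc n" "j < Suc n" for i j
    using mat_adjoint_index[of i A' j] hA' that A' by auto
  define A3 where "A3 = mat n n (\<lambda>(i, j). A' $$ (Suc i, Suc j))"
  have A3: "A3 \<in> carrier_mat n n" by (simp add: A3_def)
  have hA3: "mat_adjoint A3 = A3"
  proof (rule eq_matI)
    fix i j assume "i < dim_row A3" "j < dim_col A3"
    then have ij: "i < n" "j < n" using A3 by auto
    then have "mat_adjoint A3 $$ (i, j) = cnj (A' $$ (Suc j, Suc i))"
      using A3 by (subst mat_adjoint_index) (auto simp: A3_def)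
    also have "\<dots> = A3 $$ (i, j)" using swap[of "Suc i" "Suc j"] ij by (simp add: A3_def)
    finally show "mat_adjoint A3 $$ (i, j) = A3 $$ (i, j)" .
  qed (use A3 in auto)
  obtain U d where U: "U \<in> carrier_mat n n" and UU: "mat_adjoint U * U = 1\<^sub>m n"
    and A3eq: "A3 = U * diagm n (\<lambda>i. complex_of_real (d i)) * mat_adjoint U"
    using Suc.IH[OF A3 hA3] by blast
  have e_real: "e = of_real (Re e)"
    using swap[of 0 0] col by (auto simp: A'_def complex_eq_iff)
  \<comment> \<open>The first column vanishes below the corner by the choice of \<open>W\<close>;
    Hermitian symmetry then clears the first row too.\<close>
  have A'_corner: "A' = corner_mat e A3 n"
  proof (rule eq_matI)
    fix i j assume "i < dim_row (corner_mat e A3 n)" "j < dim_col (corner_mat e A3 n)"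
    then have ij: "i < Suc n" "j < Suc n" by auto
    show "A' $$ (i, j) = corner_mat e A3 n $$ (i, j)"
    proof (cases "j = 0")
      case True then show ?thesis using col ij by (auto simp: A'_def corner_mat_def)
    next
      case j: False
      show ?thesis
      proof (cases "i = 0")
        case True
        then show ?thesis using swap[of 0 j] col ij j by (auto simp: A'_def corner_mat_def)
      next
        case False then show ?thesis using ij j by (auto simp: corner_mat_def A3_def)
      qed
    qed
  qed (use A' in auto)
  define D where "D = diagm n (\<lambda>i. complex_of_real (d i))"
  have D: "D \<in> carrier_mat n n" by (simp add: D_def)
  define V where "V = corner_mat 1 U n"
  have V: "V \<in> carrier_mat (Suc n) (Suc n)" by (simp add: V_def)
  have V': "mat_adjoint V = corner_mat 1 (mat_adjoint U) n"
    by (simp add: V_def mat_adjoint_corner[OF U])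
  have VV: "mat_adjoint V * V = 1\<^sub>m (Suc n)"
    unfolding V' using U by (simp add: V_def corner_mat_mult UU corner_mat_one)
  define d' where "d' i = (if i = 0 then Re e else d (i - 1))" for i
  have diag: "diagm (Suc n) (\<lambda>i. complex_of_real (d' i)) = corner_mat e D n"
    by (rule eq_matI) (auto simp: corner_mat_def D_def d'_def e_real[symmetric])
  have A'eq: "A' = V * diagm (Suc n) (\<lambda>i. complex_of_real (d' i)) * mat_adjoint V"
    unfolding diag V' A'_corner A3eq D_def[symmetric] using U D
    by (simp add: V_def corner_mat_mult mult_carrier_mat[of _ n n _ n])
  define E where "E = diagm (Suc n) (\<lambda>i. complex_of_real (d' i))"
  have E: "E \<in> carrier_mat (Suc n) (Suc n)" by (simp add: E_def)
  note WW2 = unitary_left_right[OF W WW]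
  have "A = (W * mat_adjoint W) * A * (W * mat_adjoint W)" using A by (simp add: WW2)
  also have "\<dots> = W * A' * mat_adjoint W"
    unfolding A'_def using A W W' by (simp add: assoc_mult_mat[of _ "Suc n" "Suc n" _ "Suc n" _ "Suc n"] mult_carrier_mat[of _ "Suc n" "Suc n" _ "Suc n"])
  also have "\<dots> = (W * V) * E * mat_adjoint (W * V)"
    unfolding A'eq E_def[symmetric] mat_adjoint_mult[OF W V] using W V W' E mat_adjoint_carrier[OF V]
    by (simp add: assoc_mult_mat[of _ "Suc n" "Suc n" _ "Suc n" _ "Suc n"] mult_carrier_mat[of _ "Suc n" "Suc n" _ "Suc n"])
  finally have 1: "A = (W * V) * E * mat_adjoint (W * V)" .
  have "mat_adjoint (W * V) * (W * V) = mat_adjoint V * (mat_adjoint W * W) * V"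
    unfolding mat_adjoint_mult[OF W V] using W V W' mat_adjoint_carrier[OF V]
    by (simp add: assoc_mult_mat[of _ "Suc n" "Suc n" _ "Suc n" _ "Suc n"] mult_carrier_mat[of _ "Suc n" "Suc n" _ "Suc n"])
  also have "\<dots> = 1\<^sub>m (Suc n)" using mat_adjoint_carrier[OF V] by (simp only: WW right_mult_one_mat VV)
  finally show ?case using 1 W V E_def by (intro exI[of _ "W * V"] exI[of _ d']) auto
qed

section \<open>Positive semidefinite matrices and their square roots\<close>

lemma diagm_mult_index:
  assumes "W \<in> carrier_mat n n" "i < n" "j < n"
  shows "(diagm n d * W) $$ (i, j) = d i * W $$ (i, j)"
    and "(W * diagm n d) $$ (i, j) = W $$ (i, j) * d j"
proof -
  have "(diagm n d * W) $$ (i, j) = (\<Sum>l<n. if l = i then d i * W $$ (i, j) else 0)"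
    unfolding index_mult_mat_sum[OF diagm_carrier assms] using assms by (intro sum.cong) auto
  then show "(diagm n d * W) $$ (i, j) = d i * W $$ (i, j)" using assms by simp
  have "(W * diagm n d) $$ (i, j) = (\<Sum>l<n. if l = j then W $$ (i, j) * d j else 0)"
    unfolding index_mult_mat_sum[OF assms(1) diagm_carrier assms(2,3)] using assms by (intro sum.cong) auto
  then show "(W * diagm n d) $$ (i, j) = W $$ (i, j) * d j" using assms by simp
qed

lemma quadratic_form_sum:
  fixes A :: "complex mat"
  assumes "A \<in> carrier_mat n n" "v \<in> carrier_vec n"
  shows "(A *\<^sub>v v) \<bullet>c v = (\<Sum>k<n. \<Sum>l<n. cnj (vec_index v k) * A $$ (k, l) * vec_index v l)"
  using assms by (auto simp: scalar_prod_def atLeast0LessThan sum_distrib_right sum_distrib_left ac_simps intro!: sum.cong)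

lemma psd_mat_diagonalized:
  assumes "psd_mat A" "A \<in> carrier_mat n n"
  shows "\<exists>U d. U \<in> carrier_mat n n \<and> mat_adjoint U * U = 1\<^sub>m n \<and> (\<forall>i<n. 0 \<le> d i) \<and>
     A = U * diagm n (\<lambda>i. complex_of_real (d i)) * mat_adjoint U"
proof -
  have A: "A \<in> carrier_mat n n" by fact
  obtain U d where U: "U \<in> carrier_mat n n" and UU: "mat_adjoint U * U = 1\<^sub>m n"
    and Aeq: "A = U * diagm n (\<lambda>i. complex_of_real (d i)) * mat_adjoint U"
    using hermitian_spectral[of A n] assms unfolding psd_mat_def by blast
  define D where "D = diagm n (\<lambda>i. complex_of_real (d i))"
  have D: "D \<in> carrier_mat n n" by (simp add: D_def)
  have U': "mat_adjoint U \<in> carrier_mat n n" using U by simp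
  have "d i \<ge> 0" if i: "i < n" for i
  proof -
    \<comment> \<open>Column \<open>i\<close> of \<open>U\<close>: the quadratic form takes the
      value \<open>d i\<close> there.\<close>
    define v where "v = vec n (\<lambda>k. U $$ (k, i))"
    have v: "v \<in> carrier_vec n" by (simp add: v_def)
    have "mat_adjoint U * (A * U) = (mat_adjoint U * U) * D * (mat_adjoint U * U)"
      unfolding Aeq D_def[symmetric] using U U' D
      by (simp add: assoc_mult_mat[of _ n n _ n _ n] mult_carrier_mat[of _ n n _ n])
    also have "\<dots> = D" using D by (simp add: UU)
    finally have UAU: "mat_adjoint U * (A * U) = D" .
    have "of_real (d i) = (mat_adjoint U * (A * U)) $$ (i, i)" using i unfolding UAU by (simp add: D_def)
    also have "\<dots> = (\<Sum>k<n. mat_adjoint U $$ (i, k) * (A * U) $$ (k, i))"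
      using A U U' i by (intro index_mult_mat_sum) auto
    also have "\<dots> = (\<Sum>k<n. \<Sum>l<n. cnj (vec_index v k) * A $$ (k, l) * vec_index v l)"
    proof (intro sum.cong refl)
      fix k assume "k \<in> {..<n}"
      then have k: "k < n" by simp
      show "mat_adjoint U $$ (i, k) * (A * U) $$ (k, i) = (\<Sum>l<n. cnj (vec_index v k) * A $$ (k, l) * vec_index v l)"
        unfolding index_mult_mat_sum[OF A U k i] sum_distrib_left
        using U k i by (intro sum.cong) (auto simp: v_def)
    qed
    also have "\<dots> = (A *\<^sub>v v) \<bullet>c v" by (rule quadratic_form_sum[OF A v, symmetric])
    finally have "of_real (d i) = (A *\<^sub>v v) \<bullet>c v" .
    then have "d i = Re ((A *\<^sub>v v) \<bullet>c v)" by (metis Re_complex_of_real)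
    then show ?thesis using assms v unfolding psd_mat_def by auto
  qed
  then show ?thesis using U UU Aeq by blast
qed

lemma psd_mat_gram:
  fixes C :: "complex mat"
  assumes C: "C \<in> carrier_mat n n"
  shows "psd_mat (C * mat_adjoint C)"
proof -
  have C': "mat_adjoint C \<in> carrier_mat n n" using C by simp
  have CC: "C * mat_adjoint C \<in> carrier_mat n n" using C C' by simp
  have herm: "mat_adjoint (C * mat_adjoint C) = C * mat_adjoint C"
    unfolding mat_adjoint_mult[OF C C'] by simp
  have "0 \<le> Re (((C * mat_adjoint C) *\<^sub>v v) \<bullet>c v)" if v: "v \<in> carrier_vec n" for v
  proof -
    \<comment> \<open>The conjugated coordinates of the vector
      \<open>mat_adjoint C *\<^sub>v v\<close>. The quadratic form is the sum of their squared
      moduli.\<close>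
    define u where "u m = (\<Sum>k<n. cnj (vec_index v k) * C $$ (k, m))" for m
    have "((C * mat_adjoint C) *\<^sub>v v) \<bullet>c v
      = (\<Sum>k<n. \<Sum>l<n. \<Sum>m<n. (cnj (vec_index v k) * C $$ (k, m)) * cnj (cnj (vec_index v l) * C $$ (l, m)))"
      unfolding quadratic_form_sum[OF CC v]
      by (intro sum.cong refl, subst index_mult_mat_sum[OF C C'])
         (use C in \<open>auto simp: sum_distrib_left sum_distrib_right ac_simps intro!: sum.cong\<close>)
    also have "\<dots> = (\<Sum>k<n. \<Sum>m<n. \<Sum>l<n. (cnj (vec_index v k) * C $$ (k, m)) * cnj (cnj (vec_index v l) * C $$ (l, m)))"
      by (rule sum.cong[OF refl]) (rule sum.swap)
    also have "\<dots> = (\<Sum>m<n. \<Sum>k<n. \<Sum>l<n. (cnj (vec_index v k) * C $$ (k, m)) * cnj (cnj (vec_index v l) * C $$ (l, m)))"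
      by (rule sum.swap)
    also have "\<dots> = (\<Sum>m<n. u m * cnj (u m))"
      unfolding u_def cnj_sum sum_product by simp
    also have "\<dots> = of_real (\<Sum>m<n. (cmod (u m))\<^sup>2)"
      unfolding of_real_sum complex_norm_square by simp
    finally show ?thesis by (simp add: sum_nonneg)
  qed
  then show ?thesis using CC herm unfolding psd_mat_def by (auto simp: square_mat.simps)
qed

text \<open>With \<open>E\<close> the diagonal matrix of the square roots of \<open>d\<close>, the
  matrix is the Gram matrix of \<open>U * E\<close>.\<close>

lemma psd_mat_of_diagonal:
  assumes U: "U \<in> carrier_mat n n" and UU: "mat_adjoint U * U = 1\<^sub>m n"
    and d: "\<And>i. i < n \<Longrightarrow> 0 \<le> d i"
  shows "psd_mat (U * diagm n (\<lambda>i. complex_of_real (d i)) * mat_adjoint U)"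
proof -
  define E where "E = diagm n (\<lambda>i. complex_of_real (sqrt (d i)))"
  have E: "E \<in> carrier_mat n n" by (simp add: E_def)
  have E': "mat_adjoint E = E" by (simp add: E_def mat_adjoint_diagm)
  have "diagm n (\<lambda>i. complex_of_real (d i)) = E * E"
    unfolding E_def diagm_mult by (rule eq_matI) (auto simp: d simp flip: of_real_mult)
  then have "U * diagm n (\<lambda>i. complex_of_real (d i)) * mat_adjoint U = (U * E) * mat_adjoint (U * E)"
    unfolding mat_adjoint_mult[OF U E] E' using U E mat_adjoint_carrier[OF U]
    by (simp add: assoc_mult_mat[of _ n n _ n _ n] mult_carrier_mat[of _ n n _ n])
  then show ?thesis using psd_mat_gram[of "U * E" n] U E by simp
qed

lemma diagonal_square:
  assumes U: "U \<in> carrier_mat n n" and UU: "mat_adjoint U * U = 1\<^sub>m n"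
  shows "(U * diagm n d * mat_adjoint U) * (U * diagm n d * mat_adjoint U)
    = U * diagm n (\<lambda>i. d i * d i) * mat_adjoint U"
proof -
  have U': "mat_adjoint U \<in> carrier_mat n n" using U by simp
  have "(U * diagm n d * mat_adjoint U) * (U * diagm n d * mat_adjoint U)
    = U * (diagm n d * ((mat_adjoint U * U) * diagm n d)) * mat_adjoint U"
    using U U' by (simp add: assoc_mult_mat[of _ n n _ n _ n] mult_carrier_mat[of _ n n _ n])
  then show ?thesis unfolding UU by (simp add: left_mult_one_mat[of _ n n] diagm_mult)
qed

text \<open>Let \<open>U\<close> and \<open>V\<close> diagonalize the two roots and put
  \<open>W = mat_adjoint U * V\<close>. Equality of the squares says entrywise that (b i)^2 and (c
  j)^2 agree wherever \<open>W\<close> has a nonzero entry. As both are nonnegative, already b i = c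
  j there, so \<open>W\<close> intertwines the diagonals themselves, which is the claim.\<close>

lemma psd_sqrt_unique:
  assumes B: "psd_mat B" "B \<in> carrier_mat n n" and C: "psd_mat C" "C \<in> carrier_mat n n"
    and eq: "B * B = C * C"
  shows "B = C"
proof -
  obtain U b where U: "U \<in> carrier_mat n n" and UU: "mat_adjoint U * U = 1\<^sub>m n"
    and b: "\<forall>i<n. 0 \<le> b i" and Beq: "B = U * diagm n (\<lambda>i. complex_of_real (b i)) * mat_adjoint U"
    using psd_mat_diagonalized[OF B] by blast
  obtain V c where V: "V \<in> carrier_mat n n" and VV: "mat_adjoint V * V = 1\<^sub>m n"
    and c: "\<forall>i<n. 0 \<le> c i" and Ceq: "C = V * diagm n (\<lambda>i. complex_of_real (c i)) * mat_adjoint V"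
    using psd_mat_diagonalized[OF C] by blast
  have U': "mat_adjoint U \<in> carrier_mat n n" and V': "mat_adjoint V \<in> carrier_mat n n" using U V by auto
  define W where "W = mat_adjoint U * V"
  have W: "W \<in> carrier_mat n n" using U' V by (simp add: W_def)
  note sq = assoc_mult_mat[of _ n n _ n _ n] mult_carrier_mat[of _ n n _ n]
  have conj: "mat_adjoint U * (U * X * mat_adjoint U) * V = X * W"
    "mat_adjoint U * (V * X * mat_adjoint V) * V = W * X" if X: "X \<in> carrier_mat n n" for X
  proof -
    have "mat_adjoint U * (U * X * mat_adjoint U) * V = (mat_adjoint U * U) * X * W"
      unfolding W_def using U U' V X by (simp add: sq)
    then show "mat_adjoint U * (U * X * mat_adjoint U) * V = X * W"
      using X by (simp add: UU)
    have "mat_adjoint U * (V * X * mat_adjoint V) * V = W * X * (mat_adjoint V * V)"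
      unfolding W_def using U U' V V' X by (simp add: sq)
    then show "mat_adjoint U * (V * X * mat_adjoint V) * V = W * X"
      using X W mult_carrier_mat[OF W X] by (simp add: VV)
  qed
  have bbW: "diagm n (\<lambda>i. complex_of_real (b i) * complex_of_real (b i)) * W = W * diagm n (\<lambda>i. complex_of_real (c i) * complex_of_real (c i))"
    using arg_cong[OF eq, of "\<lambda>X. mat_adjoint U * X * V"]
    unfolding Beq Ceq diagonal_square[OF U UU] diagonal_square[OF V VV]
      conj(1)[OF diagm_carrier] conj(2)[OF diagm_carrier] .
  have ent: "(complex_of_real (b i) * complex_of_real (b i)) * W $$ (i, j) = W $$ (i, j) * (complex_of_real (c j) * complex_of_real (c j))"
    if "i < n" "j < n" for i j
    using arg_cong[OF bbW, of "\<lambda>X. X $$ (i, j)"] unfolding diagm_mult_index[OF W that] .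
  have bc: "b i = c j" if "i < n" "j < n" "W $$ (i, j) \<noteq> 0" for i j
  proof -
    have "complex_of_real (b i) * complex_of_real (b i) = complex_of_real (c j) * complex_of_real (c j)"
      using ent[OF that(1,2)] that(3) by simp
    then have "b i * b i = c j * c j" by (simp flip: of_real_mult)
    then show ?thesis using b c that by (intro power2_eq_imp_eq[of "b i" "c j"]) (auto simp: power2_eq_square)
  qed
  have main: "diagm n (\<lambda>i. complex_of_real (b i)) * W = W * diagm n (\<lambda>i. complex_of_real (c i))"
  proof (rule eq_matI)
    fix i j assume "i < dim_row (W * diagm n (\<lambda>i. complex_of_real (c i)))" "j < dim_col (W * diagm n (\<lambda>i. complex_of_real (c i)))"
    then have ij: "i < n" "j < n" using W by auto
    show "(diagm n (\<lambda>i. complex_of_real (b i)) * W) $$ (i, j) = (W * diagm n (\<lambda>i. complex_of_real (c i))) $$ (i, j)"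
      unfolding diagm_mult_index[OF W ij] using bc[OF ij] by (cases "W $$ (i, j) = 0") auto
  qed (use W in auto)
  have UW: "U * W = V"
  proof -
    have "U * W = (U * mat_adjoint U) * V" unfolding W_def using U U' V by (simp add: sq)
    then show ?thesis using V by (simp add: unitary_left_right[OF U UU])
  qed
  have WV: "W * mat_adjoint V = mat_adjoint U"
  proof -
    have "W * mat_adjoint V = mat_adjoint U * (V * mat_adjoint V)" unfolding W_def using U' V V' by (simp add: sq)
    then show ?thesis using U' by (simp add: unitary_left_right[OF V VV] right_mult_one_mat[of _ n n])
  qed
  have "B = U * (diagm n (\<lambda>i. complex_of_real (b i)) * (W * mat_adjoint V))"
    unfolding Beq WV using U U' by (simp add: sq)
  also have "\<dots> = U * (diagm n (\<lambda>i. complex_of_real (b i)) * W) * mat_adjoint V"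
    using U W V' by (simp add: sq)
  also have "\<dots> = (U * W) * diagm n (\<lambda>i. complex_of_real (c i)) * mat_adjoint V"
    unfolding main using U W V' by (simp add: sq)
  finally show ?thesis unfolding UW Ceq .
qed

section \<open>Singular values through the spectral decomposition\<close>

lemma proots_linear_factors:
  "proots (\<Prod>a\<leftarrow>as. [:- a, 1:]) = mset (as :: complex list)"
proof (induction as)
  case (Cons a as)
  have "(\<Prod>a\<leftarrow>as. [:- a, 1:]) \<noteq> 0" by (auto simp: prod_list_zero_iff)
  then have "proots ([:- a, 1:] * (\<Prod>a\<leftarrow>as. [:- a, 1:])) = {#a#} + mset as"
    by (subst proots_mult) (simp_all only: Cons proots_linear_factor, auto)
  then show ?case by (simp only: list.map prod_list.Cons mset.simps) simp
qed simp

text \<open>The bridge from the definition of \<open>singular_values\<close> to usable algebra. The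
  definite description in \<open>mat_sqrt\<close> is resolved by uniqueness of the root, and the
  sorted list is replaced by an unordered diagonal, which suffices for symmetric functions.\<close>

theorem singular_values_spectral:
  fixes M :: "complex mat"
  assumes M: "M \<in> carrier_mat n n"
  shows "\<exists>U d. U \<in> carrier_mat n n \<and> mat_adjoint U * U = 1\<^sub>m n \<and> (\<forall>i<n. 0 \<le> d i) \<and>
    M * mat_adjoint M = U * diagm n (\<lambda>i. complex_of_real ((d i)\<^sup>2)) * mat_adjoint U \<and>
    mset (singular_values M) = image_mset d (mset_set {..<n})"
proof -
  define A where "A = M * mat_adjoint M"
  have A: "A \<in> carrier_mat n n" using M by (simp add: A_def)
  have "psd_mat A" unfolding A_def by (rule psd_mat_gram[OF M])
  from psd_mat_diagonalized[OF this A] obtain U e where U: "U \<in> carrier_mat n n"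
    and UU: "mat_adjoint U * U = 1\<^sub>m n" and e: "\<forall>i<n. 0 \<le> e i"
    and Aeq: "A = U * diagm n (\<lambda>i. complex_of_real (e i)) * mat_adjoint U" by blast
  define d where "d i = sqrt (e i)" for i
  have d: "\<forall>i<n. 0 \<le> d i" using e by (simp add: d_def)
  define D where "D = diagm n (\<lambda>i. complex_of_real (d i))"
  have D: "D \<in> carrier_mat n n" by (simp add: D_def)
  define B where "B = U * D * mat_adjoint U"
  have U': "mat_adjoint U \<in> carrier_mat n n" using U by simp
  have B: "B \<in> carrier_mat n n" using U U' D by (simp add: B_def mult_carrier_mat[of _ n n _ n])
  have psdB: "psd_mat B" unfolding B_def D_def using d by (intro psd_mat_of_diagonal[OF U UU]) auto
  have dsq: "diagm n (\<lambda>i. complex_of_real (d i) * complex_of_real (d i)) = diagm n (\<lambda>i. complex_of_real (e i))"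
    by (rule eq_matI) (use e in \<open>auto simp: d_def simp flip: of_real_mult\<close>)
  have BB: "B * B = A" unfolding B_def D_def diagonal_square[OF U UU] dsq Aeq ..
  have sqrtA: "mat_sqrt A = B"
    unfolding mat_sqrt_def
  proof (rule the_equality)
    show "psd_mat B \<and> dim_row B = dim_row A \<and> B * B = A" using psdB BB A B by auto
    fix C assume C: "psd_mat C \<and> dim_row C = dim_row A \<and> C * C = A"
    then have "C \<in> carrier_mat n n" using A unfolding psd_mat_def by (auto simp: square_mat.simps)
    then show "C = B" using psd_sqrt_unique[of C n B] C psdB B BB by auto
  qed
  have "similar_mat_wit B D U (mat_adjoint U)"
    by (rule similar_mat_witI[of _ _ n]) (use U U' D B UU unitary_left_right[OF U UU] B_def in auto)
  then have "char_poly B = char_poly D" by (intro char_poly_similar) (auto simp: similar_mat_def)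
  also have "\<dots> = (\<Prod>a\<leftarrow>diag_mat D. [:- a, 1:])"
    by (intro char_poly_upper_triangular[OF D]) (auto simp: D_def upper_triangular_def)
  also have "diag_mat D = map (\<lambda>i. complex_of_real (d i)) [0..<n]"
    by (auto simp: diag_mat_def D_def intro!: map_cong)
  finally have "proots (char_poly B) = mset (map (\<lambda>i. complex_of_real (d i)) [0..<n])"
    by (simp only: proots_linear_factors)
  then have "mset (singular_values M) = image_mset d (mset_set {..<n})"
    unfolding singular_values_def A_def[symmetric] sqrtA
    by (simp add: image_mset.compositionality comp_def atLeast0LessThan del: upt.simps)
  moreover have "A = U * diagm n (\<lambda>i. complex_of_real ((d i)\<^sup>2)) * mat_adjoint U"
    unfolding Aeq using dsq by (simp add: power2_eq_square)
  ultimately show ?thesis using U UU d unfolding A_def[symmetric] by (intro exI[of _ U] exI[of _ d] conjI)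
qed

lemma trace_diagonal_conjugate:
  assumes U: "U \<in> carrier_mat n n" and UU: "mat_adjoint U * U = 1\<^sub>m n"
  shows "(\<Sum>i<n. (U * diagm n e * mat_adjoint U) $$ (i, i)) = (\<Sum>k<n. e k)"
proof -
  have U': "mat_adjoint U \<in> carrier_mat n n" using U by simp
  have UD: "U * diagm n e \<in> carrier_mat n n" using U by (simp add: mult_carrier_mat[of _ n n _ n])
  have "(\<Sum>i<n. (U * diagm n e * mat_adjoint U) $$ (i, i))
      = (\<Sum>i<n. \<Sum>k<n. e k * (mat_adjoint U $$ (k, i) * U $$ (i, k)))"
    by (intro sum.cong refl, subst index_mult_mat_sum[OF UD U'])
       (auto simp: diagm_mult_index[OF U] ac_simps intro!: sum.cong)
  also have "\<dots> = (\<Sum>k<n. e k * (mat_adjoint U * U) $$ (k, k))"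
    by (subst sum.swap) (auto simp: index_mult_mat_sum[OF U' U] sum_distrib_left simp del: index_mult_mat intro!: sum.cong)
  also have "\<dots> = (\<Sum>k<n. e k)" by (simp add: UU)
  finally show ?thesis .
qed

text \<open>Sums over all singular values do not depend on their order, so any enumeration
  \<open>d\<close> may replace the sorted list.\<close>

lemma sum_singular_values:
  assumes mset: "mset (singular_values M) = image_mset d (mset_set {..<n})"
  shows "length (singular_values M) = n"
    and "(\<Sum>k<n. f (singular_values M ! k)) = (\<Sum>i<n. f (d i) :: real)"
proof -
  have "length (singular_values M) = size (mset (singular_values M))" by simp
  then show len: "length (singular_values M) = n" unfolding mset by simp
  have "(\<Sum>k<n. f (singular_values M ! k)) = sum_list (map f (singular_values M))"
    by (simp add: sum_list_sum_nth len atLeast0LessThan)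
  also have "\<dots> = sum_mset (image_mset f (mset (singular_values M)))"
    by (simp flip: sum_mset_sum_list)
  also have "\<dots> = (\<Sum>i<n. f (d i))" unfolding mset by (simp add: image_mset.compositionality sum_unfold_sum_mset comp_def)
  finally show "(\<Sum>k<n. f (singular_values M ! k)) = (\<Sum>i<n. f (d i))" .
qed

lemma singular_value_nonneg:
  assumes M: "M \<in> carrier_mat n n" and k: "k < n"
  shows "0 \<le> singular_values M ! k" and "length (singular_values M) = n"
proof -
  obtain U d where d: "\<forall>i<n. 0 \<le> d i" and ms: "mset (singular_values M) = image_mset d (mset_set {..<n})"
    using singular_values_spectral[OF M] by metis
  show len: "length (singular_values M) = n" by (rule sum_singular_values(1)[OF ms])
  have "singular_values M ! k \<in># mset (singular_values M)" using k len by simp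
  then show "0 \<le> singular_values M ! k" unfolding ms using d by auto
qed

text \<open>Both sides are the trace of \<open>M * mat_adjoint M\<close>. This makes the second
  moment of the singular values explicit in the entries, which yields tightness later.\<close>

lemma sum_singular_values_squared:
  fixes M :: "complex mat"
  assumes M: "M \<in> carrier_mat n n"
  shows "(\<Sum>k<n. (singular_values M ! k)\<^sup>2) = (\<Sum>i<n. \<Sum>j<n. (cmod (M $$ (i, j)))\<^sup>2)"
proof -
  obtain U d where U: "U \<in> carrier_mat n n" "mat_adjoint U * U = 1\<^sub>m n"
    and eq: "M * mat_adjoint M = U * diagm n (\<lambda>i. complex_of_real ((d i)\<^sup>2)) * mat_adjoint U"
    and ms: "mset (singular_values M) = image_mset d (mset_set {..<n})"
    using singular_values_spectral[OF M] by blast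
  have "complex_of_real (\<Sum>k<n. (singular_values M ! k)\<^sup>2) = (\<Sum>i<n. (M * mat_adjoint M) $$ (i, i))"
    unfolding eq trace_diagonal_conjugate[OF U] sum_singular_values(2)[OF ms, of "\<lambda>x. x\<^sup>2"] by simp
  also have "\<dots> = (\<Sum>i<n. \<Sum>j<n. complex_of_real ((cmod (M $$ (i, j)))\<^sup>2))"
    using M by (intro sum.cong refl, subst index_mult_mat_sum[OF M mat_adjoint_carrier[OF M]])
      (auto simp del: of_real_power simp add: complex_norm_square intro!: sum.cong)
  also have "\<dots> = complex_of_real (\<Sum>i<n. \<Sum>j<n. (cmod (M $$ (i, j)))\<^sup>2)" by simp
  finally show ?thesis unfolding of_real_eq_iff .
qed

text \<open>The equation forces \<open>X\<close> to be \<open>c\<close> times an inverse that is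
  diagonal in the eigenbasis of \<open>M * mat_adjoint M\<close>. The factor \<open>c\<close> is
  kept because the upper left block of the Green matrix solves this equation with \<i> t on the
  right.\<close>

lemma trace_resolvent_singular_values:
  fixes M :: "complex mat"
  assumes M: "M \<in> carrier_mat n n" and X: "X \<in> carrier_mat n n" and t: "t > 0"
    and inv: "(M * mat_adjoint M + of_real (t\<^sup>2) \<cdot>\<^sub>m 1\<^sub>m n) * X = c \<cdot>\<^sub>m 1\<^sub>m n"
  shows "(\<Sum>i<n. X $$ (i, i)) = c * of_real (\<Sum>k<n. 1 / ((singular_values M ! k)\<^sup>2 + t\<^sup>2))"
proof -
  obtain U d where U: "U \<in> carrier_mat n n" and UU: "mat_adjoint U * U = 1\<^sub>m n"
    and eq: "M * mat_adjoint M = U * diagm n (\<lambda>i. complex_of_real ((d i)\<^sup>2)) * mat_adjoint U"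
    and ms: "mset (singular_values M) = image_mset d (mset_set {..<n})"
    using singular_values_spectral[OF M] by blast
  have U': "mat_adjoint U \<in> carrier_mat n n" using U by simp
  note UU' = unitary_left_right[OF U UU]
  note sq = assoc_mult_mat[of _ n n _ n _ n] mult_carrier_mat[of _ n n _ n]
  define E where "E = diagm n (\<lambda>i. complex_of_real ((d i)\<^sup>2 + t\<^sup>2))"
  define F where "F = diagm n (\<lambda>i. c * complex_of_real (1 / ((d i)\<^sup>2 + t\<^sup>2)))"
  define F1 where "F1 = diagm n (\<lambda>i. complex_of_real (1 / ((d i)\<^sup>2 + t\<^sup>2)))"
  have E: "E \<in> carrier_mat n n" and F1: "F1 \<in> carrier_mat n n" by (auto simp: E_def F1_def)
  have nz: "(d i)\<^sup>2 + t\<^sup>2 \<noteq> 0" for i using t by (metis add_nonneg_pos less_numeral_extra(3) zero_le_power2 zero_less_power)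
  have FE: "F1 * E = 1\<^sub>m n"
    unfolding F1_def E_def diagm_mult
    by (rule eq_matI) (use t in \<open>auto simp: nz simp flip: of_real_mult simp del: of_real_add of_real_power of_real_divide\<close>)
  have shift: "M * mat_adjoint M + of_real (t\<^sup>2) \<cdot>\<^sub>m 1\<^sub>m n = U * E * mat_adjoint U"
  proof -
    have "U * E * mat_adjoint U = U * (diagm n (\<lambda>i. complex_of_real ((d i)\<^sup>2)) + of_real (t\<^sup>2) \<cdot>\<^sub>m 1\<^sub>m n) * mat_adjoint U"
      by (rule arg_cong[of _ _ "\<lambda>Z. U * Z * mat_adjoint U"]) (auto simp: E_def)
    also have "\<dots> = U * diagm n (\<lambda>i. complex_of_real ((d i)\<^sup>2)) * mat_adjoint U + of_real (t\<^sup>2) \<cdot>\<^sub>m (U * mat_adjoint U)"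
      using U U' by (simp add: add_mult_distrib_mat[of _ n n _ _ n] mult_add_distrib_mat[of _ n n _ n]
          mult_smult_distrib[of _ n n _ n] mult_smult_assoc_mat[of _ n n _ n] mult_carrier_mat[of _ n n _ n]
          right_mult_one_mat[of _ n n])
    finally show ?thesis unfolding UU' eq by simp
  qed
  have "X = (U * (F1 * E) * mat_adjoint U) * X" unfolding FE using U U' X by (simp add: UU' right_mult_one_mat[of _ n n])
  also have "\<dots> = U * F1 * ((mat_adjoint U * U) * E * mat_adjoint U * X)"
    unfolding UU using U U' X E F1 by (simp add: sq left_mult_one_mat[of _ n n])
  also have "\<dots> = U * F1 * mat_adjoint U * ((U * E * mat_adjoint U) * X)"
    using U U' X E F1 by (simp add: sq)
  also have "\<dots> = U * F1 * mat_adjoint U * (c \<cdot>\<^sub>m 1\<^sub>m n)" unfolding shift[symmetric] inv ..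
  also have "\<dots> = c \<cdot>\<^sub>m (U * F1 * mat_adjoint U)"
    using U U' F1 by (simp add: mult_smult_distrib[of _ n n _ n] mult_carrier_mat[of _ n n _ n] right_mult_one_mat[of _ n n])
  finally have Xeq: "X = c \<cdot>\<^sub>m (U * F1 * mat_adjoint U)" .
  have "(\<Sum>i<n. X $$ (i, i)) = (\<Sum>i<n. c * (U * F1 * mat_adjoint U) $$ (i, i))"
    unfolding Xeq using U by (intro sum.cong) auto
  also have "\<dots> = c * (\<Sum>k<n. complex_of_real (1 / ((d k)\<^sup>2 + t\<^sup>2)))"
    unfolding F1_def sum_distrib_left[symmetric] trace_diagonal_conjugate[OF U UU] ..
  also have "(\<Sum>k<n. complex_of_real (1 / ((d k)\<^sup>2 + t\<^sup>2))) = of_real (\<Sum>k<n. 1 / ((singular_values M ! k)\<^sup>2 + t\<^sup>2))"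
    unfolding sum_singular_values(2)[OF ms, of "\<lambda>x. 1 / (x\<^sup>2 + t\<^sup>2)"] by simp
  finally show ?thesis .
qed

lemma singular_value_dist_basic:
  fixes f :: "real \<Rightarrow> real"
  assumes M: "M \<in> carrier_mat n n" and n: "n > 0"
  shows "prob_space (singular_value_dist M)" "sets (singular_value_dist M) = sets borel"
    and "emeasure (singular_value_dist M) {..<0} = 0"
    and "f \<in> borel_measurable borel \<Longrightarrow>
      (LINT s|singular_value_dist M. f s) = (\<Sum>k<n. f (singular_values M ! k)) / real n"
proof -
  have dim: "dim_row M = n" using M by auto
  have meas: "(\<lambda>k. singular_values M ! k) \<in> measurable (uniform_count_measure {..<n}) borel" by simp
  interpret U: prob_space "uniform_count_measure {..<n}"
    using n by (intro prob_space_uniform_count_measure) auto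
  show "prob_space (singular_value_dist M)" unfolding singular_value_dist_def dim
    by (rule U.prob_space_distr[OF meas])
  show "sets (singular_value_dist M) = sets borel" unfolding singular_value_dist_def by simp
  have "(\<lambda>k. singular_values M ! k) -` {..<0} \<inter> {..<n} = {}"
    using singular_value_nonneg(1)[OF M] by force
  then show "emeasure (singular_value_dist M) {..<0} = 0"
    unfolding singular_value_dist_def dim by (subst emeasure_distr[OF meas]) (auto simp: space_uniform_count_measure)
  show "(LINT s|singular_value_dist M. f s) = (\<Sum>k<n. f (singular_values M ! k)) / real n"
    if "f \<in> borel_measurable borel"
    unfolding singular_value_dist_def dim integral_distr[OF meas that]
    by (subst integral_uniform_count_measure) auto
qed

section \<open>Resolvents of Hermitian matrices\<close>

lemma diagonal_conjugate_index:
  assumes U: "U \<in> carrier_mat n n" and ij: "i < n" "j < n"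
  shows "(U * diagm n e * mat_adjoint U) $$ (i, j) = (\<Sum>k<n. U $$ (i, k) * e k * cnj (U $$ (j, k)))"
proof -
  have U': "mat_adjoint U \<in> carrier_mat n n" using U by simp
  have UD: "U * diagm n e \<in> carrier_mat n n" using U by (simp add: mult_carrier_mat[of _ n n _ n])
  show ?thesis
    by (subst index_mult_mat_sum[OF UD U' ij])
       (use U ij in \<open>auto simp: diagm_mult_index(2)[OF U] simp del: index_mult_mat intro!: sum.cong\<close>)
qed

lemma diagonal_conjugate_mult:
  assumes U: "U \<in> carrier_mat n n" and UU: "mat_adjoint U * U = 1\<^sub>m n"
  shows "(U * diagm n d * mat_adjoint U) * (U * diagm n e * mat_adjoint U)
    = U * diagm n (\<lambda>i. d i * e i) * mat_adjoint U"
proof -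
  have U': "mat_adjoint U \<in> carrier_mat n n" using U by simp
  have "(U * diagm n d * mat_adjoint U) * (U * diagm n e * mat_adjoint U)
    = U * (diagm n d * ((mat_adjoint U * U) * diagm n e)) * mat_adjoint U"
    using U U' by (simp add: assoc_mult_mat[of _ n n _ n _ n] mult_carrier_mat[of _ n n _ n])
  then show ?thesis unfolding UU by (simp add: left_mult_one_mat[of _ n n] diagm_mult)
qed

lemma sum_row_squared:
  fixes G :: "complex mat"
  assumes G: "G \<in> carrier_mat n n" and i: "i < n"
  shows "complex_of_real (\<Sum>q<n. (cmod (G $$ (i, q)))\<^sup>2) = (G * mat_adjoint G) $$ (i, i)"
    and "complex_of_real (\<Sum>q<n. (cmod (G $$ (q, i)))\<^sup>2) = (mat_adjoint G * G) $$ (i, i)"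
proof -
  show "complex_of_real (\<Sum>q<n. (cmod (G $$ (i, q)))\<^sup>2) = (G * mat_adjoint G) $$ (i, i)"
    unfolding index_mult_mat_sum[OF G mat_adjoint_carrier[OF G] i i] of_real_sum complex_norm_square
    using G i by (intro sum.cong) auto
  show "complex_of_real (\<Sum>q<n. (cmod (G $$ (q, i)))\<^sup>2) = (mat_adjoint G * G) $$ (i, i)"
    unfolding index_mult_mat_sum[OF mat_adjoint_carrier[OF G] G i i] of_real_sum complex_norm_square
    using G i by (intro sum.cong) auto
qed

text \<open>In an eigenbasis the inverse is the diagonal of 1 / (d i - \<i> t), whose moduli are at
  most 1 / t. The squared row and column norms are the diagonal entries of
  \<open>G * mat_adjoint G\<close> and \<open>mat_adjoint G * G\<close>, hence the two
  bounds.\<close>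

lemma hermitian_resolvent_exists:
  fixes H :: "complex mat"
  assumes H: "H \<in> carrier_mat n n" and herm: "mat_adjoint H = H" and t: "t > 0"
  shows "\<exists>G. G \<in> carrier_mat n n \<and> (H - (\<i> * of_real t) \<cdot>\<^sub>m 1\<^sub>m n) * G = 1\<^sub>m n \<and>
    G * (H - (\<i> * of_real t) \<cdot>\<^sub>m 1\<^sub>m n) = 1\<^sub>m n \<and>
    (\<forall>p<n. (\<Sum>q<n. (cmod (G $$ (p, q)))\<^sup>2) \<le> 1 / t\<^sup>2) \<and>
    (\<forall>p<n. (\<Sum>q<n. (cmod (G $$ (q, p)))\<^sup>2) \<le> 1 / t\<^sup>2)"
proof -
  obtain U d where U: "U \<in> carrier_mat n n" and UU: "mat_adjoint U * U = 1\<^sub>m n"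
    and Heq: "H = U * diagm n (\<lambda>i. complex_of_real (d i)) * mat_adjoint U"
    using hermitian_spectral[OF H herm] by blast
  have U': "mat_adjoint U \<in> carrier_mat n n" using U by simp
  note UU' = unitary_left_right[OF U UU]
  define w where "w i = complex_of_real (d i) - \<i> * of_real t" for i
  have w0: "w i \<noteq> 0" for i using t by (auto simp: w_def complex_eq_iff)
  have wn: "1 / (cmod (w i))\<^sup>2 \<le> 1 / t\<^sup>2" for i
  proof -
    have "(cmod (w i))\<^sup>2 = (d i)\<^sup>2 + t\<^sup>2" by (simp add: w_def cmod_power2)
    then show ?thesis using t by (intro divide_left_mono mult_pos_pos) (auto intro: add_nonneg_pos)
  qed
  have one: "1\<^sub>m n = U * diagm n (\<lambda>i. 1) * mat_adjoint U"
  proof -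
    have "diagm n (\<lambda>i. 1) = 1\<^sub>m n" by (rule eq_matI) auto
    then show ?thesis using U UU' by (simp add: right_mult_one_mat[of _ n n])
  qed
  have shift: "H - (\<i> * of_real t) \<cdot>\<^sub>m 1\<^sub>m n = U * diagm n w * mat_adjoint U"
  proof (rule eq_matI)
    fix i j assume "i < dim_row (U * diagm n w * mat_adjoint U)" "j < dim_col (U * diagm n w * mat_adjoint U)"
    then have ij: "i < n" "j < n" using U by auto
    have "(H - (\<i> * of_real t) \<cdot>\<^sub>m 1\<^sub>m n) $$ (i, j) = H $$ (i, j) - \<i> * of_real t * (1\<^sub>m n) $$ (i, j)"
      using ij H by auto
    also have "\<dots> = (U * diagm n w * mat_adjoint U) $$ (i, j)"
      unfolding one Heq diagonal_conjugate_index[OF U ij] w_def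
      by (simp add: algebra_simps sum_subtractf sum_distrib_left)
    finally show "(H - (\<i> * of_real t) \<cdot>\<^sub>m 1\<^sub>m n) $$ (i, j) = (U * diagm n w * mat_adjoint U) $$ (i, j)" .
  qed (use U H in auto)
  define G where "G = U * diagm n (\<lambda>i. 1 / w i) * mat_adjoint U"
  have G: "G \<in> carrier_mat n n" using U U' by (simp add: G_def mult_carrier_mat[of _ n n _ n])
  have G': "mat_adjoint G = U * diagm n (\<lambda>i. cnj (1 / w i)) * mat_adjoint U"
  proof -
    have UD: "U * diagm n (\<lambda>i. 1 / w i) \<in> carrier_mat n n" using U by (simp add: mult_carrier_mat[of _ n n _ n])
    show ?thesis unfolding G_def mat_adjoint_mult[OF UD U'] mat_adjoint_mult[OF U diagm_carrier] mat_adjoint_diagm mat_adjoint_adjoint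
      using U U' by (simp add: assoc_mult_mat[of _ n n _ n _ n])
  qed
  have L: "(H - (\<i> * of_real t) \<cdot>\<^sub>m 1\<^sub>m n) * G = 1\<^sub>m n" "G * (H - (\<i> * of_real t) \<cdot>\<^sub>m 1\<^sub>m n) = 1\<^sub>m n"
    unfolding shift G_def diagonal_conjugate_mult[OF U UU] using one by (simp_all add: w0)
  have diag: "Re ((U * diagm n e * mat_adjoint U) $$ (p, p)) \<le> 1 / t\<^sup>2"
    if p: "p < n" and e: "\<And>i. e i = of_real (1 / (cmod (w i))\<^sup>2)" for p e
  proof -
    have *: "Re ((U * diagm n (\<lambda>i. of_real (g i)) * mat_adjoint U) $$ (p, p)) = (\<Sum>k<n. g k * (cmod (U $$ (p, k)))\<^sup>2)" for g
      unfolding diagonal_conjugate_index[OF U p p] Re_sum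
      by (intro sum.cong refl) (simp add: cmod_power2, simp add: power2_eq_square algebra_simps)
    have "Re ((U * diagm n e * mat_adjoint U) $$ (p, p)) = (\<Sum>k<n. 1 / (cmod (w k))\<^sup>2 * (cmod (U $$ (p, k)))\<^sup>2)"
      unfolding e by (rule *)
    also have "\<dots> \<le> (\<Sum>k<n. 1 / t\<^sup>2 * (cmod (U $$ (p, k)))\<^sup>2)"
      by (intro sum_mono mult_right_mono wn) auto
    also have "\<dots> = 1 / t\<^sup>2 * (\<Sum>k<n. 1 * (cmod (U $$ (p, k)))\<^sup>2)" by (simp add: sum_distrib_left)
    also have "(\<Sum>k<n. 1 * (cmod (U $$ (p, k)))\<^sup>2) = Re ((U * diagm n (\<lambda>i. of_real 1) * mat_adjoint U) $$ (p, p))"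
      by (rule *[symmetric])
    also have "\<dots> = 1" using arg_cong[OF one, of "\<lambda>X. Re (X $$ (p, p))"] p by simp
    finally show ?thesis by simp
  qed
  have inv: "1 / w i * cnj (1 / w i) = of_real (1 / (cmod (w i))\<^sup>2)" "cnj (1 / w i) * (1 / w i) = of_real (1 / (cmod (w i))\<^sup>2)" for i
    unfolding of_real_divide of_real_1 complex_norm_square by simp_all
  have rows: "(\<Sum>q<n. (cmod (G $$ (p, q)))\<^sup>2) \<le> 1 / t\<^sup>2" if p: "p < n" for p
  proof -
    have "(\<Sum>q<n. (cmod (G $$ (p, q)))\<^sup>2) = Re ((G * mat_adjoint G) $$ (p, p))"
      using sum_row_squared(1)[OF G p] by (metis Re_complex_of_real)
    also have "\<dots> \<le> 1 / t\<^sup>2"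
      unfolding G' unfolding G_def diagonal_conjugate_mult[OF U UU] by (rule diag[OF p inv(1)])
    finally show ?thesis .
  qed
  have cols: "(\<Sum>q<n. (cmod (G $$ (q, p)))\<^sup>2) \<le> 1 / t\<^sup>2" if p: "p < n" for p
  proof -
    have "(\<Sum>q<n. (cmod (G $$ (q, p)))\<^sup>2) = Re ((mat_adjoint G * G) $$ (p, p))"
      using sum_row_squared(2)[OF G p] by (metis Re_complex_of_real)
    also have "\<dots> \<le> 1 / t\<^sup>2"
      unfolding G' unfolding G_def diagonal_conjugate_mult[OF U UU] by (rule diag[OF p inv(2)])
    finally show ?thesis .
  qed
  show ?thesis using G L rows cols by blast
qed

text \<open>A two-sided inverse is unique, so the choice operator picks a definite matrix; bundling
  the norm bounds into the property makes them available at once.\<close>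

definition resolvent :: "nat \<Rightarrow> complex mat \<Rightarrow> real \<Rightarrow> complex mat" where
  "resolvent n H t = (SOME G. G \<in> carrier_mat n n \<and> (H - (\<i> * of_real t) \<cdot>\<^sub>m 1\<^sub>m n) * G = 1\<^sub>m n \<and>
    G * (H - (\<i> * of_real t) \<cdot>\<^sub>m 1\<^sub>m n) = 1\<^sub>m n \<and>
    (\<forall>p<n. (\<Sum>q<n. (cmod (G $$ (p, q)))\<^sup>2) \<le> 1 / t\<^sup>2) \<and>
    (\<forall>p<n. (\<Sum>q<n. (cmod (G $$ (q, p)))\<^sup>2) \<le> 1 / t\<^sup>2))"

lemma resolvent:
  assumes "H \<in> carrier_mat n n" "mat_adjoint H = H" "t > 0"
  shows "resolvent n H t \<in> carrier_mat n n"
    and "(H - (\<i> * of_real t) \<cdot>\<^sub>m 1\<^sub>m n) * resolvent n H t = 1\<^sub>m n"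
    and "resolvent n H t * (H - (\<i> * of_real t) \<cdot>\<^sub>m 1\<^sub>m n) = 1\<^sub>m n"
    and "p < n \<Longrightarrow> (\<Sum>q<n. (cmod (resolvent n H t $$ (p, q)))\<^sup>2) \<le> 1 / t\<^sup>2"
    and "p < n \<Longrightarrow> (\<Sum>q<n. (cmod (resolvent n H t $$ (q, p)))\<^sup>2) \<le> 1 / t\<^sup>2"
  using someI_ex[OF hermitian_resolvent_exists[OF assms], folded resolvent_def] by auto

text \<open>With S the spectral shift, K - H = (K - S) - (H - S); multiplying by the two inverses
  from left and right gives G - F.\<close>

lemma resolvent_identity:
  assumes H: "H \<in> carrier_mat n n" "mat_adjoint H = H" and K: "K \<in> carrier_mat n n" "mat_adjoint K = K" and t: "t > 0"
    and pq: "p < n" "q < n"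
  shows "resolvent n H t $$ (p, q) - resolvent n K t $$ (p, q)
    = (\<Sum>k<n. \<Sum>l<n. resolvent n H t $$ (p, k) * (K $$ (k, l) - H $$ (k, l)) * resolvent n K t $$ (l, q))"
proof -
  define G where "G = resolvent n H t"
  define F where "F = resolvent n K t"
  define S where "S = (\<i> * of_real t) \<cdot>\<^sub>m (1\<^sub>m n :: complex mat)"
  have S: "S \<in> carrier_mat n n" by (simp add: S_def)
  note R = resolvent[OF H t, folded G_def S_def] resolvent[OF K t, folded F_def S_def]
  have G: "G \<in> carrier_mat n n" and F: "F \<in> carrier_mat n n" using R by auto
  have KS: "K - S \<in> carrier_mat n n" and HS: "H - S \<in> carrier_mat n n" using S by auto
  have KH: "K - H \<in> carrier_mat n n" and KHF: "(K - H) * F \<in> carrier_mat n n" using H F by auto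
  have "K - H = (K - S) - (H - S)" using H K S by (intro eq_matI) auto
  then have "G * ((K - H) * F) = G * ((K - S) * F) - G * (H - S) * F"
    using G F KS HS by (simp add: minus_mult_distrib_mat[of _ n n _ _ n] mult_minus_distrib_mat[of _ n n _ n]
        assoc_mult_mat[of _ n n _ n _ n] mult_carrier_mat[of _ n n _ n])
  also have "\<dots> = G - F" using R G F by (simp add: right_mult_one_mat[of _ n n] left_mult_one_mat[of _ n n])
  finally have eq: "G - F = G * ((K - H) * F)" by simp
  have "G $$ (p, q) - F $$ (p, q) = (G - F) $$ (p, q)" using F pq by simp
  also have "\<dots> = (\<Sum>k<n. \<Sum>l<n. G $$ (p, k) * (K $$ (k, l) - H $$ (k, l)) * F $$ (l, q))"
    unfolding eq index_mult_mat_sum[OF G KHF pq]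
    by (intro sum.cong refl, subst index_mult_mat_sum[OF KH F])
       (use pq H in \<open>auto simp: sum_distrib_left mult.assoc intro!: sum.cong\<close>)
  finally show ?thesis unfolding G_def F_def .
qed

section \<open>The Hermitization and its resolvent\<close>

text \<open>The array is a function on index pairs, so that permuting it, and exchanging two of its
  entries, is composition.\<close>

definition shifted_mat :: "nat \<Rightarrow> complex \<Rightarrow> (nat \<times> nat \<Rightarrow> real) \<Rightarrow> complex mat" where
  "shifted_mat n z X = mat n n (\<lambda>(i, j). of_real (X (i, j) / sqrt (real n)) - (if i = j then z else 0))"

text \<open>The block matrix with zero diagonal blocks, \<open>M\<close> above and its adjoint
  below. Indices below \<open>n\<close> belong to the first block, \<open>n + j\<close> to the
  second. Being Hermitian, it has a resolvent at \<i> t for every positive t, although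
  \<open>M\<close> itself need not be normal.\<close>

definition hermitize :: "nat \<Rightarrow> complex mat \<Rightarrow> complex mat" where
  "hermitize n M = mat (2 * n) (2 * n) (\<lambda>(p, q).
     if p < n \<and> n \<le> q then M $$ (p, q - n)
     else if n \<le> p \<and> q < n then cnj (M $$ (q, p - n)) else 0)"

definition green :: "nat \<Rightarrow> complex \<Rightarrow> real \<Rightarrow> (nat \<times> nat \<Rightarrow> real) \<Rightarrow> nat \<Rightarrow> nat \<Rightarrow> complex" where
  "green n z t X p q = resolvent (2 * n) (hermitize n (shifted_mat n z X)) t $$ (p, q)"

text \<open>For \<open>F = G\<close> this is \<open>- sqrt n\<close> times the derivative of \<open>G p q\<close> in the array entry \<open>c\<close>, which
  occurs in both off-diagonal blocks of the Hermitization.\<close>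

definition pair_kernel :: "nat \<Rightarrow> (nat \<Rightarrow> nat \<Rightarrow> complex) \<Rightarrow> (nat \<Rightarrow> nat \<Rightarrow> complex) \<Rightarrow> nat \<times> nat \<Rightarrow> nat \<Rightarrow> nat \<Rightarrow> complex" where
  "pair_kernel n G F c p q = G p (fst c) * F (n + snd c) q + G p (n + snd c) * F (fst c) q"

text \<open>The offsets \<open>r\<close> and \<open>s\<close>, each 0 or \<open>n\<close>, select
  one of the four blocks: (0, 0) gives the quantity g of the overview and (n, 0) gives b.\<close>

definition partial_trace :: "nat \<Rightarrow> nat \<Rightarrow> nat \<Rightarrow> (nat \<Rightarrow> nat \<Rightarrow> complex) \<Rightarrow> complex" where
  "partial_trace n r s G = (\<Sum>i<n. G (r + i) (s + i)) / of_nat n"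

lemma hermitize_carrier [simp]: "hermitize n M \<in> carrier_mat (2 * n) (2 * n)"
  by (simp add: hermitize_def)

lemma hermitize_hermitian [simp]: "mat_adjoint (hermitize n M) = hermitize n M"
proof (rule eq_matI)
  fix p q assume "p < dim_row (hermitize n M)" "q < dim_col (hermitize n M)"
  then have pq: "p < 2 * n" "q < 2 * n" by (auto simp: hermitize_def)
  then have "mat_adjoint (hermitize n M) $$ (p, q) = cnj (hermitize n M $$ (q, p))"
    by (intro mat_adjoint_index) (auto simp: hermitize_def)
  also have "\<dots> = hermitize n M $$ (p, q)" using pq by (auto simp: hermitize_def)
  finally show "mat_adjoint (hermitize n M) $$ (p, q) = hermitize n M $$ (p, q)" .
qed (auto simp: hermitize_def)

lemma sum_double:
  fixes f :: "nat \<Rightarrow> 'a::comm_monoid_add"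
  shows "(\<Sum>k<2 * n. f k) = (\<Sum>i<n. f i) + (\<Sum>j<n. f (n + j))"
proof -
  have "(\<Sum>k<2 * n. f k) = sum f {0..<n} + sum f {0 + n..<n + n}"
    using sum.atLeastLessThan_concat[of 0 n "n + n" f] by (simp add: atLeast0LessThan mult_2)
  also have "sum f {0 + n..<n + n} = (\<Sum>j<n. f (n + j))"
    unfolding sum.shift_bounds_nat_ivl by (simp add: atLeast0LessThan add.commute)
  finally show ?thesis by (simp add: atLeast0LessThan)
qed

lemma shifted_mat_carrier [simp]: "shifted_mat n z X \<in> carrier_mat n n"
  by (simp add: shifted_mat_def)

lemma shifted_mat_dim [simp]: "dim_row (shifted_mat n z X) = n" "dim_col (shifted_mat n z X) = n"
  by (simp_all add: shifted_mat_def)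

lemma hermitize_index:
  assumes "i < n" "j < n"
  shows "hermitize n M $$ (i, j) = 0" "hermitize n M $$ (i, n + j) = M $$ (i, j)"
    "hermitize n M $$ (n + j, i) = cnj (M $$ (i, j))" "hermitize n M $$ (n + i, n + j) = 0"
  using assms by (auto simp: hermitize_def)

locale hermitized =
  fixes n :: nat and z :: complex and t :: real
  assumes n: "n > 0" and t: "t > 0"
begin

abbreviation "G \<equiv> green n z t"
abbreviation "M \<equiv> shifted_mat n z"
abbreviation "W \<equiv> pair_kernel n"
abbreviation "tr \<equiv> partial_trace n"

section \<open>Norm bounds for the Green matrix\<close>

lemma green_row: "p < 2 * n \<Longrightarrow> (\<Sum>q<2 * n. (cmod (G X p q))\<^sup>2) \<le> 1 / t\<^sup>2"
  and green_col: "p < 2 * n \<Longrightarrow> (\<Sum>q<2 * n. (cmod (G X q p))\<^sup>2) \<le> 1 / t\<^sup>2"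
  unfolding green_def by (rule resolvent[OF hermitize_carrier hermitize_hermitian t], assumption)+

lemma sum_shift_le:
  assumes "r \<le> n" "\<And>q. 0 \<le> f q"
  shows "(\<Sum>i<n. f (r + i)) \<le> (\<Sum>q<2 * n. f q :: real)"
proof -
  have "(\<Sum>i<n. f (r + i)) = (\<Sum>q\<in>(+) r ` {..<n}. f q)" by (simp add: sum.reindex inj_on_def)
  also have "\<dots> \<le> (\<Sum>q<2 * n. f q)" using assms by (intro sum_mono2) auto
  finally show ?thesis .
qed

lemma green_row_part: "p < 2 * n \<Longrightarrow> r \<le> n \<Longrightarrow> (\<Sum>i<n. (cmod (G X p (r + i)))\<^sup>2) \<le> 1 / t\<^sup>2"
  using sum_shift_le[of r "\<lambda>q. (cmod (G X p q))\<^sup>2"] green_row[of p X] by simp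

lemma green_col_part: "p < 2 * n \<Longrightarrow> r \<le> n \<Longrightarrow> (\<Sum>i<n. (cmod (G X (r + i) p))\<^sup>2) \<le> 1 / t\<^sup>2"
  using sum_shift_le[of r "\<lambda>q. (cmod (G X q p))\<^sup>2"] green_col[of p X] by simp

lemma green_le:
  assumes "p < 2 * n" "q < 2 * n"
  shows "cmod (G X p q) \<le> 1 / t"
proof -
  have "(cmod (G X p q))\<^sup>2 \<le> (\<Sum>q<2 * n. (cmod (G X p q))\<^sup>2)"
    using assms by (intro member_le_sum) auto
  also have "\<dots> \<le> (1 / t)\<^sup>2" using green_row[OF assms(1)] by (simp add: power_one_over)
  finally show ?thesis by (rule power2_le_imp_le) (use t in simp)
qed

lemma cauchy_schwarz_sum:
  fixes u v :: "nat \<Rightarrow> complex"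
  assumes "(\<Sum>i<m. (cmod (u i))\<^sup>2) \<le> 1 / t\<^sup>2" "(\<Sum>i<m. (cmod (v i))\<^sup>2) \<le> 1 / t\<^sup>2"
  shows "(\<Sum>i<m. cmod (u i) * cmod (v i)) \<le> 1 / t\<^sup>2"
proof -
  have "cmod (u i) * cmod (v i) \<le> ((cmod (u i))\<^sup>2 + (cmod (v i))\<^sup>2) / 2" for i
    using sum_squares_bound[of "cmod (u i)" "cmod (v i)"] by simp
  then have "(\<Sum>i<m. cmod (u i) * cmod (v i)) \<le> (\<Sum>i<m. ((cmod (u i))\<^sup>2 + (cmod (v i))\<^sup>2) / 2)"
    by (rule sum_mono)
  also have "\<dots> = ((\<Sum>i<m. (cmod (u i))\<^sup>2) + (\<Sum>i<m. (cmod (v i))\<^sup>2)) / 2"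
    by (simp only: sum.distrib sum_divide_distrib[symmetric])
  also have "\<dots> \<le> 1 / t\<^sup>2"
  proof -
    have "(a + b) / 2 \<le> c" if "a \<le> c" "b \<le> c" for a b c :: real using that by (simp add: field_simps)
    from this[OF assms] show ?thesis .
  qed
  finally show ?thesis .
qed

lemma l1_bound:
  assumes "(\<Sum>i<n. (cmod (u i))\<^sup>2) \<le> 1 / t\<^sup>2"
  shows "(\<Sum>i<n. cmod (u i)) \<le> sqrt (real n) / t"
proof -
  have "(\<Sum>i<n. cmod (u i))\<^sup>2 \<le> real n * (\<Sum>i<n. (cmod (u i))\<^sup>2)"
    using sum_squared_le_sum_of_squares[of "\<lambda>i. cmod (u i)" "{..<n}"] by (simp add: mult.commute)
  also have "\<dots> \<le> real n * (1 / t\<^sup>2)" using assms by (intro mult_left_mono) auto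
  also have "\<dots> = (sqrt (real n) / t)\<^sup>2" by (simp add: power_divide)
  finally show ?thesis by (rule power2_le_imp_le) (use t in simp)
qed

text \<open>There are n^2 terms, each only known to be bounded, but two vectors of l^2 norm at most
  1 / t have l^1 norms of order sqrt n. The gained factor n is what makes off-diagonal contributions
  negligible.\<close>

lemma l1_product:
  assumes "(\<Sum>i<n. (cmod (u i))\<^sup>2) \<le> 1 / t\<^sup>2" "(\<Sum>i<n. (cmod (v i))\<^sup>2) \<le> 1 / t\<^sup>2"
  shows "(\<Sum>i<n. \<Sum>j<n. cmod (u i) * cmod (v j)) \<le> real n / t\<^sup>2"
proof -
  have "(\<Sum>i<n. \<Sum>j<n. cmod (u i) * cmod (v j)) = (\<Sum>i<n. cmod (u i)) * (\<Sum>j<n. cmod (v j))"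
    by (simp add: sum_product)
  also have "\<dots> \<le> (sqrt (real n) / t) * (sqrt (real n) / t)"
    using t by (intro mult_mono l1_bound assms sum_nonneg) auto
  finally show ?thesis by (simp add: power2_eq_square)
qed

section \<open>Block equations and perturbation of the Green matrix\<close>

lemma green_upper:
  assumes i: "i < n" and q: "q < 2 * n"
  shows "(\<Sum>j<n. M X $$ (i, j) * G X (n + j) q) - \<i> * of_real t * G X i q = (if i = q then 1 else 0)"
proof -
  note R = resolvent[OF hermitize_carrier[of n "M X"] hermitize_hermitian t]
  define H where "H = hermitize n (M X)"
  have HS: "H - (\<i> * of_real t) \<cdot>\<^sub>m 1\<^sub>m (2 * n) \<in> carrier_mat (2 * n) (2 * n)" by auto
  have "(if i = q then 1 else 0) = ((H - (\<i> * of_real t) \<cdot>\<^sub>m 1\<^sub>m (2 * n)) * resolvent (2 * n) H t) $$ (i, q)"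
    using R(2) i q unfolding H_def by auto
  also have "\<dots> = (\<Sum>k<2 * n. (H $$ (i, k) - \<i> * of_real t * (if i = k then 1 else 0)) * G X k q)"
    using i q R(1) by (subst index_mult_mat_sum[OF HS]) (auto simp: green_def H_def intro!: sum.cong)
  also have "\<dots> = (\<Sum>k<2 * n. H $$ (i, k) * G X k q) - (\<Sum>k<2 * n. if k = i then \<i> * of_real t * G X k q else 0)"
    unfolding sum_subtractf[symmetric] by (intro sum.cong) (auto simp: algebra_simps)
  also have "\<dots> = (\<Sum>j<n. M X $$ (i, j) * G X (n + j) q) - \<i> * of_real t * G X i q"
    unfolding sum_double[of "\<lambda>k. H $$ (i, k) * G X k q"] using i by (simp add: H_def hermitize_index)
  finally show ?thesis by simp
qed

lemma green_lower:
  assumes i: "i < n" and q: "q < 2 * n"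
  shows "(\<Sum>j<n. cnj (M X $$ (j, i)) * G X j q) - \<i> * of_real t * G X (n + i) q = (if n + i = q then 1 else 0)"
proof -
  note R = resolvent[OF hermitize_carrier[of n "M X"] hermitize_hermitian t]
  define H where "H = hermitize n (M X)"
  have HS: "H - (\<i> * of_real t) \<cdot>\<^sub>m 1\<^sub>m (2 * n) \<in> carrier_mat (2 * n) (2 * n)" by auto
  have i': "n + i < 2 * n" using i by simp
  have "(if n + i = q then 1 else 0) = ((H - (\<i> * of_real t) \<cdot>\<^sub>m 1\<^sub>m (2 * n)) * resolvent (2 * n) H t) $$ (n + i, q)"
    using R(2) i' q unfolding H_def by auto
  also have "\<dots> = (\<Sum>k<2 * n. (H $$ (n + i, k) - \<i> * of_real t * (if n + i = k then 1 else 0)) * G X k q)"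
    using i' q R(1) by (subst index_mult_mat_sum[OF HS]) (auto simp: green_def H_def intro!: sum.cong)
  also have "\<dots> = (\<Sum>k<2 * n. H $$ (n + i, k) * G X k q) - (\<Sum>k<2 * n. if k = n + i then \<i> * of_real t * G X k q else 0)"
    unfolding sum_subtractf[symmetric] by (intro sum.cong) (auto simp: algebra_simps)
  also have "\<dots> = (\<Sum>j<n. cnj (M X $$ (j, i)) * G X j q) - \<i> * of_real t * G X (n + i) q"
    unfolding sum_double[of "\<lambda>k. H $$ (n + i, k) * G X k q"] using i by (simp add: H_def hermitize_index)
  finally show ?thesis by simp
qed

text \<open>This comes from multiplying the shifted Hermitization from the other side than in
  \<open>green_upper\<close>; comparing the two identifies the traces of the diagonal
  blocks.\<close>

lemma green_right:
  assumes j: "j < n" and p: "p < 2 * n"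
  shows "(\<Sum>i<n. G X p i * M X $$ (i, j)) - \<i> * of_real t * G X p (n + j) = (if p = n + j then 1 else 0)"
proof -
  note R = resolvent[OF hermitize_carrier[of n "M X"] hermitize_hermitian t]
  define H where "H = hermitize n (M X)"
  have HS: "H - (\<i> * of_real t) \<cdot>\<^sub>m 1\<^sub>m (2 * n) \<in> carrier_mat (2 * n) (2 * n)" by auto
  have j': "n + j < 2 * n" using j by simp
  have "(if p = n + j then 1 else 0) = (resolvent (2 * n) H t * (H - (\<i> * of_real t) \<cdot>\<^sub>m 1\<^sub>m (2 * n))) $$ (p, n + j)"
    using R(3) j' p unfolding H_def by auto
  also have "\<dots> = (\<Sum>k<2 * n. G X p k * (H $$ (k, n + j) - \<i> * of_real t * (if n + j = k then 1 else 0)))"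
    using j' p R(1) by (subst index_mult_mat_sum[OF _ HS]) (auto simp: green_def H_def intro!: sum.cong)
  also have "\<dots> = (\<Sum>k<2 * n. G X p k * H $$ (k, n + j)) - (\<Sum>k<2 * n. if k = n + j then \<i> * of_real t * G X p k else 0)"
    unfolding sum_subtractf[symmetric] by (intro sum.cong) (auto simp: algebra_simps)
  also have "\<dots> = (\<Sum>i<n. G X p i * M X $$ (i, j)) - \<i> * of_real t * G X p (n + j)"
    unfolding sum_double[of "\<lambda>k. G X p k * H $$ (k, n + j)"] using j by (simp add: H_def hermitize_index)
  finally show ?thesis by simp
qed

text \<open>In the resolvent identity the shift by \<open>z\<close> cancels, and the real increments
  of the array occur in both off-diagonal blocks; these two occurrences are the two products in
  \<open>pair_kernel\<close>.\<close>

lemma green_difference: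
  assumes pq: "p < 2 * n" "q < 2 * n"
  shows "G X p q - G Y p q
    = (\<Sum>c\<in>{..<n} \<times> {..<n}. of_real ((Y c - X c) / sqrt (real n)) * W (G X) (G Y) c p q)"
proof -
  define H where "H = hermitize n (M X)"
  define K where "K = hermitize n (M Y)"
  define d where "d i j = complex_of_real ((Y (i, j) - X (i, j)) / sqrt (real n))" for i j
  have MM: "M Y $$ (i, j) - M X $$ (i, j) = d i j" if "i < n" "j < n" for i j
    using that by (simp add: shifted_mat_def d_def diff_divide_distrib)
  have MM': "cnj (M Y $$ (i, j)) - cnj (M X $$ (i, j)) = d i j" if "i < n" "j < n" for i j
    using arg_cong[OF MM[OF that], of cnj] by (simp add: d_def)
  have "G X p q - G Y p q = (\<Sum>k<2 * n. \<Sum>l<2 * n. G X p k * (K $$ (k, l) - H $$ (k, l)) * G Y l q)"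
    unfolding green_def H_def K_def
    by (rule resolvent_identity[OF hermitize_carrier hermitize_hermitian hermitize_carrier hermitize_hermitian t pq])
  also have "\<dots> = (\<Sum>i<n. \<Sum>j<n. G X p i * d i j * G Y (n + j) q) + (\<Sum>j<n. \<Sum>i<n. G X p (n + j) * d i j * G Y i q)"
    unfolding sum_double H_def K_def
    by (intro arg_cong2[of _ _ _ _ "(+)"] sum.cong refl) (simp_all add: hermitize_index MM MM')
  also have "(\<Sum>j<n. \<Sum>i<n. G X p (n + j) * d i j * G Y i q) = (\<Sum>i<n. \<Sum>j<n. G X p (n + j) * d i j * G Y i q)"
    by (rule sum.swap)
  also have "(\<Sum>i<n. \<Sum>j<n. G X p i * d i j * G Y (n + j) q) + \<dots> = (\<Sum>i<n. \<Sum>j<n. d i j * W (G X) (G Y) (i, j) p q)"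
    unfolding sum.distrib[symmetric] by (intro sum.cong refl) (simp add: pair_kernel_def algebra_simps)
  finally show ?thesis by (simp add: sum.cartesian_product d_def split_def)
qed

text \<open>An exchange alters two entries by opposite amounts, so only two terms of
  \<open>green_difference\<close> survive. The formula is exact; the price is that the second factor
  is taken at the exchanged array.\<close>

lemma green_swap:
  assumes pq: "p < 2 * n" "q < 2 * n" and a: "a \<in> {..<n} \<times> {..<n}" and b: "b \<in> {..<n} \<times> {..<n}"
  shows "G X p q - G (X \<circ> Transposition.transpose a b) p q
    = of_real ((X b - X a) / sqrt (real n)) *
      (W (G X) (G (X \<circ> Transposition.transpose a b)) a p q - W (G X) (G (X \<circ> Transposition.transpose a b)) b p q)"
    (is "_ = of_real ?d * (?W a - ?W b)")
proof -
  define V where "V c = ?W c" for c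
  have "G X p q - G (X \<circ> Transposition.transpose a b) p q
    = (\<Sum>c\<in>{..<n} \<times> {..<n}. of_real (((X \<circ> Transposition.transpose a b) c - X c) / sqrt (real n)) * V c)"
    unfolding V_def by (rule green_difference[OF pq])
  also have "\<dots> = (\<Sum>c\<in>{..<n} \<times> {..<n}. (if c = a then of_real ?d * V a else 0) - (if c = b then of_real ?d * V b else 0))"
    by (intro sum.cong refl) (auto simp: Transposition.transpose_def diff_divide_distrib algebra_simps)
  also have "\<dots> = of_real ?d * (V a - V b)"
    using a b by (simp add: sum_subtractf sum.delta right_diff_distrib)
  finally show ?thesis unfolding V_def .
qed

lemma kernel_le:
  assumes "p < 2 * n" "q < 2 * n" "c \<in> {..<n} \<times> {..<n}"
  shows "cmod (W (G X) (G Y) c p q) \<le> 2 / t\<^sup>2"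
proof -
  have b: "cmod (G X p k) * cmod (G Y l q) \<le> 1 / t * (1 / t)" if "k < 2 * n" "l < 2 * n" for k l
    using assms that t by (intro mult_mono green_le) auto
  have "cmod (W (G X) (G Y) c p q) \<le> cmod (G X p (fst c)) * cmod (G Y (n + snd c) q) + cmod (G X p (n + snd c)) * cmod (G Y (fst c) q)"
    unfolding pair_kernel_def by (metis norm_mult norm_triangle_ineq)
  also have "\<dots> \<le> 1 / t * (1 / t) + 1 / t * (1 / t)"
    using assms by (intro add_mono b) auto
  finally show ?thesis by (simp add: power2_eq_square)
qed

lemma green_swap_le:
  assumes pq: "p < 2 * n" "q < 2 * n" and a: "a \<in> {..<n} \<times> {..<n}" and b: "b \<in> {..<n} \<times> {..<n}"
  shows "cmod (G X p q - G (X \<circ> Transposition.transpose a b) p q) \<le> 4 * \<bar>X a - X b\<bar> / (sqrt (real n) * t\<^sup>2)"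
proof -
  let ?Y = "X \<circ> Transposition.transpose a b"
  have "cmod (W (G X) (G ?Y) a p q - W (G X) (G ?Y) b p q) \<le> 2 / t\<^sup>2 + 2 / t\<^sup>2"
    by (intro order_trans[OF norm_triangle_ineq4] add_mono kernel_le pq a b)
  then have "\<bar>(X b - X a) / sqrt (real n)\<bar> * cmod (W (G X) (G ?Y) a p q - W (G X) (G ?Y) b p q)
      \<le> \<bar>(X b - X a) / sqrt (real n)\<bar> * (4 / t\<^sup>2)"
    by (intro mult_left_mono) auto
  then show ?thesis unfolding green_swap[OF assms] norm_mult norm_of_real
    by (simp add: abs_minus_commute mult.commute)
qed

text \<open>Cauchy-Schwarz over the diagonal position \<open>i\<close>: summing \<open>n\<close>
  kernels costs nothing compared with the bound for a single one.\<close>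

lemma trace_kernel_le:
  assumes "r \<le> n" "s \<le> n" "c \<in> {..<n} \<times> {..<n}"
  shows "cmod (\<Sum>i<n. W (G X) (G Y) c (r + i) (s + i)) \<le> 2 / t\<^sup>2"
proof -
  have "cmod (\<Sum>i<n. W (G X) (G Y) c (r + i) (s + i))
     \<le> (\<Sum>i<n. cmod (G X (r + i) (fst c)) * cmod (G Y (n + snd c) (s + i))) +
       (\<Sum>i<n. cmod (G X (r + i) (n + snd c)) * cmod (G Y (fst c) (s + i)))"
    unfolding sum.distrib[symmetric] pair_kernel_def
    by (intro sum_norm_le) (metis norm_mult norm_triangle_ineq)
  also have "\<dots> \<le> 1 / t\<^sup>2 + 1 / t\<^sup>2"
    using assms by (intro add_mono cauchy_schwarz_sum green_row_part green_col_part) auto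
  finally show ?thesis by simp
qed

text \<open>Thanks to \<open>trace_kernel_le\<close>, the bound is smaller than the one for a single
  entry of G by the full factor 1 / n of the normalization. Functions of the traces therefore behave
  almost like constants under one exchange.\<close>

lemma partial_trace_swap_le:
  assumes rs: "r \<le> n" "s \<le> n" and a: "a \<in> {..<n} \<times> {..<n}" and b: "b \<in> {..<n} \<times> {..<n}"
  shows "cmod (tr r s (G X) - tr r s (G (X \<circ> Transposition.transpose a b)))
    \<le> 4 * \<bar>X a - X b\<bar> / (real n * sqrt (real n) * t\<^sup>2)"
proof -
  let ?Y = "X \<circ> Transposition.transpose a b"
  let ?d = "(X b - X a) / sqrt (real n)"
  let ?V = "\<lambda>c. (\<Sum>i<n. W (G X) (G ?Y) c (r + i) (s + i))"
  have "tr r s (G X) - tr r s (G ?Y) = (\<Sum>i<n. G X (r + i) (s + i) - G ?Y (r + i) (s + i)) / of_nat n"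
    by (simp add: partial_trace_def sum_subtractf diff_divide_distrib)
  also have "(\<Sum>i<n. G X (r + i) (s + i) - G ?Y (r + i) (s + i)) = of_real ?d * (?V a - ?V b)"
    unfolding sum_subtractf[symmetric] sum_distrib_left using rs
    by (intro sum.cong refl green_swap a b) auto
  finally have eq: "tr r s (G X) - tr r s (G ?Y) = of_real ?d * (?V a - ?V b) / of_nat n" .
  have "cmod (?V a - ?V b) \<le> 2 / t\<^sup>2 + 2 / t\<^sup>2"
    by (intro order_trans[OF norm_triangle_ineq4] add_mono trace_kernel_le rs a b)
  then have "\<bar>?d\<bar> * cmod (?V a - ?V b) / real n \<le> \<bar>?d\<bar> * (4 / t\<^sup>2) / real n"
    by (intro divide_right_mono mult_left_mono) auto
  then show ?thesis unfolding eq norm_mult norm_divide norm_of_real norm_of_nat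
    by (simp add: abs_minus_commute mult.commute mult.left_commute)
qed

lemma partial_trace_le:
  assumes "r \<le> n" "s \<le> n"
  shows "cmod (tr r s (G X)) \<le> 1 / t"
proof -
  have "cmod (\<Sum>i<n. G X (r + i) (s + i)) \<le> (\<Sum>i<n. 1 / t)"
    using assms by (intro sum_norm_le green_le) auto
  then show ?thesis using n by (simp add: partial_trace_def norm_divide field_simps)
qed

lemma kernel_sum_le:
  assumes "p < 2 * n" "q < 2 * n"
  shows "(\<Sum>c\<in>{..<n} \<times> {..<n}. cmod (W (G X) (G X) c p q)) \<le> 2 * real n / t\<^sup>2"
proof -
  have "(\<Sum>c\<in>{..<n} \<times> {..<n}. cmod (W (G X) (G X) c p q))
    \<le> (\<Sum>c\<in>{..<n} \<times> {..<n}. cmod (G X p (fst c)) * cmod (G X (n + snd c) q) + cmod (G X (fst c) q) * cmod (G X p (n + snd c)))"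
    unfolding pair_kernel_def by (intro sum_mono order_trans[OF norm_triangle_ineq]) (simp add: norm_mult mult.commute)
  also have "\<dots> = (\<Sum>i<n. \<Sum>j<n. cmod (G X p (0 + i)) * cmod (G X (n + j) q)) + (\<Sum>i<n. \<Sum>j<n. cmod (G X (0 + i) q) * cmod (G X p (n + j)))"
    by (simp add: sum.distrib sum.cartesian_product split_def)
  also have "\<dots> \<le> real n / t\<^sup>2 + real n / t\<^sup>2"
    using assms by (intro add_mono l1_product green_row_part green_col_part) auto
  finally show ?thesis by simp
qed

text \<open>Companion of \<open>kernel_sum_le\<close> with the roles reversed: the kernel cell
  \<open>c\<close> is fixed and the matrix position varies. The estimate of the off-diagonal terms
  needs sums in both directions.\<close>

lemma kernel_sum_positions_le:
  assumes c: "c \<in> {..<n} \<times> {..<n}"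
    and pos: "pos = (\<lambda>(i, j). (n + j, i)) \<or> pos = (\<lambda>(i, j). (i, j))"
  shows "(\<Sum>a\<in>{..<n} \<times> {..<n}. cmod (W (G X) (G X) c (fst (pos a)) (snd (pos a)))) \<le> 2 * real n / t\<^sup>2"
proof -
  have *: "cmod (W (G X) (G X) c p q)
    \<le> cmod (G X (n + snd c) q) * cmod (G X p (fst c)) + cmod (G X (fst c) q) * cmod (G X p (n + snd c))" for p q
    unfolding pair_kernel_def by (intro order_trans[OF norm_triangle_ineq]) (simp add: norm_mult mult.commute)
  from pos show ?thesis
  proof
    assume pos: "pos = (\<lambda>(i, j). (n + j, i))"
    have "(\<Sum>a\<in>{..<n} \<times> {..<n}. cmod (W (G X) (G X) c (fst (pos a)) (snd (pos a))))
      \<le> (\<Sum>a\<in>{..<n} \<times> {..<n}. cmod (G X (n + snd c) (fst a)) * cmod (G X (n + snd a) (fst c)) + cmod (G X (fst c) (fst a)) * cmod (G X (n + snd a) (n + snd c)))"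
      by (intro sum_mono order_trans[OF *]) (auto simp: pos)
    also have "\<dots> = (\<Sum>i<n. \<Sum>j<n. cmod (G X (n + snd c) (0 + i)) * cmod (G X (n + j) (fst c))) + (\<Sum>i<n. \<Sum>j<n. cmod (G X (fst c) (0 + i)) * cmod (G X (n + j) (n + snd c)))"
      by (simp add: sum.distrib sum.cartesian_product split_def)
    also have "\<dots> \<le> real n / t\<^sup>2 + real n / t\<^sup>2"
      using c by (intro add_mono l1_product green_row_part green_col_part) auto
    finally show ?thesis by simp
  next
    assume pos: "pos = (\<lambda>(i, j). (i, j))"
    have "(\<Sum>a\<in>{..<n} \<times> {..<n}. cmod (W (G X) (G X) c (fst (pos a)) (snd (pos a))))
      \<le> (\<Sum>a\<in>{..<n} \<times> {..<n}. cmod (G X (fst a) (fst c)) * cmod (G X (n + snd c) (snd a)) + cmod (G X (fst a) (n + snd c)) * cmod (G X (fst c) (snd a)))"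
      by (intro sum_mono order_trans[OF *]) (auto simp: pos mult.commute)
    also have "\<dots> = (\<Sum>i<n. \<Sum>j<n. cmod (G X (0 + i) (fst c)) * cmod (G X (n + snd c) (0 + j))) + (\<Sum>i<n. \<Sum>j<n. cmod (G X (0 + i) (n + snd c)) * cmod (G X (fst c) (0 + j)))"
      by (simp add: sum.distrib sum.cartesian_product split_def)
    also have "\<dots> \<le> real n / t\<^sup>2 + real n / t\<^sup>2"
      using c by (intro add_mono l1_product green_row_part green_col_part) auto
    finally show ?thesis by simp
  qed
qed

text \<open>Cyclicity of the trace: \<open>M\<close> times the lower left block of G and the same
  product in the other order have equal traces, and each equals n plus \<i> t times the trace of one
  diagonal block.\<close>

lemma partial_trace_upper_lower: "tr n n (G X) = tr 0 0 (G X)"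
proof -
  have "\<i> * of_real t * (\<Sum>i<n. G X i i) + of_nat n = (\<Sum>i<n. \<Sum>j<n. M X $$ (i, j) * G X (n + j) i)"
  proof -
    have "(\<Sum>i<n. (\<Sum>j<n. M X $$ (i, j) * G X (n + j) i)) = (\<Sum>i<n. 1 + \<i> * of_real t * G X i i)"
      using green_upper[of _ _ X] by (intro sum.cong refl) (auto simp: diff_eq_eq)
    then show ?thesis by (simp add: sum.distrib sum_distrib_left)
  qed
  also have "\<dots> = (\<Sum>j<n. \<Sum>i<n. G X (n + j) i * M X $$ (i, j))"
    by (subst sum.swap) (simp add: mult.commute)
  also have "\<dots> = (\<Sum>j<n. 1 + \<i> * of_real t * G X (n + j) (n + j))"
    using green_right[of _ _ X] by (intro sum.cong refl) (auto simp: diff_eq_eq)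
  also have "\<dots> = \<i> * of_real t * (\<Sum>j<n. G X (n + j) (n + j)) + of_nat n"
    by (simp add: sum.distrib sum_distrib_left)
  finally show ?thesis using t by (simp add: partial_trace_def)
qed

text \<open>The averaged diagonal of the upper block equation, solved for the term that is linear in
  the array. That term is the one to which the exchange argument applies.\<close>

lemma trace_equation_1:
  "(\<Sum>c\<in>{..<n} \<times> {..<n}. of_real (X c) * G X (n + snd c) (fst c)) / of_real (real n * sqrt (real n))
    = 1 + z * tr n 0 (G X) + \<i> * of_real t * tr 0 0 (G X)"
proof -
  have "(\<Sum>i<n. \<Sum>j<n. M X $$ (i, j) * G X (n + j) i) = (\<Sum>i<n. 1 + \<i> * of_real t * G X i i)"
    using green_upper[of _ _ X] by (intro sum.cong refl) (auto simp: diff_eq_eq)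
  moreover have "(\<Sum>i<n. \<Sum>j<n. M X $$ (i, j) * G X (n + j) i)
     = (\<Sum>i<n. \<Sum>j<n. of_real (X (i, j)) * G X (n + j) i) / of_real (sqrt (real n)) - z * (\<Sum>i<n. G X (n + i) i)"
  proof -
    have "(\<Sum>i<n. \<Sum>j<n. M X $$ (i, j) * G X (n + j) i)
      = (\<Sum>i<n. \<Sum>j<n. of_real (X (i, j)) * G X (n + j) i / of_real (sqrt (real n)) - (if j = i then z * G X (n + j) i else 0))"
      by (intro sum.cong refl) (auto simp: shifted_mat_def algebra_simps)
    then show ?thesis by (simp add: sum_subtractf sum_divide_distrib sum_distrib_left)
  qed
  ultimately have "(\<Sum>i<n. \<Sum>j<n. of_real (X (i, j)) * G X (n + j) i) / of_real (sqrt (real n))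
    = of_nat n + \<i> * of_real t * (\<Sum>i<n. G X i i) + z * (\<Sum>i<n. G X (n + i) i)"
    by (simp add: sum.distrib sum_distrib_left algebra_simps)
  then have "(\<Sum>i<n. \<Sum>j<n. of_real (X (i, j)) * G X (n + j) i) / of_real (sqrt (real n)) / of_nat n
    = 1 + z * tr n 0 (G X) + \<i> * of_real t * tr 0 0 (G X)"
    using n by (simp add: partial_trace_def add_divide_distrib)
  then show ?thesis by (simp add: sum.cartesian_product split_def mult.commute)
qed

text \<open>The same for the lower block equation at the diagonal of the lower left block, where the
  right-hand side of the resolvent equation is zero. The array is real, so conjugation touches only
  \<open>z\<close>.\<close>

lemma trace_equation_2:
  "(\<Sum>c\<in>{..<n} \<times> {..<n}. of_real (X c) * G X (fst c) (snd c)) / of_real (real n * sqrt (real n))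
    = cnj z * tr 0 0 (G X) + \<i> * of_real t * tr n 0 (G X)"
proof -
  have "(\<Sum>i<n. \<Sum>j<n. cnj (M X $$ (j, i)) * G X j i) = (\<Sum>i<n. \<i> * of_real t * G X (n + i) i)"
    using green_lower[of _ _ X] by (intro sum.cong refl) (auto simp: diff_eq_eq)
  moreover have "(\<Sum>i<n. \<Sum>j<n. cnj (M X $$ (j, i)) * G X j i)
     = (\<Sum>i<n. \<Sum>j<n. of_real (X (j, i)) * G X j i) / of_real (sqrt (real n)) - cnj z * (\<Sum>i<n. G X i i)"
  proof -
    have "(\<Sum>i<n. \<Sum>j<n. cnj (M X $$ (j, i)) * G X j i)
      = (\<Sum>i<n. \<Sum>j<n. of_real (X (j, i)) * G X j i / of_real (sqrt (real n)) - (if j = i then cnj z * G X j i else 0))"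
      by (intro sum.cong refl) (auto simp: shifted_mat_def algebra_simps)
    then show ?thesis by (simp add: sum_subtractf sum_divide_distrib sum_distrib_left)
  qed
  moreover have "(\<Sum>i<n. \<Sum>j<n. of_real (X (j, i)) * G X j i) = (\<Sum>i<n. \<Sum>j<n. of_real (X (i, j)) * G X i j)"
    by (rule sum.swap)
  ultimately have "(\<Sum>i<n. \<Sum>j<n. of_real (X (i, j)) * G X i j) / of_real (sqrt (real n))
    = \<i> * of_real t * (\<Sum>i<n. G X (n + i) i) + cnj z * (\<Sum>i<n. G X i i)"
    by (simp add: sum_distrib_left algebra_simps)
  then have "(\<Sum>i<n. \<Sum>j<n. of_real (X (i, j)) * G X i j) / of_real (sqrt (real n)) / of_nat n
    = cnj z * tr 0 0 (G X) + \<i> * of_real t * tr n 0 (G X)"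
    using n by (simp add: partial_trace_def add_divide_distrib)
  then show ?thesis by (simp add: sum.cartesian_product split_def mult.commute)
qed

text \<open>One of the two products in the kernel factorizes over i and j into traces of the
  diagonal blocks, giving g^2. The other is a sum of n^2 squares of entries of G, which the column
  bounds reduce to n / t^2.\<close>

lemma kernel_diagonal_1:
  "cmod ((\<Sum>c\<in>{..<n} \<times> {..<n}. W (G X) (G X) c (n + snd c) (fst c)) / of_nat (n\<^sup>2) - tr 0 0 (G X) * tr 0 0 (G X))
    \<le> 1 / (real n * t\<^sup>2)"
proof -
  have "(\<Sum>c\<in>{..<n} \<times> {..<n}. W (G X) (G X) c (n + snd c) (fst c))
    = (\<Sum>i<n. \<Sum>j<n. G X (n + j) i * G X (n + j) i) + (\<Sum>i<n. \<Sum>j<n. G X i i * G X (n + j) (n + j))"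
    by (simp add: pair_kernel_def sum.distrib sum.cartesian_product split_def mult.commute)
  also have "(\<Sum>i<n. \<Sum>j<n. G X i i * G X (n + j) (n + j)) = of_nat (n\<^sup>2) * (tr 0 0 (G X) * tr n n (G X))"
    using n by (simp add: partial_trace_def sum_product power2_eq_square)
  finally have eq: "(\<Sum>c\<in>{..<n} \<times> {..<n}. W (G X) (G X) c (n + snd c) (fst c)) / of_nat (n\<^sup>2) - tr 0 0 (G X) * tr 0 0 (G X)
     = (\<Sum>i<n. \<Sum>j<n. G X (n + j) i * G X (n + j) i) / of_nat (n\<^sup>2)"
    using n unfolding partial_trace_upper_lower by (simp add: add_divide_distrib)
  have "cmod (\<Sum>i<n. \<Sum>j<n. G X (n + j) i * G X (n + j) i) \<le> (\<Sum>i<n. \<Sum>j<n. (cmod (G X (n + j) i))\<^sup>2)"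
    by (intro sum_norm_le) (simp add: norm_mult power2_eq_square)
  also have "\<dots> \<le> (\<Sum>i<n. 1 / t\<^sup>2)"
    by (intro sum_mono green_col_part) auto
  finally show ?thesis unfolding eq norm_divide norm_of_nat using n by (simp add: field_simps power2_eq_square)
qed

lemma kernel_diagonal_2:
  "cmod ((\<Sum>c\<in>{..<n} \<times> {..<n}. W (G X) (G X) c (fst c) (snd c)) / of_nat (n\<^sup>2) - tr 0 0 (G X) * tr n 0 (G X))
    \<le> 1 / (real n * t\<^sup>2)"
proof -
  have "(\<Sum>c\<in>{..<n} \<times> {..<n}. W (G X) (G X) c (fst c) (snd c))
    = (\<Sum>i<n. \<Sum>j<n. G X i i * G X (n + j) j) + (\<Sum>i<n. \<Sum>j<n. G X i (n + j) * G X i j)"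
    by (simp add: pair_kernel_def sum.distrib sum.cartesian_product split_def)
  also have "(\<Sum>i<n. \<Sum>j<n. G X i i * G X (n + j) j) = of_nat (n\<^sup>2) * (tr 0 0 (G X) * tr n 0 (G X))"
    using n by (simp add: partial_trace_def sum_product power2_eq_square)
  finally have eq: "(\<Sum>c\<in>{..<n} \<times> {..<n}. W (G X) (G X) c (fst c) (snd c)) / of_nat (n\<^sup>2) - tr 0 0 (G X) * tr n 0 (G X)
     = (\<Sum>i<n. \<Sum>j<n. G X i (n + j) * G X i j) / of_nat (n\<^sup>2)"
    using n by (simp add: add_divide_distrib)
  have "cmod (\<Sum>i<n. \<Sum>j<n. G X i (n + j) * G X i j) \<le> (\<Sum>i<n. \<Sum>j<n. cmod (G X i (n + j)) * cmod (G X i (0 + j)))"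
    by (intro sum_norm_le) (simp add: norm_mult)
  also have "\<dots> \<le> (\<Sum>i<n. 1 / t\<^sup>2)"
    by (intro sum_mono cauchy_schwarz_sum green_row_part) auto
  finally show ?thesis unfolding eq norm_divide norm_of_nat using n by (simp add: field_simps power2_eq_square)
qed

text \<open>Eliminating the lower left block between \<open>green_upper\<close> and
  \<open>green_lower\<close> shows that the upper left block Q satisfies (M M* + t^2) Q = \<i> t.
  Thus g is \<i> times a positive average, the real quantity h of the overview.\<close>

lemma trace_singular_values:
  "tr 0 0 (G X) = \<i> * of_real ((\<Sum>k<n. t / ((singular_values (M X) ! k)\<^sup>2 + t\<^sup>2)) / real n)"
proof -
  define Q where "Q = mat n n (\<lambda>(i, j). G X i j)"
  have Q: "Q \<in> carrier_mat n n" by (simp add: Q_def)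
  have M: "M X \<in> carrier_mat n n" by simp
  have M': "mat_adjoint (M X) \<in> carrier_mat n n" by simp
  have MM: "M X * mat_adjoint (M X) \<in> carrier_mat n n" by (simp add: mult_carrier_mat[of _ n n _ n])
  have S: "M X * mat_adjoint (M X) + of_real (t\<^sup>2) \<cdot>\<^sub>m 1\<^sub>m n \<in> carrier_mat n n" using MM by simp
  have "(M X * mat_adjoint (M X) + of_real (t\<^sup>2) \<cdot>\<^sub>m 1\<^sub>m n) * Q = (\<i> * of_real t) \<cdot>\<^sub>m 1\<^sub>m n"
  proof (rule eq_matI)
    fix i q assume "i < dim_row ((\<i> * of_real t) \<cdot>\<^sub>m 1\<^sub>m n)" "q < dim_col ((\<i> * of_real t) \<cdot>\<^sub>m 1\<^sub>m n)"
    then have iq: "i < n" "q < n" by auto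
    have "((M X * mat_adjoint (M X) + of_real (t\<^sup>2) \<cdot>\<^sub>m 1\<^sub>m n) * Q) $$ (i, q)
      = (\<Sum>l<n. ((\<Sum>k<n. M X $$ (i, k) * cnj (M X $$ (l, k))) + (if i = l then of_real (t\<^sup>2) else 0)) * G X l q)"
      unfolding index_mult_mat_sum[OF S Q iq]
      using iq M MM by (intro sum.cong refl) (auto simp: index_mult_mat_sum[OF M M'] Q_def simp del: index_mult_mat(1))
    also have "\<dots> = (\<Sum>l<n. \<Sum>k<n. M X $$ (i, k) * cnj (M X $$ (l, k)) * G X l q) + (\<Sum>l<n. if l = i then of_real (t\<^sup>2) * G X l q else 0)"
      unfolding sum.distrib[symmetric] by (intro sum.cong refl) (auto simp: algebra_simps sum_distrib_left)
    also have "(\<Sum>l<n. if l = i then of_real (t\<^sup>2) * G X l q else 0) = of_real (t\<^sup>2) * G X i q" using iq by simp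
    also have "(\<Sum>l<n. \<Sum>k<n. M X $$ (i, k) * cnj (M X $$ (l, k)) * G X l q) = (\<Sum>k<n. M X $$ (i, k) * (\<Sum>l<n. cnj (M X $$ (l, k)) * G X l q))"
      by (subst sum.swap) (simp add: sum_distrib_left mult.assoc)
    also have "\<dots> = (\<Sum>k<n. M X $$ (i, k) * (\<i> * of_real t * G X (n + k) q))"
      using green_lower[of _ q X] iq by (intro sum.cong refl) (auto simp: diff_eq_eq)
    also have "\<dots> = \<i> * of_real t * (\<Sum>k<n. M X $$ (i, k) * G X (n + k) q)" by (simp add: sum_distrib_left algebra_simps)
    also have "\<dots> = \<i> * of_real t * ((if i = q then 1 else 0) + \<i> * of_real t * G X i q)"
      using green_upper[of i q X] iq by (auto simp: diff_eq_eq)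
    finally show "((M X * mat_adjoint (M X) + of_real (t\<^sup>2) \<cdot>\<^sub>m 1\<^sub>m n) * Q) $$ (i, q) = ((\<i> * of_real t) \<cdot>\<^sub>m 1\<^sub>m n) $$ (i, q)"
      using iq by (simp add: algebra_simps power2_eq_square)
  qed (simp_all add: Q_def)
  from trace_resolvent_singular_values[OF M Q t this]
  have "(\<Sum>i<n. G X i i) = \<i> * of_real t * of_real (\<Sum>k<n. 1 / ((singular_values (M X) ! k)\<^sup>2 + t\<^sup>2))"
    by (simp add: Q_def)
  then show ?thesis by (simp add: partial_trace_def sum_distrib_left mult.assoc flip: of_real_mult)
qed

end

section \<open>Exchanging entries of the permuted array\<close>

lemma sum_permutes_transpose:
  assumes "a \<in> S" "b \<in> S"
  shows "(\<Sum>\<pi>\<in>{\<pi>. \<pi> permutes S}. F (\<pi> \<circ> Transposition.transpose a b)) = (\<Sum>\<pi>\<in>{\<pi>. \<pi> permutes S}. F \<pi>)"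
proof -
  have tt: "Transposition.transpose a b \<circ> Transposition.transpose a b = id" by (rule transpose_comp_involutory)
  have perm: "\<pi> \<circ> Transposition.transpose a b permutes S" if "\<pi> permutes S" for \<pi>
    using permutes_swap_id[OF assms] that by (rule permutes_compose)
  show ?thesis
    by (rule sum.reindex_bij_witness[of _ "\<lambda>\<pi>. \<pi> \<circ> Transposition.transpose a b" "\<lambda>\<pi>. \<pi> \<circ> Transposition.transpose a b"])
       (auto simp: comp_assoc tt perm)
qed

text \<open>Centring gives card S * y (\<pi> a) as the sum over b of y (\<pi> a) - y (\<pi> b).
  Replacing \<pi> by its exchange flips the sign of this difference while preserving the uniform
  law, so \<open>F \<pi>\<close> may be replaced by half its change. The array \<open>y\<close> is
  left general: it will be \<open>x\<close> and later its square minus 1.\<close>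

lemma swap_integration_by_parts:
  fixes y :: "'a \<Rightarrow> real" and F :: "('a \<Rightarrow> 'a) \<Rightarrow> complex"
  assumes fin: "finite S" and y0: "(\<Sum>c\<in>S. y c) = 0" and a: "a \<in> S"
  shows "(\<Sum>\<pi>\<in>{\<pi>. \<pi> permutes S}. of_real (y (\<pi> a)) * F \<pi>)
    = (\<Sum>\<pi>\<in>{\<pi>. \<pi> permutes S}. \<Sum>b\<in>S. of_real (y (\<pi> a) - y (\<pi> b)) * (F \<pi> - F (\<pi> \<circ> Transposition.transpose a b)))
       / of_nat (2 * card S)"
proof -
  define P where "P = {\<pi>. \<pi> permutes S}"
  have card: "card S > 0" using fin a by (auto simp: card_gt_0_iff)
  have swapped: "(\<Sum>\<pi>\<in>P. of_real (y (\<pi> a) - y (\<pi> b)) * F (\<pi> \<circ> Transposition.transpose a b))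
      = - (\<Sum>\<pi>\<in>P. of_real (y (\<pi> a) - y (\<pi> b)) * F \<pi>)" if b: "b \<in> S" for b
  proof -
    have "(\<Sum>\<pi>\<in>P. of_real (y (\<pi> a) - y (\<pi> b)) * F (\<pi> \<circ> Transposition.transpose a b))
      = (\<Sum>\<pi>\<in>P. (\<lambda>\<rho>. of_real (y (\<rho> b) - y (\<rho> a)) * F \<rho>) (\<pi> \<circ> Transposition.transpose a b))"
      by (intro sum.cong refl) simp
    also have "\<dots> = (\<Sum>\<pi>\<in>P. of_real (y (\<pi> b) - y (\<pi> a)) * F \<pi>)"
      unfolding P_def by (rule sum_permutes_transpose[OF a b])
    also have "\<dots> = - (\<Sum>\<pi>\<in>P. of_real (y (\<pi> a) - y (\<pi> b)) * F \<pi>)"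
      unfolding sum_negf[symmetric] by (intro sum.cong refl) (simp add: algebra_simps)
    finally show ?thesis .
  qed
  have "(\<Sum>\<pi>\<in>P. \<Sum>b\<in>S. of_real (y (\<pi> a) - y (\<pi> b)) * (F \<pi> - F (\<pi> \<circ> Transposition.transpose a b)))
     = (\<Sum>b\<in>S. (\<Sum>\<pi>\<in>P. of_real (y (\<pi> a) - y (\<pi> b)) * F \<pi>) - (\<Sum>\<pi>\<in>P. of_real (y (\<pi> a) - y (\<pi> b)) * F (\<pi> \<circ> Transposition.transpose a b)))"
    by (subst sum.swap) (simp add: right_diff_distrib sum_subtractf)
  also have "\<dots> = (\<Sum>b\<in>S. 2 * (\<Sum>\<pi>\<in>P. of_real (y (\<pi> a) - y (\<pi> b)) * F \<pi>))"
    by (intro sum.cong refl) (simp only: swapped diff_minus_eq_add mult_2)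
  also have "\<dots> = 2 * (\<Sum>\<pi>\<in>P. (\<Sum>b\<in>S. of_real (y (\<pi> a) - y (\<pi> b))) * F \<pi>)"
    unfolding sum_distrib_left[symmetric] sum_distrib_right by (subst sum.swap) simp
  also have "\<dots> = 2 * (\<Sum>\<pi>\<in>P. of_nat (card S) * (of_real (y (\<pi> a)) * F \<pi>))"
  proof -
    have "(\<Sum>b\<in>S. complex_of_real (y (\<pi> a) - y (\<pi> b))) = of_nat (card S) * of_real (y (\<pi> a))" if "\<pi> \<in> P" for \<pi>
    proof -
      have "(\<Sum>b\<in>S. y (\<pi> b)) = (\<Sum>c\<in>S. y c)"
        using that unfolding P_def by (intro sum.reindex_bij_betw permutes_imp_bij) simp
      then have "(\<Sum>b\<in>S. y (\<pi> a) - y (\<pi> b)) = card S * y (\<pi> a)" using y0 by (simp add: sum_subtractf)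
      then show ?thesis by (metis of_real_mult of_real_of_nat_eq of_real_sum)
    qed
    then show ?thesis by (simp add: mult.assoc cong: sum.cong)
  qed
  also have "\<dots> = of_nat (2 * card S) * (\<Sum>\<pi>\<in>P. of_real (y (\<pi> a)) * F \<pi>)"
    by (simp add: sum_distrib_left mult.assoc)
  finally show ?thesis using card unfolding P_def by simp
qed

locale swap_array = hermitized +
  fixes x :: "nat \<times> nat \<Rightarrow> real" and K :: real
  assumes x_sum: "(\<Sum>c\<in>{..<n} \<times> {..<n}. x c) = 0"
    and x_square: "(\<Sum>c\<in>{..<n} \<times> {..<n}. (x c)\<^sup>2) = (real n)\<^sup>2"
    and x_le: "c \<in> {..<n} \<times> {..<n} \<Longrightarrow> \<bar>x c\<bar> \<le> K"
begin

abbreviation "S \<equiv> {..<n} \<times> {..<n}"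
abbreviation "P \<equiv> {\<pi>. \<pi> permutes S}"

lemma card_S: "card S = n\<^sup>2" by (simp add: power2_eq_square)

lemma K_nonneg: "K \<ge> 0"
  using x_le[of "(0, 0)"] n by auto

context
  fixes X \<pi> assumes pi: "\<pi> permutes S" and X: "X = x \<circ> \<pi>"
begin

section \<open>Moments and differences of the permuted array\<close>

lemma X_sum: "(\<Sum>c\<in>S. X c) = 0"
  using sum.reindex_bij_betw[OF permutes_imp_bij[OF pi], of x] x_sum unfolding X by simp

lemma X_square: "(\<Sum>c\<in>S. (X c)\<^sup>2) = (real n)\<^sup>2"
  using sum.reindex_bij_betw[OF permutes_imp_bij[OF pi], of "\<lambda>c. (x c)\<^sup>2"] x_square unfolding X by simp

lemma X_le: "c \<in> S \<Longrightarrow> \<bar>X c\<bar> \<le> K"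
  unfolding X comp_apply by (intro x_le) (use permutes_in_image[OF pi] in blast)

lemma X_diff_le: "a \<in> S \<Longrightarrow> b \<in> S \<Longrightarrow> \<bar>X a - X b\<bar> \<le> 2 * K"
  using X_le[of a] X_le[of b] by linarith

text \<open>The mean over b is (X a)^2 + 1 and not 2: the squared differences do not average out at
  a fixed position. This is the reason for the second exchange.\<close>

lemma X_diff_square_row: "(\<Sum>b\<in>S. (X a - X b)\<^sup>2) = (real n)\<^sup>2 * ((X a)\<^sup>2 + 1)"
proof -
  have "(\<Sum>b\<in>S. (X a - X b)\<^sup>2) = (\<Sum>b\<in>S. (X a)\<^sup>2 - 2 * X a * X b + (X b)\<^sup>2)"
    by (intro sum.cong refl) (simp add: power2_diff)
  also have "\<dots> = card S * (X a)\<^sup>2 - 2 * X a * (\<Sum>b\<in>S. X b) + (\<Sum>b\<in>S. (X b)\<^sup>2)"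
    by (simp add: sum.distrib sum_subtractf sum_distrib_left)
  also have "\<dots> = (real n)\<^sup>2 * ((X a)\<^sup>2 + 1)"
    unfolding X_sum X_square card_S by (simp add: algebra_simps)
  finally show ?thesis .
qed

lemma X_diff_square: "(\<Sum>a\<in>S. \<Sum>b\<in>S. (X a - X b)\<^sup>2) = 2 * (real n) ^ 4"
proof -
  have "(\<Sum>a\<in>S. \<Sum>b\<in>S. (X a - X b)\<^sup>2) = (real n)\<^sup>2 * ((\<Sum>a\<in>S. (X a)\<^sup>2) + real (card S))"
    unfolding X_diff_square_row sum_distrib_left[symmetric] sum.distrib by simp
  then show ?thesis unfolding X_square card_S by (simp add: power2_eq_square power4_eq_xxxx)
qed

end

text \<open>Moves the second factor of the kernel in \<open>green_swap\<close> back to the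
  unexchanged array. The cost is one more factor |X a - X b| / sqrt n.\<close>

lemma kernel_change_second:
  fixes X :: "nat \<times> nat \<Rightarrow> real"
  assumes pq: "p < 2 * n" "q < 2 * n" and a: "a \<in> S" and b: "b \<in> S" and c: "c \<in> S"
  defines "Y \<equiv> X \<circ> Transposition.transpose a b"
  shows "cmod (W (G X) (G Y) c p q - W (G X) (G X) c p q) \<le> 8 * \<bar>X a - X b\<bar> / (sqrt (real n) * t ^ 3)"
proof -
  let ?e = "4 * \<bar>X a - X b\<bar> / (sqrt (real n) * t\<^sup>2)"
  have e: "cmod (G X k l - G Y k l) \<le> ?e" if "k < 2 * n" "l < 2 * n" for k l
    unfolding Y_def by (rule green_swap_le[OF that a b])
  have "W (G X) (G Y) c p q - W (G X) (G X) c p q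
    = G X p (fst c) * - (G X (n + snd c) q - G Y (n + snd c) q) + G X p (n + snd c) * - (G X (fst c) q - G Y (fst c) q)"
    by (simp add: pair_kernel_def algebra_simps)
  also have "cmod \<dots> \<le> 1 / t * ?e + 1 / t * ?e"
  proof (intro order_trans[OF norm_triangle_ineq] add_mono)
    show "cmod (G X p (fst c) * - (G X (n + snd c) q - G Y (n + snd c) q)) \<le> 1 / t * ?e"
      unfolding norm_mult norm_minus_cancel using pq c t by (intro mult_mono e green_le) auto
    show "cmod (G X p (n + snd c) * - (G X (fst c) q - G Y (fst c) q)) \<le> 1 / t * ?e"
      unfolding norm_mult norm_minus_cancel using pq c t by (intro mult_mono e green_le) auto
  qed
  also have "\<dots> = 8 * \<bar>X a - X b\<bar> / (sqrt (real n) * t ^ 3)" by (simp add: power2_eq_square power3_eq_cube)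
  finally show ?thesis .
qed

lemma kernel_change_both:
  fixes X :: "nat \<times> nat \<Rightarrow> real"
  assumes pq: "p < 2 * n" "q < 2 * n" and a: "a \<in> S" and b: "b \<in> S" and c: "c \<in> S"
  defines "Y \<equiv> X \<circ> Transposition.transpose a b"
  shows "cmod (W (G X) (G X) c p q - W (G Y) (G Y) c p q) \<le> 16 * \<bar>X a - X b\<bar> / (sqrt (real n) * t ^ 3)"
proof -
  let ?e = "4 * \<bar>X a - X b\<bar> / (sqrt (real n) * t\<^sup>2)"
  have e: "cmod (G X k l - G Y k l) \<le> ?e" if "k < 2 * n" "l < 2 * n" for k l
    unfolding Y_def by (rule green_swap_le[OF that a b])
  have prod: "cmod (G X k l * G X k' l' - G Y k l * G Y k' l') \<le> 1 / t * ?e + ?e * (1 / t)"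
    if "k < 2 * n" "l < 2 * n" "k' < 2 * n" "l' < 2 * n" for k l k' l'
  proof -
    have "G X k l * G X k' l' - G Y k l * G Y k' l' = G X k l * (G X k' l' - G Y k' l') + (G X k l - G Y k l) * G Y k' l'"
      by (simp add: algebra_simps)
    moreover have "cmod (G X k l * (G X k' l' - G Y k' l')) \<le> 1 / t * ?e"
      unfolding norm_mult using that t by (intro mult_mono e green_le) auto
    moreover have "cmod ((G X k l - G Y k l) * G Y k' l') \<le> ?e * (1 / t)"
      unfolding norm_mult using that t by (intro mult_mono e green_le) auto
    ultimately show ?thesis by (simp only:) (intro order_trans[OF norm_triangle_ineq] add_mono)
  qed
  have "W (G X) (G X) c p q - W (G Y) (G Y) c p q
    = (G X p (fst c) * G X (n + snd c) q - G Y p (fst c) * G Y (n + snd c) q)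
    + (G X p (n + snd c) * G X (fst c) q - G Y p (n + snd c) * G Y (fst c) q)"
    by (simp add: pair_kernel_def algebra_simps)
  also have "cmod \<dots> \<le> (1 / t * ?e + ?e * (1 / t)) + (1 / t * ?e + ?e * (1 / t))"
    using pq c by (intro order_trans[OF norm_triangle_ineq] add_mono prod) auto
  also have "\<dots> = 16 * \<bar>X a - X b\<bar> / (sqrt (real n) * t ^ 3)" by (simp add: power2_eq_square power3_eq_cube)
  finally show ?thesis .
qed

text \<open>The two choices of \<open>pos\<close> below give the two self-consistent equations. They pair the array entry
  \<open>(i, j)\<close> with the entry of \<open>G\<close> that completes it to the trace of \<open>M\<close> times the lower left
  block, respectively of the adjoint of \<open>M\<close> times the upper left block.\<close>

definition entry where "entry pos X a = G X (fst (pos a)) (snd (pos a))"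
definition ker where "ker pos X a c = W (G X) (G X) c (fst (pos a)) (snd (pos a))"

section \<open>The exchange argument against a test function\<close>

context
  fixes \<phi> :: "(nat \<times> nat \<Rightarrow> real) \<Rightarrow> complex" and C L :: real and pos
  assumes phi_le: "\<And>\<pi>. \<pi> permutes S \<Longrightarrow> cmod (\<phi> (x \<circ> \<pi>)) \<le> C"
    and phi_swap: "\<And>\<pi> a b. \<pi> permutes S \<Longrightarrow> a \<in> S \<Longrightarrow> b \<in> S \<Longrightarrow>
      cmod (\<phi> (x \<circ> \<pi>) - \<phi> (x \<circ> \<pi> \<circ> Transposition.transpose a b)) \<le> L * \<bar>x (\<pi> a) - x (\<pi> b)\<bar>"
    and L: "L \<ge> 0"
    and pos: "pos = (\<lambda>(i, j). (n + j, i)) \<or> pos = (\<lambda>(i, j). (i, j))"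
begin

lemma pos_bound: "a \<in> S \<Longrightarrow> fst (pos a) < 2 * n \<and> snd (pos a) < 2 * n"
  using pos by auto

lemma C_nonneg: "C \<ge> 0"
  using phi_le[OF permutes_id] norm_ge_zero order_trans by blast

text \<open>Inserting \<open>green_swap\<close> cancels the leading part exactly. What remains is
  the change of the test function, giving L / t, and the replacement of the second kernel factor,
  giving the term with K: twice the constant 8 of \<open>kernel_change_second\<close>, and one
  difference estimated by 2 K, which makes 32.\<close>

lemma first_order_pathwise:
  assumes pi: "\<pi> permutes S" and X: "X = x \<circ> \<pi>" and a: "a \<in> S" and b: "b \<in> S"
  defines "Y \<equiv> X \<circ> Transposition.transpose a b"
  shows "cmod (of_real (X a - X b) * (\<phi> X * entry pos X a - \<phi> Y * entry pos Y a)
      + \<phi> X * of_real ((X a - X b)\<^sup>2 / sqrt (real n)) * (ker pos X a a - ker pos X a b))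
    \<le> (X a - X b)\<^sup>2 * (32 * C * K / (real n * t ^ 3) + L / t)"
proof -
  define p where "p = fst (pos a)"
  define q where "q = snd (pos a)"
  have pq: "p < 2 * n" "q < 2 * n" using pos_bound[OF a] by (auto simp: p_def q_def)
  define d where "d = X a - X b"
  define s where "s = sqrt (real n)"
  have s: "s > 0" using n by (simp add: s_def)
  have ss: "s * s = real n" by (simp add: s_def)
  define ea where "ea = W (G X) (G Y) a p q - W (G X) (G X) a p q"
  define eb where "eb = W (G X) (G Y) b p q - W (G X) (G X) b p q"
  define u where "u = G X p q"
  define v where "v = G Y p q"
  define wa where "wa = W (G X) (G X) a p q"
  define wb where "wb = W (G X) (G X) b p q"
  have uv: "u - v = of_real (- d / s) * ((wa + ea) - (wb + eb))"
    unfolding u_def v_def wa_def wb_def ea_def eb_def d_def s_def Y_def using green_swap[OF pq a b, of X] by simp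
  have "of_real d * (\<phi> X * u - \<phi> Y * v) + \<phi> X * of_real (d\<^sup>2 / s) * (wa - wb)
     = of_real d * (\<phi> X * (u - v) + (\<phi> X - \<phi> Y) * v) + \<phi> X * of_real (d\<^sup>2 / s) * (wa - wb)"
    by (simp add: algebra_simps)
  also have "\<dots> = of_real d * ((\<phi> X - \<phi> Y) * v) - \<phi> X * of_real (d\<^sup>2 / s) * (ea - eb)"
    unfolding uv by (simp add: algebra_simps power2_eq_square add_divide_distrib diff_divide_distrib)
  finally have eq: "of_real d * (\<phi> X * u - \<phi> Y * v) + \<phi> X * of_real (d\<^sup>2 / s) * (wa - wb)
     = of_real d * ((\<phi> X - \<phi> Y) * v) - \<phi> X * of_real (d\<^sup>2 / s) * (ea - eb)" .
  have 1: "cmod (of_real d * ((\<phi> X - \<phi> Y) * v)) \<le> d\<^sup>2 * (L / t)"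
  proof -
    have "cmod (\<phi> X - \<phi> Y) * cmod v \<le> (L * \<bar>d\<bar>) * (1 / t)"
      using phi_swap[OF pi a b] L unfolding X Y_def d_def v_def using green_le[OF pq] by (intro mult_mono) auto
    then have "\<bar>d\<bar> * (cmod (\<phi> X - \<phi> Y) * cmod v) \<le> \<bar>d\<bar> * ((L * \<bar>d\<bar>) * (1 / t))"
      by (rule mult_left_mono) simp
    also have "\<dots> = (\<bar>d\<bar> * \<bar>d\<bar>) * (L / t)" by simp
    also have "\<bar>d\<bar> * \<bar>d\<bar> = d\<^sup>2" by (simp add: power2_eq_square)
    finally show ?thesis by (simp add: norm_mult)
  qed
  have dK: "\<bar>d\<bar> \<le> 2 * K" unfolding d_def by (rule X_diff_le[OF pi X a b])
  have e: "cmod (ea - eb) \<le> 32 * K / (s * t ^ 3)"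
  proof -
    have "cmod (ea - eb) \<le> 8 * \<bar>d\<bar> / (s * t ^ 3) + 8 * \<bar>d\<bar> / (s * t ^ 3)"
      unfolding ea_def eb_def d_def s_def Y_def
      by (intro order_trans[OF norm_triangle_ineq4] add_mono kernel_change_second pq a b)
    also have "\<dots> = 16 * \<bar>d\<bar> / (s * t ^ 3)" by simp
    also have "\<dots> \<le> 16 * (2 * K) / (s * t ^ 3)"
      using dK s t by (intro divide_right_mono mult_left_mono) auto
    finally show ?thesis by simp
  qed
  have 2: "cmod (\<phi> X * of_real (d\<^sup>2 / s) * (ea - eb)) \<le> d\<^sup>2 * (32 * C * K / (real n * t ^ 3))"
  proof -
    have "cmod (\<phi> X * of_real (d\<^sup>2 / s) * (ea - eb)) = (d\<^sup>2 / s) * (cmod (\<phi> X) * cmod (ea - eb))"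
      using s by (simp add: norm_mult norm_divide power2_eq_square abs_mult)
    also have "\<dots> \<le> (d\<^sup>2 / s) * (C * (32 * K / (s * t ^ 3)))"
      using phi_le[OF pi] e s C_nonneg unfolding X by (intro mult_left_mono mult_mono) auto
    also have "\<dots> = d\<^sup>2 * (32 * C * K / ((s * s) * t ^ 3))" by (simp add: ac_simps)
    finally show ?thesis unfolding ss .
  qed
  have "cmod (of_real d * (\<phi> X * u - \<phi> Y * v) + \<phi> X * of_real (d\<^sup>2 / s) * (wa - wb))
     \<le> d\<^sup>2 * (L / t) + d\<^sup>2 * (32 * C * K / (real n * t ^ 3))"
    unfolding eq by (intro order_trans[OF norm_triangle_ineq4] add_mono 1 2)
  also have "\<dots> = d\<^sup>2 * (32 * C * K / (real n * t ^ 3) + L / t)" by (simp add: algebra_simps)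
  finally show ?thesis unfolding d_def s_def u_def v_def wa_def wb_def p_def q_def entry_def ker_def .
qed

text \<open>The weight is at most 2 (X a)^2 + 2 (X b)^2. The first part is combined with the sum of
  kernels over b, the second with the sum over a; each is of order n, and the squares add up to n^2.
  The result n^3 is small against the normalization n^4.\<close>

lemma off_diagonal_pathwise:
  assumes pi: "\<pi> permutes S" and X: "X = x \<circ> \<pi>"
  shows "cmod (\<Sum>a\<in>S. \<Sum>b\<in>S. \<phi> X * of_real ((X a - X b)\<^sup>2) * ker pos X a b) \<le> C * (8 * (real n) ^ 3 / t\<^sup>2)"
proof -
  let ?B = "2 * real n / t\<^sup>2"
  have row: "(\<Sum>b\<in>S. cmod (ker pos X a b)) \<le> ?B" if "a \<in> S" for a
    unfolding ker_def using pos_bound[OF that] by (intro kernel_sum_le) auto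
  have col: "(\<Sum>a\<in>S. cmod (ker pos X a b)) \<le> ?B" if "b \<in> S" for b
    unfolding ker_def by (rule kernel_sum_positions_le[OF that pos])
  have "cmod (\<Sum>a\<in>S. \<Sum>b\<in>S. \<phi> X * of_real ((X a - X b)\<^sup>2) * ker pos X a b)
     \<le> (\<Sum>a\<in>S. \<Sum>b\<in>S. C * (2 * (X a)\<^sup>2 * cmod (ker pos X a b) + 2 * (X b)\<^sup>2 * cmod (ker pos X a b)))"
  proof (intro sum_norm_le)
    fix a b
    have sq: "(X a - X b)\<^sup>2 \<le> 2 * (X a)\<^sup>2 + 2 * (X b)\<^sup>2"
      using sum_squares_bound[of "X a" "- X b"] by (simp add: power2_diff)
    have "cmod (\<phi> X * of_real ((X a - X b)\<^sup>2) * ker pos X a b) = cmod (\<phi> X) * ((X a - X b)\<^sup>2 * cmod (ker pos X a b))"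
      by (simp add: norm_mult power2_eq_square abs_mult flip: of_real_diff)
    also have "\<dots> \<le> C * ((2 * (X a)\<^sup>2 + 2 * (X b)\<^sup>2) * cmod (ker pos X a b))"
      using phi_le[OF pi] C_nonneg sq unfolding X by (intro mult_mono) auto
    finally show "cmod (\<phi> X * of_real ((X a - X b)\<^sup>2) * ker pos X a b)
       \<le> C * (2 * (X a)\<^sup>2 * cmod (ker pos X a b) + 2 * (X b)\<^sup>2 * cmod (ker pos X a b))" by (simp only: distrib_right)
  qed
  also have "\<dots> = C * ((\<Sum>a\<in>S. 2 * (X a)\<^sup>2 * (\<Sum>b\<in>S. cmod (ker pos X a b))) + (\<Sum>b\<in>S. 2 * (X b)\<^sup>2 * (\<Sum>a\<in>S. cmod (ker pos X a b))))"
  proof -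
    have "(\<Sum>a\<in>S. \<Sum>b\<in>S. 2 * (X b)\<^sup>2 * cmod (ker pos X a b)) = (\<Sum>b\<in>S. 2 * (X b)\<^sup>2 * (\<Sum>a\<in>S. cmod (ker pos X a b)))"
      by (subst sum.swap) (simp only: sum_distrib_left)
    then show ?thesis unfolding sum_distrib_left[symmetric] sum.distrib by simp
  qed
  also have "\<dots> \<le> C * ((\<Sum>a\<in>S. 2 * (X a)\<^sup>2 * ?B) + (\<Sum>b\<in>S. 2 * (X b)\<^sup>2 * ?B))"
    using C_nonneg by (intro mult_left_mono add_mono sum_mono row col) auto
  also have "(\<Sum>a\<in>S. 2 * (X a)\<^sup>2 * ?B) = 2 * (real n)\<^sup>2 * ?B"
    unfolding sum_distrib_right[symmetric] sum_distrib_left[symmetric] X_square[OF pi X] ..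
  also have "C * (2 * (real n)\<^sup>2 * ?B + 2 * (real n)\<^sup>2 * ?B) = C * (8 * (real n) ^ 3 / t\<^sup>2)"
    by (simp add: power2_eq_square power3_eq_cube)
  finally show ?thesis .
qed

text \<open>The summand of the exchange formula for the centred array X^2 - 1. A difference of
  squares costs a factor 2 K against a plain difference, and the derivative of the kernel pays for
  it with 1 / sqrt n; this is one of the places where K / sqrt n enters.\<close>

lemma second_order_pathwise:
  assumes pi: "\<pi> permutes S" and X: "X = x \<circ> \<pi>" and a: "a \<in> S" and b: "b \<in> S"
  defines "Y \<equiv> X \<circ> Transposition.transpose a b"
  shows "cmod (of_real (((X a)\<^sup>2 - 1) - ((X b)\<^sup>2 - 1)) * (\<phi> X * ker pos X a a - \<phi> Y * ker pos Y a a))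
    \<le> (X a - X b)\<^sup>2 * (2 * K * (16 * C / (sqrt (real n) * t ^ 3) + 2 * L / t\<^sup>2))"
proof -
  define p where "p = fst (pos a)"
  define q where "q = snd (pos a)"
  have pq: "p < 2 * n" "q < 2 * n" using pos_bound[OF a] by (auto simp: p_def q_def)
  define d where "d = X a - X b"
  have ab: "\<bar>((X a)\<^sup>2 - 1) - ((X b)\<^sup>2 - 1)\<bar> \<le> 2 * K * \<bar>d\<bar>"
  proof -
    have "((X a)\<^sup>2 - 1) - ((X b)\<^sup>2 - 1) = (X a + X b) * d" by (simp add: d_def power2_eq_square algebra_simps)
    moreover have "\<bar>X a + X b\<bar> \<le> 2 * K" using X_le[OF pi X a] X_le[OF pi X b] by linarith
    ultimately show ?thesis by (simp add: abs_mult mult_right_mono)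
  qed
  have k1: "cmod (ker pos X a a - ker pos Y a a) \<le> 16 * \<bar>d\<bar> / (sqrt (real n) * t ^ 3)"
    unfolding ker_def d_def Y_def using pq unfolding p_def q_def by (intro kernel_change_both a b)
  have k2: "cmod (ker pos Y a a) \<le> 2 / t\<^sup>2"
    unfolding ker_def using pq a unfolding p_def q_def by (intro kernel_le)
  have "\<phi> X * ker pos X a a - \<phi> Y * ker pos Y a a = \<phi> X * (ker pos X a a - ker pos Y a a) + (\<phi> X - \<phi> Y) * ker pos Y a a"
    by (simp add: algebra_simps)
  also have "cmod \<dots> \<le> C * (16 * \<bar>d\<bar> / (sqrt (real n) * t ^ 3)) + (L * \<bar>d\<bar>) * (2 / t\<^sup>2)"
  proof (intro order_trans[OF norm_triangle_ineq] add_mono)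
    show "cmod (\<phi> X * (ker pos X a a - ker pos Y a a)) \<le> C * (16 * \<bar>d\<bar> / (sqrt (real n) * t ^ 3))"
      unfolding norm_mult using phi_le[OF pi] k1 C_nonneg unfolding X by (intro mult_mono) auto
    show "cmod ((\<phi> X - \<phi> Y) * ker pos Y a a) \<le> (L * \<bar>d\<bar>) * (2 / t\<^sup>2)"
      unfolding norm_mult using phi_swap[OF pi a b] k2 L unfolding X Y_def d_def by (intro mult_mono) auto
  qed
  also have "\<dots> = \<bar>d\<bar> * (16 * C / (sqrt (real n) * t ^ 3) + 2 * L / t\<^sup>2)" by (simp add: algebra_simps)
  finally have k: "cmod (\<phi> X * ker pos X a a - \<phi> Y * ker pos Y a a) \<le> \<bar>d\<bar> * (16 * C / (sqrt (real n) * t ^ 3) + 2 * L / t\<^sup>2)" .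
  have "cmod (of_real (((X a)\<^sup>2 - 1) - ((X b)\<^sup>2 - 1)) * (\<phi> X * ker pos X a a - \<phi> Y * ker pos Y a a))
     \<le> (2 * K * \<bar>d\<bar>) * (\<bar>d\<bar> * (16 * C / (sqrt (real n) * t ^ 3) + 2 * L / t\<^sup>2))"
    unfolding norm_mult norm_of_real using ab k K_nonneg by (intro mult_mono) auto
  also have "\<dots> = (\<bar>d\<bar> * \<bar>d\<bar>) * (2 * K * (16 * C / (sqrt (real n) * t ^ 3) + 2 * L / t\<^sup>2))" by (simp only: ac_simps)
  also have "\<bar>d\<bar> * \<bar>d\<bar> = d\<^sup>2" by (simp add: power2_eq_square)
  finally show ?thesis unfolding d_def .
qed

text \<open>Approximately, the array term of the trace equations may be replaced by minus the
  averaged diagonal kernel, even after multiplication by the test function. Of the sums defined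
  below, D is the main term, R the first order remainder, Q the off-diagonal part, and V the
  fluctuation of the squares, which becomes U after the second exchange.\<close>

lemma averaged_estimate:
  "cmod (\<Sum>\<pi>\<in>P. \<phi> (x \<circ> \<pi>) *
     ((\<Sum>a\<in>S. of_real (x (\<pi> a)) * entry pos (x \<circ> \<pi>) a) / of_real (real n * sqrt (real n))
       + (\<Sum>a\<in>S. ker pos (x \<circ> \<pi>) a a) / of_nat (n\<^sup>2)))
    \<le> card P * (sqrt (real n) * (32 * C * K / (real n * t ^ 3) + L / t)
       + K * (16 * C / (sqrt (real n) * t ^ 3) + 2 * L / t\<^sup>2) + 4 * C / (real n * t\<^sup>2))"
proof -
  define s where "s = sqrt (real n)"
  have s: "s > 0" using n by (simp add: s_def)
  have n': "real n > 0" using n by simp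
  define \<tau> where "\<tau> = (\<lambda>a b :: nat \<times> nat. Transposition.transpose a b)"
  define A where "A \<pi> = (\<Sum>a\<in>S. \<Sum>b\<in>S. of_real (x (\<pi> a) - x (\<pi> b)) *
     (\<phi> (x \<circ> \<pi>) * entry pos (x \<circ> \<pi>) a - \<phi> (x \<circ> \<pi> \<circ> \<tau> a b) * entry pos (x \<circ> \<pi> \<circ> \<tau> a b) a))" for \<pi>
  define R where "R \<pi> = (\<Sum>a\<in>S. \<Sum>b\<in>S. of_real (x (\<pi> a) - x (\<pi> b)) *
     (\<phi> (x \<circ> \<pi>) * entry pos (x \<circ> \<pi>) a - \<phi> (x \<circ> \<pi> \<circ> \<tau> a b) * entry pos (x \<circ> \<pi> \<circ> \<tau> a b) a)
     + \<phi> (x \<circ> \<pi>) * of_real ((x (\<pi> a) - x (\<pi> b))\<^sup>2 / s) * (ker pos (x \<circ> \<pi>) a a - ker pos (x \<circ> \<pi>) a b))" for \<pi>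
  define Q where "Q \<pi> = (\<Sum>a\<in>S. \<Sum>b\<in>S. \<phi> (x \<circ> \<pi>) * of_real ((x (\<pi> a) - x (\<pi> b))\<^sup>2) * ker pos (x \<circ> \<pi>) a b)" for \<pi>
  define D where "D \<pi> = (\<Sum>a\<in>S. \<phi> (x \<circ> \<pi>) * ker pos (x \<circ> \<pi>) a a)" for \<pi>
  define V where "V \<pi> = (\<Sum>a\<in>S. of_real ((x (\<pi> a))\<^sup>2 - 1) * (\<phi> (x \<circ> \<pi>) * ker pos (x \<circ> \<pi>) a a))" for \<pi>
  define U where "U \<pi> = (\<Sum>a\<in>S. \<Sum>b\<in>S. of_real (((x (\<pi> a))\<^sup>2 - 1) - ((x (\<pi> b))\<^sup>2 - 1)) *
     (\<phi> (x \<circ> \<pi>) * ker pos (x \<circ> \<pi>) a a - \<phi> (x \<circ> \<pi> \<circ> \<tau> a b) * ker pos (x \<circ> \<pi> \<circ> \<tau> a b) a a))" for \<pi>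
  define eR where "eR = 32 * C * K / (real n * t ^ 3) + L / t"
  define eV where "eV = 2 * K * (16 * C / (s * t ^ 3) + 2 * L / t\<^sup>2)"
  have fin: "finite S" by simp
  \<comment> \<open>The normalization of the squares is exactly the centring that
    \<open>swap_integration_by_parts\<close> requires.\<close>
  have x2_sum: "(\<Sum>c\<in>S. (x c)\<^sup>2 - 1) = 0"
    using x_square card_S by (simp add: sum_subtractf)
  have pair: "cmod (\<Sum>a\<in>S. \<Sum>b\<in>S. h a b) \<le> 2 * real n ^ 4 * e"
    if "\<pi> \<in> P" and "\<And>a b. a \<in> S \<Longrightarrow> b \<in> S \<Longrightarrow> cmod (h a b) \<le> (x (\<pi> a) - x (\<pi> b))\<^sup>2 * e" for h \<pi> e
  proof -
    have "cmod (\<Sum>a\<in>S. \<Sum>b\<in>S. h a b) \<le> (\<Sum>a\<in>S. \<Sum>b\<in>S. (x (\<pi> a) - x (\<pi> b))\<^sup>2 * e)"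
      using that(2) by (intro sum_norm_le) auto
    also have "\<dots> = (\<Sum>a\<in>S. \<Sum>b\<in>S. (x (\<pi> a) - x (\<pi> b))\<^sup>2) * e" by (simp only: sum_distrib_right)
    also have "(\<Sum>a\<in>S. \<Sum>b\<in>S. (x (\<pi> a) - x (\<pi> b))\<^sup>2) = 2 * real n ^ 4"
      using X_diff_square[of \<pi> "x \<circ> \<pi>"] that(1) by simp
    finally show ?thesis .
  qed
  have R_le: "cmod (R \<pi>) \<le> 2 * real n ^ 4 * eR" if "\<pi> \<in> P" for \<pi>
    unfolding R_def eR_def \<tau>_def s_def
    by (rule pair[OF that], use that first_order_pathwise[of \<pi> "x \<circ> \<pi>"] in simp)
  have U_le: "cmod (U \<pi>) \<le> 2 * real n ^ 4 * eV" if "\<pi> \<in> P" for \<pi>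
    unfolding U_def eV_def \<tau>_def s_def
    by (rule pair[OF that], use that second_order_pathwise[of \<pi> "x \<circ> \<pi>"] in simp)
  have Q_le: "cmod (Q \<pi>) \<le> C * (8 * (real n) ^ 3 / t\<^sup>2)" if "\<pi> \<in> P" for \<pi>
    unfolding Q_def using off_diagonal_pathwise[of \<pi> "x \<circ> \<pi>"] that by simp
  have sum_P: "cmod (\<Sum>\<pi>\<in>P. h \<pi>) \<le> card P * e" if "\<And>\<pi>. \<pi> \<in> P \<Longrightarrow> cmod (h \<pi>) \<le> e" for h and e :: real
    using sum_norm_le[of P h "\<lambda>_. e"] that by simp
  \<comment> \<open>The row sum n^2 ((X a)^2 + 1) is split as n^2 times ((X a)^2 - 1) + 2, which
    produces V + 2 D.\<close>
  have A: "A \<pi> = R \<pi> - of_real ((real n)\<^sup>2 / s) * (V \<pi> + 2 * D \<pi>) + of_real (1 / s) * Q \<pi>" if "\<pi> \<in> P" for \<pi>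
  proof -
    have "R \<pi> = A \<pi> + (\<Sum>a\<in>S. \<Sum>b\<in>S. \<phi> (x \<circ> \<pi>) * of_real ((x (\<pi> a) - x (\<pi> b))\<^sup>2 / s) * ker pos (x \<circ> \<pi>) a a) - of_real (1 / s) * Q \<pi>"
      unfolding R_def A_def Q_def sum_distrib_left sum.distrib[symmetric] sum_subtractf[symmetric]
      by (intro sum.cong refl) (simp add: algebra_simps diff_divide_distrib add_divide_distrib)
    also have "(\<Sum>a\<in>S. \<Sum>b\<in>S. \<phi> (x \<circ> \<pi>) * of_real ((x (\<pi> a) - x (\<pi> b))\<^sup>2 / s) * ker pos (x \<circ> \<pi>) a a)
       = of_real ((real n)\<^sup>2 / s) * (V \<pi> + 2 * D \<pi>)"
    proof -
      have "(\<Sum>b\<in>S. \<phi> (x \<circ> \<pi>) * of_real ((x (\<pi> a) - x (\<pi> b))\<^sup>2 / s) * ker pos (x \<circ> \<pi>) a a)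
        = of_real ((real n)\<^sup>2 / s) * (of_real ((x (\<pi> a))\<^sup>2 - 1) * (\<phi> (x \<circ> \<pi>) * ker pos (x \<circ> \<pi>) a a) + 2 * (\<phi> (x \<circ> \<pi>) * ker pos (x \<circ> \<pi>) a a))" for a
      proof -
        have "(\<Sum>b\<in>S. (x (\<pi> a) - x (\<pi> b))\<^sup>2) = (real n)\<^sup>2 * ((x (\<pi> a))\<^sup>2 + 1)"
          using X_diff_square_row[of \<pi> "x \<circ> \<pi>" a] that by simp
        then have "complex_of_real (\<Sum>b\<in>S. (x (\<pi> a) - x (\<pi> b))\<^sup>2 / s) = of_real ((real n)\<^sup>2 / s * ((x (\<pi> a))\<^sup>2 + 1))"
          by (simp add: sum_divide_distrib[symmetric])
        then show ?thesis
          unfolding sum_distrib_right[symmetric] sum_distrib_left[symmetric] of_real_sum[symmetric]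
          by (simp add: algebra_simps)
      qed
      then show ?thesis unfolding V_def D_def sum_distrib_left sum.distrib[symmetric] by simp
    qed
    finally show ?thesis by simp
  qed
  have T: "(\<Sum>\<pi>\<in>P. \<Sum>a\<in>S. of_real (x (\<pi> a)) * (\<phi> (x \<circ> \<pi>) * entry pos (x \<circ> \<pi>) a)) = (\<Sum>\<pi>\<in>P. A \<pi>) / of_nat (2 * n\<^sup>2)"
  proof -
    have "(\<Sum>\<pi>\<in>P. \<Sum>a\<in>S. of_real (x (\<pi> a)) * (\<phi> (x \<circ> \<pi>) * entry pos (x \<circ> \<pi>) a))
       = (\<Sum>a\<in>S. \<Sum>\<pi>\<in>P. of_real (x (\<pi> a)) * (\<phi> (x \<circ> \<pi>) * entry pos (x \<circ> \<pi>) a))" by (rule sum.swap)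
    also have "\<dots> = (\<Sum>a\<in>S. (\<Sum>\<pi>\<in>P. \<Sum>b\<in>S. of_real (x (\<pi> a) - x (\<pi> b)) *
       (\<phi> (x \<circ> \<pi>) * entry pos (x \<circ> \<pi>) a - \<phi> (x \<circ> \<pi> \<circ> \<tau> a b) * entry pos (x \<circ> \<pi> \<circ> \<tau> a b) a)) / of_nat (2 * card S))"
      by (intro sum.cong refl, subst swap_integration_by_parts[OF fin x_sum]) (simp_all only: o_assoc \<tau>_def)
    also have "\<dots> = (\<Sum>\<pi>\<in>P. A \<pi>) / of_nat (2 * n\<^sup>2)"
      unfolding A_def card_S sum_divide_distrib[symmetric] by (subst sum.swap) simp
    finally show ?thesis .
  qed
  have V: "(\<Sum>\<pi>\<in>P. V \<pi>) = (\<Sum>\<pi>\<in>P. U \<pi>) / of_nat (2 * n\<^sup>2)"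
  proof -
    have "(\<Sum>\<pi>\<in>P. V \<pi>)
       = (\<Sum>a\<in>S. \<Sum>\<pi>\<in>P. of_real ((x (\<pi> a))\<^sup>2 - 1) * (\<phi> (x \<circ> \<pi>) * ker pos (x \<circ> \<pi>) a a))" unfolding V_def by (rule sum.swap)
    also have "\<dots> = (\<Sum>a\<in>S. (\<Sum>\<pi>\<in>P. \<Sum>b\<in>S. of_real (((x (\<pi> a))\<^sup>2 - 1) - ((x (\<pi> b))\<^sup>2 - 1)) *
       (\<phi> (x \<circ> \<pi>) * ker pos (x \<circ> \<pi>) a a - \<phi> (x \<circ> \<pi> \<circ> \<tau> a b) * ker pos (x \<circ> \<pi> \<circ> \<tau> a b) a a)) / of_nat (2 * card S))"
      by (intro sum.cong refl, subst swap_integration_by_parts[OF fin x2_sum]) (simp_all only: o_assoc \<tau>_def)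
    also have "\<dots> = (\<Sum>\<pi>\<in>P. U \<pi>) / of_nat (2 * n\<^sup>2)"
      unfolding U_def card_S sum_divide_distrib[symmetric] by (subst sum.swap) simp
    finally show ?thesis .
  qed
  have lhs: "(\<Sum>\<pi>\<in>P. \<phi> (x \<circ> \<pi>) *
     ((\<Sum>a\<in>S. of_real (x (\<pi> a)) * entry pos (x \<circ> \<pi>) a) / of_real (real n * s) + (\<Sum>a\<in>S. ker pos (x \<circ> \<pi>) a a) / of_nat (n\<^sup>2)))
     = (\<Sum>\<pi>\<in>P. \<Sum>a\<in>S. of_real (x (\<pi> a)) * (\<phi> (x \<circ> \<pi>) * entry pos (x \<circ> \<pi>) a)) / of_real (real n * s) + (\<Sum>\<pi>\<in>P. D \<pi>) / of_nat (n\<^sup>2)"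
    unfolding sum_divide_distrib D_def sum.distrib[symmetric]
    by (intro sum.cong refl) (simp add: distrib_left sum_distrib_left sum_divide_distrib mult.left_commute)
  have A_sum: "(\<Sum>\<pi>\<in>P. A \<pi>) = (\<Sum>\<pi>\<in>P. R \<pi>) - of_real ((real n)\<^sup>2 / s) * ((\<Sum>\<pi>\<in>P. V \<pi>) + 2 * (\<Sum>\<pi>\<in>P. D \<pi>)) + of_real (1 / s) * (\<Sum>\<pi>\<in>P. Q \<pi>)"
    unfolding sum_distrib_left sum.distrib[symmetric] sum_subtractf[symmetric] by (intro sum.cong refl A)
  have ss: "complex_of_real s * complex_of_real s = of_nat n" unfolding s_def of_real_mult[symmetric] by simp
  \<comment> \<open>With s^2 = n the contributions of D cancel exactly, leaving only the three error
    sums.\<close>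
  have "(\<Sum>\<pi>\<in>P. A \<pi>) / of_nat (2 * n\<^sup>2) / of_real (real n * s) + (\<Sum>\<pi>\<in>P. D \<pi>) / of_nat (n\<^sup>2)
    = (\<Sum>\<pi>\<in>P. R \<pi>) / of_real (2 * real n ^ 3 * s) - (\<Sum>\<pi>\<in>P. U \<pi>) / of_real (4 * real n ^ 4) + (\<Sum>\<pi>\<in>P. Q \<pi>) / of_real (2 * real n ^ 4)"
  proof -
    have alg: "(r - (m\<^sup>2 / z) * ((u / (2 * m\<^sup>2)) + 2 * d) + (1 / z) * q) / (2 * m\<^sup>2) / (m * z) + d / m\<^sup>2
       = r / (2 * m ^ 3 * z) - u / (4 * m ^ 4) + q / (2 * m ^ 4)" if "z * z = m" "m \<noteq> 0" for r u d q m z :: complex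
    proof -
      have z: "z \<noteq> 0" using that by auto
      have e1: "(m\<^sup>2 / z) * ((u / (2 * m\<^sup>2)) + 2 * d) / (2 * m\<^sup>2) / (m * z) = ((u / (2 * m\<^sup>2)) + 2 * d) / (2 * m * (z * z))"
        using that(2) z by (simp add: field_simps)
      have e2: "(1 / z) * q / (2 * m\<^sup>2) / (m * z) = q / (2 * m ^ 3 * (z * z))"
        using that(2) z by (simp add: field_simps power2_eq_square power3_eq_cube)
      have e3: "r / (2 * m\<^sup>2) / (m * z) = r / (2 * m ^ 3 * z)" by (simp add: power2_eq_square power3_eq_cube mult.assoc)
      have e4: "(r - (m\<^sup>2 / z) * ((u / (2 * m\<^sup>2)) + 2 * d) + (1 / z) * q) / (2 * m\<^sup>2) / (m * z)
        = r / (2 * m\<^sup>2) / (m * z) - (m\<^sup>2 / z) * ((u / (2 * m\<^sup>2)) + 2 * d) / (2 * m\<^sup>2) / (m * z) + (1 / z) * q / (2 * m\<^sup>2) / (m * z)"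
        by (simp only: diff_divide_distrib add_divide_distrib)
      show ?thesis unfolding e4 e1 e2 e3 that(1) using that(2)
        by (simp add: field_simps power2_eq_square power3_eq_cube power4_eq_xxxx)
    qed
    show ?thesis unfolding A_sum V
      using alg[OF ss, of "\<Sum>\<pi>\<in>P. R \<pi>" "\<Sum>\<pi>\<in>P. U \<pi>" "\<Sum>\<pi>\<in>P. D \<pi>" "\<Sum>\<pi>\<in>P. Q \<pi>"] n by simp
  qed
  then have "cmod (\<Sum>\<pi>\<in>P. \<phi> (x \<circ> \<pi>) *
     ((\<Sum>a\<in>S. of_real (x (\<pi> a)) * entry pos (x \<circ> \<pi>) a) / of_real (real n * s) + (\<Sum>a\<in>S. ker pos (x \<circ> \<pi>) a a) / of_nat (n\<^sup>2)))
     = cmod ((\<Sum>\<pi>\<in>P. R \<pi>) / of_real (2 * real n ^ 3 * s) - (\<Sum>\<pi>\<in>P. U \<pi>) / of_real (4 * real n ^ 4) + (\<Sum>\<pi>\<in>P. Q \<pi>) / of_real (2 * real n ^ 4))"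
    unfolding lhs T by simp
  also have "\<dots> \<le> cmod (\<Sum>\<pi>\<in>P. R \<pi>) / (2 * real n ^ 3 * s) + cmod (\<Sum>\<pi>\<in>P. U \<pi>) / (4 * real n ^ 4) + cmod (\<Sum>\<pi>\<in>P. Q \<pi>) / (2 * real n ^ 4)"
  proof -
    have "cmod (y / of_real c) = cmod y / c" if "c \<ge> 0" for y and c :: real using that by (simp add: norm_divide)
    from this[of "2 * real n ^ 3 * s"] this[of "4 * real n ^ 4"] this[of "2 * real n ^ 4"]
    have c: "cmod (y / of_real (2 * real n ^ 3 * s)) = cmod y / (2 * real n ^ 3 * s)"
      "cmod (y / of_real (4 * real n ^ 4)) = cmod y / (4 * real n ^ 4)"
      "cmod (y / of_real (2 * real n ^ 4)) = cmod y / (2 * real n ^ 4)" for y using s by simp_all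
    have tri: "cmod (r - u + q) \<le> cmod r + cmod u + cmod q" for r u q :: complex
      by (rule order_trans[OF norm_triangle_ineq]) (simp add: norm_triangle_ineq4)
    show ?thesis unfolding c[symmetric] by (rule tri)
  qed
  also have "\<dots> \<le> card P * (2 * real n ^ 4 * eR) / (2 * real n ^ 3 * s) + card P * (2 * real n ^ 4 * eV) / (4 * real n ^ 4) + card P * (C * (8 * (real n) ^ 3 / t\<^sup>2)) / (2 * real n ^ 4)"
    using s by (intro add_mono divide_right_mono sum_P[OF R_le] sum_P[OF U_le] sum_P[OF Q_le]) auto
  also have "\<dots> = card P * (s * eR + eV / 2 + 4 * C / (real n * t\<^sup>2))"
  proof -
    have rs: "real n / s = s" unfolding s_def using n by (simp add: real_div_sqrt)
    have "real (card P) * (2 * real n ^ 4 * eR) / (2 * real n ^ 3 * s) = card P * ((real n / s) * eR)"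
      using n s by (simp add: field_simps power3_eq_cube power4_eq_xxxx)
    moreover have "real (card P) * (2 * real n ^ 4 * eV) / (4 * real n ^ 4) = card P * (eV / 2)" using n by simp
    moreover have "real (card P) * (C * (8 * (real n) ^ 3 / t\<^sup>2)) / (2 * real n ^ 4) = card P * (4 * C / (real n * t\<^sup>2))"
      using n t by (simp add: field_simps power3_eq_cube power4_eq_xxxx)
    ultimately show ?thesis unfolding rs by (simp only: distrib_left)
  qed
  finally show ?thesis unfolding s_def eR_def eV_def by simp
qed

end

end

section \<open>The self-consistent equation\<close>

definition fixed_map :: "real \<Rightarrow> real \<Rightarrow> real" where
  "fixed_map r w = w - w / (w\<^sup>2 + r\<^sup>2)"

text \<open>Write \<open>fixed_map r u\<close> as u * k u with k increasing on the positive axis and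
  k w = t / w positive. Comparing v k v with w k w on either side of w gives the slope t / w, even
  though \<open>fixed_map\<close> need not be monotone for small arguments.\<close>

lemma fixed_map_stability:
  assumes w: "w > 0" "fixed_map r w = t" and t: "t > 0" and v: "v > 0"
  shows "\<bar>v - w\<bar> \<le> (w / t) * \<bar>fixed_map r v - t\<bar>"
proof -
  define k where "k u = 1 - 1 / (u\<^sup>2 + r\<^sup>2)" for u
  have pos: "u\<^sup>2 + r\<^sup>2 > 0" if "u > 0" for u using that by (intro add_pos_nonneg) auto
  have F: "fixed_map r u = u * k u" for u by (simp add: fixed_map_def k_def algebra_simps)
  have kw: "k w = t / w" using w F[of w] by (simp add: field_simps)
  have mono: "k u \<le> k u'" if "0 < u" "u \<le> u'" for u u'
  proof -
    have "u\<^sup>2 + r\<^sup>2 \<le> u'\<^sup>2 + r\<^sup>2" using that by (simp add: power_mono)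
    then have "1 / (u'\<^sup>2 + r\<^sup>2) \<le> 1 / (u\<^sup>2 + r\<^sup>2)" using pos[OF that(1)] by (intro divide_left_mono) auto
    then show ?thesis by (simp add: k_def)
  qed
  have "\<bar>v - w\<bar> * k w \<le> \<bar>fixed_map r v - t\<bar>"
  proof (cases "v \<ge> w")
    case True
    have "(v - w) * k w \<le> (v - w) * k v" using mono[OF w(1) True] True by (intro mult_left_mono) auto
    also have "\<dots> \<le> v * k v - w * k w" using mono[OF w(1) True] w(1) by (simp add: left_diff_distrib)
    also have "\<dots> = fixed_map r v - t" using w(2) by (simp add: F)
    finally show ?thesis using True by simp
  next
    case False
    have "(w - v) * k w \<le> w * k w - v * k v" using mono[OF v, of w] False v by (simp add: left_diff_distrib)
    also have "\<dots> = t - fixed_map r v" using w(2) by (simp add: F)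
    finally show ?thesis using False by simp
  qed
  then show ?thesis unfolding kw using w t by (simp add: field_simps)
qed

lemma fixed_map_solution:
  assumes t: "t > 0"
  shows "\<exists>!w. w > 0 \<and> fixed_map r w = t"
proof -
  have pos: "u\<^sup>2 + r\<^sup>2 > 0" if "u > 0" for u using that by (intro add_pos_nonneg) auto
  have lo: "fixed_map r t \<le> t" unfolding fixed_map_def using pos[OF t] t by simp
  \<comment> \<open>At u = t + 1 / t the subtracted term is at most 1 / u, hence at most 1 /
    t.\<close>
  have hi: "t \<le> fixed_map r (t + 1 / t)"
  proof -
    define u where "u = t + 1 / t"
    have u: "u > 0" using t by (simp add: u_def add_pos_pos)
    have "u / (u\<^sup>2 + r\<^sup>2) \<le> u / u\<^sup>2" using u pos[OF u] by (intro divide_left_mono) auto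
    also have "\<dots> = 1 / u" using u by (simp add: power2_eq_square)
    also have "\<dots> \<le> 1 / t" using t u by (intro divide_left_mono) (auto simp: u_def)
    finally show ?thesis unfolding fixed_map_def u_def[symmetric] by (simp add: u_def)
  qed
  have "continuous_on {t..t + 1 / t} (fixed_map r)"
    unfolding fixed_map_def using pos t by (intro continuous_intros) (metis atLeastAtMost_iff less_le_trans less_numeral_extra(3))
  from IVT'[of "fixed_map r", OF lo hi _ this] t obtain w where w: "w \<ge> t" "fixed_map r w = t" by auto
  show ?thesis
  proof (intro ex1I[of _ w] conjI)
    show "w > 0" "fixed_map r w = t" using w t by auto
    fix v assume v: "v > 0 \<and> fixed_map r v = t"
    have "\<bar>v - w\<bar> \<le> (w / t) * \<bar>fixed_map r v - t\<bar>" using v w t by (intro fixed_map_stability) auto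
    then show "v = w" using v by simp
  qed
qed

definition fixed_point :: "real \<Rightarrow> real \<Rightarrow> real" where
  "fixed_point r t = (THE w. w > 0 \<and> fixed_map r w = t)"

lemma fixed_point:
  assumes "t > 0"
  shows "fixed_point r t > 0" "fixed_map r (fixed_point r t) = t"
  using theI'[OF fixed_map_solution[OF assms, of r]] unfolding fixed_point_def by auto

lemma fixed_point_unique:
  assumes "t > 0" "w > 0" "fixed_map r w = t"
  shows "fixed_point r t = w"
  using fixed_map_solution[OF assms(1), of r] fixed_point[OF assms(1), of r] assms by blast

text \<open>Collects the constants of \<open>averaged_estimate\<close> with C = 2 + |z| / t + 1 /
  t^2 as bound for the defects and lam = |z| + t + 2 / t as their Lipschitz factor: 48 = 32 + 16
  from the terms with K, and 5 = 4 + 1 from the off-diagonal terms and from \<open>m\<close>. What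
  matters is that it does not depend on n.\<close>

definition error_const :: "complex \<Rightarrow> real \<Rightarrow> real" where
  "error_const z t = 48 * (2 + cmod z / t + 1 / t\<^sup>2) / t ^ 3 + 8 * (cmod z + t + 2 / t) / t ^ 4
     + 4 * (cmod z + t + 2 / t) / t ^ 3 + 5 * (2 + cmod z / t + 1 / t\<^sup>2) / t\<^sup>2"

context swap_array
begin

text \<open>The test function is the conjugate of the defect \<Delta> itself, so the averaged
  estimate bounds the mean of its squared modulus directly. The bounds assumed on \<Delta> are wide
  enough to serve both defects.\<close>

lemma mean_square_estimate:
  fixes \<Delta> m :: "(nat \<times> nat \<Rightarrow> real) \<Rightarrow> complex"
  assumes pos: "pos = (\<lambda>(i, j). (n + j, i)) \<or> pos = (\<lambda>(i, j). (i, j))"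
    and T: "\<And>X. \<Delta> X = (\<Sum>a\<in>S. of_real (X a) * G X (fst (pos a)) (snd (pos a))) / of_real (real n * sqrt (real n)) + m X"
    and m: "\<And>X. cmod ((\<Sum>c\<in>S. W (G X) (G X) c (fst (pos c)) (snd (pos c))) / of_nat (n\<^sup>2) - m X) \<le> 1 / (real n * t\<^sup>2)"
    and bound: "\<And>X. cmod (\<Delta> X) \<le> 2 + cmod z / t + 1 / t\<^sup>2"
    and swap: "\<And>X a b. a \<in> S \<Longrightarrow> b \<in> S \<Longrightarrow> cmod (\<Delta> X - \<Delta> (X \<circ> Transposition.transpose a b))
        \<le> (cmod z + t + 2 / t) * (4 * \<bar>X a - X b\<bar> / (real n * sqrt (real n) * t\<^sup>2))"
  shows "(\<Sum>\<pi>\<in>P. (cmod (\<Delta> (x \<circ> \<pi>)))\<^sup>2) \<le> card P * (error_const z t * (K / sqrt (real n) + 1 / real n))"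
proof -
  define C where "C = 2 + cmod z / t + 1 / t\<^sup>2"
  define lam where "lam = cmod z + t + 2 / t"
  define L where "L = lam * 4 / (real n * sqrt (real n) * t\<^sup>2)"
  have C: "C \<ge> 0" and l: "lam \<ge> 0" using t by (auto simp: C_def lam_def)
  have L: "L \<ge> 0" using l t by (auto simp: L_def)
  define s where "s = sqrt (real n)"
  have s: "s > 0" "s * s = real n" using n by (auto simp: s_def)
  have s1: "s \<ge> 1" using n by (simp add: s_def)
  define \<phi> where "\<phi> X = cnj (\<Delta> X)" for X
  define T where "T X = (\<Sum>a\<in>S. of_real (X a) * G X (fst (pos a)) (snd (pos a))) / of_real (real n * sqrt (real n))" for X
  define Z where "Z X = (\<Sum>c\<in>S. W (G X) (G X) c (fst (pos c)) (snd (pos c))) / of_nat (n\<^sup>2)" for X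
  have phi1: "cmod (\<phi> (x \<circ> \<pi>)) \<le> C" for \<pi>
    using bound unfolding \<phi>_def C_def by (simp only: complex_mod_cnj)
  have phi2: "cmod (\<phi> (x \<circ> \<pi>) - \<phi> (x \<circ> \<pi> \<circ> Transposition.transpose a b)) \<le> L * \<bar>x (\<pi> a) - x (\<pi> b)\<bar>"
    if "a \<in> S" "b \<in> S" for \<pi> a b
    using swap[OF that, of "x \<circ> \<pi>", folded lam_def] unfolding \<phi>_def complex_cnj_diff[symmetric] complex_mod_cnj L_def
    by (simp add: ac_simps)
  have est: "cmod (\<Sum>\<pi>\<in>P. \<phi> (x \<circ> \<pi>) * (T (x \<circ> \<pi>) + Z (x \<circ> \<pi>)))
     \<le> card P * (s * (32 * C * K / (real n * t ^ 3) + L / t)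
       + K * (16 * C / (s * t ^ 3) + 2 * L / t\<^sup>2) + 4 * C / (real n * t\<^sup>2))"
    using averaged_estimate[of \<phi> C L pos, OF phi1 phi2 L pos]
    unfolding entry_def ker_def T_def Z_def s_def comp_apply by simp
  \<comment> \<open>The array term plus \<open>m\<close> is \<Delta>; exchanging \<open>m\<close>
    for the averaged kernel Z brings in the form to which \<open>averaged_estimate\<close>
    applies.\<close>
  have split: "complex_of_real (\<Sum>\<pi>\<in>P. (cmod (\<Delta> (x \<circ> \<pi>)))\<^sup>2)
     = (\<Sum>\<pi>\<in>P. \<phi> (x \<circ> \<pi>) * (T (x \<circ> \<pi>) + Z (x \<circ> \<pi>))) - (\<Sum>\<pi>\<in>P. \<phi> (x \<circ> \<pi>) * (Z (x \<circ> \<pi>) - m (x \<circ> \<pi>)))"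
    unfolding of_real_sum sum_subtractf[symmetric]
  proof (intro sum.cong refl)
    fix \<pi>
    have "complex_of_real ((cmod (\<Delta> (x \<circ> \<pi>)))\<^sup>2) = \<phi> (x \<circ> \<pi>) * (T (x \<circ> \<pi>) + m (x \<circ> \<pi>))"
      using T[of "x \<circ> \<pi>"] unfolding complex_norm_square \<phi>_def T_def by (simp only: mult.commute)
    then show "complex_of_real ((cmod (\<Delta> (x \<circ> \<pi>)))\<^sup>2) = \<phi> (x \<circ> \<pi>) * (T (x \<circ> \<pi>) + Z (x \<circ> \<pi>)) - \<phi> (x \<circ> \<pi>) * (Z (x \<circ> \<pi>) - m (x \<circ> \<pi>))"
      by (simp add: algebra_simps)
  qed
  have "\<bar>\<Sum>\<pi>\<in>P. (cmod (\<Delta> (x \<circ> \<pi>)))\<^sup>2\<bar>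
     \<le> cmod (\<Sum>\<pi>\<in>P. \<phi> (x \<circ> \<pi>) * (T (x \<circ> \<pi>) + Z (x \<circ> \<pi>))) + cmod (\<Sum>\<pi>\<in>P. \<phi> (x \<circ> \<pi>) * (Z (x \<circ> \<pi>) - m (x \<circ> \<pi>)))"
    using arg_cong[OF split, of cmod] unfolding norm_of_real by (simp only: norm_triangle_ineq4)
  also have "cmod (\<Sum>\<pi>\<in>P. \<phi> (x \<circ> \<pi>) * (Z (x \<circ> \<pi>) - m (x \<circ> \<pi>))) \<le> (\<Sum>\<pi>\<in>P. C * (1 / (real n * t\<^sup>2)))"
  proof (intro sum_norm_le)
    fix \<pi>
    show "cmod (\<phi> (x \<circ> \<pi>) * (Z (x \<circ> \<pi>) - m (x \<circ> \<pi>))) \<le> C * (1 / (real n * t\<^sup>2))"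
      unfolding norm_mult using phi1[of \<pi>] m[of "x \<circ> \<pi>"] C unfolding Z_def by (intro mult_mono) auto
  qed
  also have "\<dots> = card P * (C / (real n * t\<^sup>2))" by simp
  finally have "(\<Sum>\<pi>\<in>P. (cmod (\<Delta> (x \<circ> \<pi>)))\<^sup>2) \<le> card P * (s * (32 * C * K / (real n * t ^ 3) + L / t)
       + K * (16 * C / (s * t ^ 3) + 2 * L / t\<^sup>2) + 4 * C / (real n * t\<^sup>2)) + card P * (C / (real n * t\<^sup>2))"
    using est by linarith
  also have "\<dots> = card P * (s * (32 * C * K / (real n * t ^ 3) + L / t)
       + K * (16 * C / (s * t ^ 3) + 2 * L / t\<^sup>2) + 4 * C / (real n * t\<^sup>2) + C / (real n * t\<^sup>2))"
    by (simp only: distrib_left)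
  also have "\<dots> \<le> card P * (error_const z t * (K / s + 1 / real n))"
  proof (rule mult_left_mono)
    have L': "L = lam * 4 / (real n * s * t\<^sup>2)" by (simp add: L_def s_def)
    have a: "s * (32 * C * K / (real n * t ^ 3) + L / t) = 32 * C / t ^ 3 * (K / s) + 4 * lam / t ^ 3 * (1 / real n)"
      unfolding L' s(2)[symmetric] using s(1) t by (simp add: field_simps power2_eq_square power3_eq_cube)
    have b: "K * (16 * C / (s * t ^ 3) + 2 * L / t\<^sup>2) = 16 * C / t ^ 3 * (K / s) + 8 * lam / t ^ 4 * (K / s) * (1 / real n)"
      unfolding L' using s t by (simp add: field_simps power2_eq_square power3_eq_cube power4_eq_xxxx)
    have "8 * lam / t ^ 4 * (K / s) * (1 / real n) \<le> 8 * lam / t ^ 4 * (K / s)"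
      using l K_nonneg s n t by (intro mult_right_le_one_le) auto
    then have "s * (32 * C * K / (real n * t ^ 3) + L / t)
       + K * (16 * C / (s * t ^ 3) + 2 * L / t\<^sup>2) + 4 * C / (real n * t\<^sup>2) + C / (real n * t\<^sup>2)
       \<le> (48 * C / t ^ 3 + 8 * lam / t ^ 4) * (K / s) + (4 * lam / t ^ 3 + 5 * C / t\<^sup>2) * (1 / real n)"
      unfolding a b by (simp add: algebra_simps)
    also have "\<dots> \<le> error_const z t * (K / s) + error_const z t * (1 / real n)"
    proof -
      have "0 \<le> 48 * C / t ^ 3" "0 \<le> 8 * lam / t ^ 4" "0 \<le> 4 * lam / t ^ 3" "0 \<le> 5 * C / t\<^sup>2"
        using C l t by simp_all
      then have "48 * C / t ^ 3 + 8 * lam / t ^ 4 \<le> error_const z t" "4 * lam / t ^ 3 + 5 * C / t\<^sup>2 \<le> error_const z t"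
        unfolding error_const_def C_def[symmetric] lam_def[symmetric] by linarith+
      then show ?thesis using K_nonneg s n by (intro add_mono mult_right_mono) auto
    qed
    finally show "s * (32 * C * K / (real n * t ^ 3) + L / t)
       + K * (16 * C / (s * t ^ 3) + 2 * L / t\<^sup>2) + 4 * C / (real n * t\<^sup>2) + C / (real n * t\<^sup>2)
       \<le> error_const z t * (K / s + 1 / real n)" by (simp only: distrib_left)
  qed simp
  finally show ?thesis unfolding s_def .
qed

section \<open>The two defects and the fixed point equation\<close>

abbreviation "g X \<equiv> tr 0 0 (G X)"
abbreviation "b X \<equiv> tr n 0 (G X)"

lemma norm_mult_le: "cmod u \<le> c \<Longrightarrow> cmod v \<le> d \<Longrightarrow> cmod (u * v) \<le> c * d"
  unfolding norm_mult by (intro mult_mono) (auto intro: order_trans[OF norm_ge_zero])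

lemma norm_mult_left_le: "cmod u \<le> c \<Longrightarrow> cmod (y * u) \<le> cmod y * c"
  by (rule norm_mult_le) simp

lemma norm_mult_cnj_left_le: "cmod u \<le> c \<Longrightarrow> cmod (cnj y * u) \<le> cmod y * c"
  by (rule norm_mult_le) simp

lemma norm_it_mult_le: "cmod u \<le> c \<Longrightarrow> cmod (\<i> * of_real t * u) \<le> t * c"
  using t by (intro norm_mult_le) (simp add: norm_mult)

lemma defect_1:
  "(\<Sum>\<pi>\<in>P. (cmod (1 + z * b (x \<circ> \<pi>) + \<i> * of_real t * g (x \<circ> \<pi>) + g (x \<circ> \<pi>) * g (x \<circ> \<pi>)))\<^sup>2)
    \<le> card P * (error_const z t * (K / sqrt (real n) + 1 / real n))"
proof (rule mean_square_estimate[where pos = "\<lambda>(i, j). (n + j, i)" and m = "\<lambda>X. g X * g X"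
    and \<Delta> = "\<lambda>X. 1 + z * b X + \<i> * of_real t * g X + g X * g X"])
  have gb: "cmod (g X) \<le> 1 / t" "cmod (b X) \<le> 1 / t" for X by (rule partial_trace_le; simp)+
  show "cmod (1 + z * b X + \<i> * of_real t * g X + g X * g X) \<le> 2 + cmod z / t + 1 / t\<^sup>2" for X
  proof -
    have "cmod (1 + z * b X + \<i> * of_real t * g X + g X * g X) \<le> 1 + cmod z * (1 / t) + t * (1 / t) + (1 / t) * (1 / t)"
      by (intro norm_triangle_mono norm_mult_left_le norm_it_mult_le norm_mult_le gb) simp
    then show ?thesis using t by (simp add: power2_eq_square)
  qed
  fix X :: "nat \<times> nat \<Rightarrow> real" and a c assume ac: "a \<in> S" "c \<in> S"
  let ?Y = "X \<circ> Transposition.transpose a c"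
  let ?e = "4 * \<bar>X a - X c\<bar> / (real n * sqrt (real n) * t\<^sup>2)"
  have e: "cmod (g X - g ?Y) \<le> ?e" "cmod (b X - b ?Y) \<le> ?e" by (rule partial_trace_swap_le[OF _ _ ac]; simp)+
  have eq: "(1 + z * b X + \<i> * of_real t * g X + g X * g X) - (1 + z * b ?Y + \<i> * of_real t * g ?Y + g ?Y * g ?Y)
     = z * (b X - b ?Y) + \<i> * of_real t * (g X - g ?Y) + (g X - g ?Y) * (g X + g ?Y)"
    by (simp add: algebra_simps)
  have "cmod ((1 + z * b X + \<i> * of_real t * g X + g X * g X) - (1 + z * b ?Y + \<i> * of_real t * g ?Y + g ?Y * g ?Y)) \<le> cmod z * ?e + t * ?e + ?e * (1 / t + 1 / t)"
    unfolding eq by (intro norm_triangle_mono norm_mult_left_le norm_it_mult_le norm_mult_le e gb)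
  also have "cmod z * ?e + t * ?e + ?e * (1 / t + 1 / t) = (cmod z + t + 2 / t) * ?e"
  proof -
    have "cmod z * e + t * e + e * (1 / t + 1 / t) = (cmod z + t + 2 / t) * e" for e :: real by (simp add: algebra_simps)
    then show ?thesis .
  qed
  finally show "cmod ((1 + z * b X + \<i> * of_real t * g X + g X * g X) - (1 + z * b ?Y + \<i> * of_real t * g ?Y + g ?Y * g ?Y))
     \<le> (cmod z + t + 2 / t) * ?e" .
next
  show "1 + z * b X + \<i> * of_real t * g X + g X * g X
    = (\<Sum>a\<in>S. of_real (X a) * G X (fst ((\<lambda>(i, j). (n + j, i)) a)) (snd ((\<lambda>(i, j). (n + j, i)) a))) / of_real (real n * sqrt (real n)) + g X * g X" for X
    using trace_equation_1[of X] by (simp only: split_def fst_conv snd_conv)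
  show "cmod ((\<Sum>c\<in>S. W (G X) (G X) c (fst ((\<lambda>(i, j). (n + j, i)) c)) (snd ((\<lambda>(i, j). (n + j, i)) c))) / of_nat (n\<^sup>2) - g X * g X) \<le> 1 / (real n * t\<^sup>2)" for X
    using kernel_diagonal_1[of X] by (simp only: split_def fst_conv snd_conv)
qed simp

lemma defect_2:
  "(\<Sum>\<pi>\<in>P. (cmod (cnj z * g (x \<circ> \<pi>) + \<i> * of_real t * b (x \<circ> \<pi>) + g (x \<circ> \<pi>) * b (x \<circ> \<pi>)))\<^sup>2)
    \<le> card P * (error_const z t * (K / sqrt (real n) + 1 / real n))"
proof (rule mean_square_estimate[where pos = "\<lambda>(i, j). (i, j)" and m = "\<lambda>X. g X * b X"
    and \<Delta> = "\<lambda>X. cnj z * g X + \<i> * of_real t * b X + g X * b X"])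
  have gb: "cmod (g X) \<le> 1 / t" "cmod (b X) \<le> 1 / t" for X by (rule partial_trace_le; simp)+
  show "cmod (cnj z * g X + \<i> * of_real t * b X + g X * b X) \<le> 2 + cmod z / t + 1 / t\<^sup>2" for X
  proof -
    have "cmod (cnj z * g X + \<i> * of_real t * b X + g X * b X) \<le> cmod z * (1 / t) + t * (1 / t) + (1 / t) * (1 / t)"
      by (intro norm_triangle_mono norm_mult_cnj_left_le norm_it_mult_le norm_mult_le gb)
    then show ?thesis using t by (simp add: power2_eq_square)
  qed
  fix X :: "nat \<times> nat \<Rightarrow> real" and a c assume ac: "a \<in> S" "c \<in> S"
  let ?Y = "X \<circ> Transposition.transpose a c"
  let ?e = "4 * \<bar>X a - X c\<bar> / (real n * sqrt (real n) * t\<^sup>2)"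
  have e: "cmod (g X - g ?Y) \<le> ?e" "cmod (b X - b ?Y) \<le> ?e" by (rule partial_trace_swap_le[OF _ _ ac]; simp)+
  have eq: "(cnj z * g X + \<i> * of_real t * b X + g X * b X) - (cnj z * g ?Y + \<i> * of_real t * b ?Y + g ?Y * b ?Y)
     = cnj z * (g X - g ?Y) + \<i> * of_real t * (b X - b ?Y) + ((g X - g ?Y) * b X + (b X - b ?Y) * g ?Y)"
    by (simp add: algebra_simps)
  have "cmod ((cnj z * g X + \<i> * of_real t * b X + g X * b X) - (cnj z * g ?Y + \<i> * of_real t * b ?Y + g ?Y * b ?Y)) \<le> cmod z * ?e + t * ?e + (?e * (1 / t) + ?e * (1 / t))"
    unfolding eq by (intro norm_triangle_mono norm_mult_cnj_left_le norm_it_mult_le norm_mult_le e gb)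
  also have "cmod z * ?e + t * ?e + (?e * (1 / t) + ?e * (1 / t)) = (cmod z + t + 2 / t) * ?e"
  proof -
    have "cmod z * e + t * e + (e * (1 / t) + e * (1 / t)) = (cmod z + t + 2 / t) * e" for e :: real by (simp add: algebra_simps)
    then show ?thesis .
  qed
  finally show "cmod ((cnj z * g X + \<i> * of_real t * b X + g X * b X) - (cnj z * g ?Y + \<i> * of_real t * b ?Y + g ?Y * b ?Y))
     \<le> (cmod z + t + 2 / t) * ?e" .
next
  show "cnj z * g X + \<i> * of_real t * b X + g X * b X
    = (\<Sum>a\<in>S. of_real (X a) * G X (fst ((\<lambda>(i, j). (i, j)) a)) (snd ((\<lambda>(i, j). (i, j)) a))) / of_real (real n * sqrt (real n)) + g X * b X" for X
    using trace_equation_2[of X] by (simp only: split_def fst_conv snd_conv)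
  show "cmod ((\<Sum>c\<in>S. W (G X) (G X) c (fst ((\<lambda>(i, j). (i, j)) c)) (snd ((\<lambda>(i, j). (i, j)) c))) / of_nat (n\<^sup>2) - g X * b X) \<le> 1 / (real n * t\<^sup>2)" for X
    using kernel_diagonal_2[of X] by (simp only: split_def fst_conv snd_conv)
qed simp

definition stieltjes :: "(nat \<times> nat \<Rightarrow> real) \<Rightarrow> real" where
  "stieltjes X = (\<Sum>k<n. t / ((singular_values (M X) ! k)\<^sup>2 + t\<^sup>2)) / real n"

text \<open>Once b is eliminated, v = t + h satisfies the fixed point equation up to the defects
  divided by v^2 + r^2, which is at least t^2. \<open>fixed_map_stability\<close> contributes the
  remaining factor w / t.\<close>

lemma stieltjes_fixed_point_defect:
  "\<bar>stieltjes X - (fixed_point (cmod z) t - t)\<bar> \<le> fixed_point (cmod z) t / t ^ 3 *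
     ((t + 1 / t) * cmod (1 + z * b X + \<i> * of_real t * g X + g X * g X)
       + cmod z * cmod (cnj z * g X + \<i> * of_real t * b X + g X * b X))"
proof -
  define h where "h = stieltjes X"
  define v where "v = t + h"
  define r where "r = cmod z"
  define w where "w = fixed_point r t"
  define d1 where "d1 = 1 + z * b X + \<i> * of_real t * g X + g X * g X"
  define d2 where "d2 = cnj z * g X + \<i> * of_real t * b X + g X * b X"
  have gh: "g X = \<i> * of_real h" unfolding h_def stieltjes_def by (rule trace_singular_values)
  have h0: "h \<ge> 0" unfolding h_def stieltjes_def using t by (intro divide_nonneg_nonneg sum_nonneg) auto
  have h1: "h \<le> 1 / t" using partial_trace_le[of 0 0 X] h0 gh by (simp add: norm_mult)
  have v: "v > 0" "v \<ge> t" "v \<le> t + 1 / t" using t h0 h1 by (auto simp: v_def)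
  have d2: "d2 = \<i> * (cnj z * of_real h + of_real v * b X)"
    unfolding d2_def gh v_def by (simp add: algebra_simps)
  have zz: "z * cnj z = of_real (r\<^sup>2)" unfolding r_def complex_norm_square ..
  \<comment> \<open>This combination cancels b: it enters with coefficient v z from the first defect
    and - v z from the second.\<close>
  have "of_real v * d1 + \<i> * z * d2 = of_real v * (1 - of_real h * of_real v) - (z * cnj z) * of_real h"
    unfolding d2 d1_def gh v_def by (simp add: algebra_simps)
  also have "\<dots> = of_real (v - h * (v\<^sup>2 + r\<^sup>2))" unfolding zz by (simp add: algebra_simps power2_eq_square)
  finally have eq: "of_real (v - h * (v\<^sup>2 + r\<^sup>2)) = of_real v * d1 + \<i> * z * d2" by simp
  have "\<bar>v - h * (v\<^sup>2 + r\<^sup>2)\<bar> = cmod (of_real v * d1 + \<i> * z * d2)" unfolding eq[symmetric] norm_of_real ..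
  also have "\<dots> \<le> v * cmod d1 + r * cmod d2"
    using v by (intro order_trans[OF norm_triangle_ineq]) (auto simp: norm_mult r_def)
  also have "\<dots> \<le> (t + 1 / t) * cmod d1 + r * cmod d2" using v by (intro add_mono mult_right_mono) auto
  finally have num: "\<bar>v - h * (v\<^sup>2 + r\<^sup>2)\<bar> \<le> (t + 1 / t) * cmod d1 + r * cmod d2" .
  have den: "t\<^sup>2 \<le> v\<^sup>2 + r\<^sup>2" using v t by (intro order_trans[OF power_mono[of t v 2]]) auto
  have t2: "t\<^sup>2 > 0" using t by simp
  have "fixed_map r v - t = - ((v - h * (v\<^sup>2 + r\<^sup>2)) / (v\<^sup>2 + r\<^sup>2))"
  proof -
    have D: "v\<^sup>2 + r\<^sup>2 \<noteq> 0" using den t2 by linarith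
    then have "(v - h * (v\<^sup>2 + r\<^sup>2)) / (v\<^sup>2 + r\<^sup>2) = v / (v\<^sup>2 + r\<^sup>2) - h"
      unfolding diff_divide_distrib by (subst nonzero_mult_div_cancel_right) auto
    then show ?thesis unfolding fixed_map_def by (simp add: v_def)
  qed
  then have "\<bar>fixed_map r v - t\<bar> = \<bar>v - h * (v\<^sup>2 + r\<^sup>2)\<bar> / (v\<^sup>2 + r\<^sup>2)"
    using den t2 by simp
  also have "\<dots> \<le> ((t + 1 / t) * cmod d1 + r * cmod d2) / t\<^sup>2"
    using num den t2 by (intro frac_le) auto
  finally have F: "\<bar>fixed_map r v - t\<bar> \<le> ((t + 1 / t) * cmod d1 + r * cmod d2) / t\<^sup>2" .
  have w: "w > 0" "fixed_map r w = t" using fixed_point[OF t, of r] by (auto simp: w_def)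
  have "\<bar>h - (w - t)\<bar> = \<bar>v - w\<bar>" by (simp add: v_def)
  also have "\<dots> \<le> (w / t) * \<bar>fixed_map r v - t\<bar>" by (rule fixed_map_stability[OF w t v(1)])
  also have "\<dots> \<le> (w / t) * (((t + 1 / t) * cmod d1 + r * cmod d2) / t\<^sup>2)"
    using F w t by (intro mult_left_mono) auto
  also have "\<dots> = w / t ^ 3 * ((t + 1 / t) * cmod d1 + r * cmod d2)"
    by (simp add: power2_eq_square power3_eq_cube)
  finally show ?thesis unfolding h_def w_def r_def d1_def d2_def .
qed

lemma stieltjes_mean_square:
  "(\<Sum>\<pi>\<in>P. (stieltjes (x \<circ> \<pi>) - (fixed_point (cmod z) t - t))\<^sup>2) \<le> card P *
    (2 * (fixed_point (cmod z) t / t ^ 3)\<^sup>2 * ((t + 1 / t)\<^sup>2 + (cmod z)\<^sup>2) * error_const z t * (K / sqrt (real n) + 1 / real n))"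
proof -
  define k where "k = fixed_point (cmod z) t / t ^ 3"
  define E where "E = card P * (error_const z t * (K / sqrt (real n) + 1 / real n))"
  define D1 where "D1 X = cmod (1 + z * b X + \<i> * of_real t * g X + g X * g X)" for X
  define D2 where "D2 X = cmod (cnj z * g X + \<i> * of_real t * b X + g X * b X)" for X
  define c where "c = t + 1 / t"
  define r where "r = cmod z"
  have "(stieltjes X - (fixed_point (cmod z) t - t))\<^sup>2 \<le> 2 * k\<^sup>2 * c\<^sup>2 * (D1 X)\<^sup>2 + 2 * k\<^sup>2 * r\<^sup>2 * (D2 X)\<^sup>2" for X
  proof -
    have "\<bar>stieltjes X - (fixed_point (cmod z) t - t)\<bar> \<le> \<bar>k * (c * D1 X + r * D2 X)\<bar>"
      using stieltjes_fixed_point_defect[of X] unfolding k_def D1_def D2_def c_def r_def by linarith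
    then have "(stieltjes X - (fixed_point (cmod z) t - t))\<^sup>2 \<le> (k * (c * D1 X + r * D2 X))\<^sup>2"
      by (rule abs_le_square_iff[THEN iffD1])
    also have "\<dots> = k\<^sup>2 * (c * D1 X + r * D2 X)\<^sup>2" by (simp add: power_mult_distrib)
    also have "\<dots> \<le> k\<^sup>2 * (2 * (c * D1 X)\<^sup>2 + 2 * (r * D2 X)\<^sup>2)"
      using sum_squares_bound[of "c * D1 X" "r * D2 X"] by (intro mult_left_mono) (auto simp: power2_sum)
    finally show ?thesis by (simp add: power_mult_distrib algebra_simps)
  qed
  then have "(\<Sum>\<pi>\<in>P. (stieltjes (x \<circ> \<pi>) - (fixed_point (cmod z) t - t))\<^sup>2)
     \<le> (\<Sum>\<pi>\<in>P. 2 * k\<^sup>2 * c\<^sup>2 * (D1 (x \<circ> \<pi>))\<^sup>2 + 2 * k\<^sup>2 * r\<^sup>2 * (D2 (x \<circ> \<pi>))\<^sup>2)"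
    by (rule sum_mono)
  also have "\<dots> = 2 * k\<^sup>2 * c\<^sup>2 * (\<Sum>\<pi>\<in>P. (D1 (x \<circ> \<pi>))\<^sup>2) + 2 * k\<^sup>2 * r\<^sup>2 * (\<Sum>\<pi>\<in>P. (D2 (x \<circ> \<pi>))\<^sup>2)"
    by (simp only: sum.distrib sum_distrib_left)
  also have "\<dots> \<le> 2 * k\<^sup>2 * c\<^sup>2 * E + 2 * k\<^sup>2 * r\<^sup>2 * E"
    using defect_1 defect_2 unfolding D1_def D2_def E_def by (intro add_mono mult_left_mono) auto
  also have "\<dots> = card P * (2 * k\<^sup>2 * (c\<^sup>2 + r\<^sup>2) * error_const z t * (K / sqrt (real n) + 1 / real n))"
    unfolding E_def by (simp only: distrib_left distrib_right ac_simps)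
  finally show ?thesis unfolding k_def c_def r_def .
qed

end

section \<open>Weak convergence from Stieltjes transforms on the imaginary axis\<close>

text \<open>The first three conjuncts of \<open>is_limit_law\<close>, shared by the random singular
  value distributions and the candidate limits.\<close>

definition half_line_prob :: "real measure \<Rightarrow> bool" where
  "half_line_prob M \<longleftrightarrow> prob_space M \<and> sets M = sets borel \<and> emeasure M {..<0} = 0"

lemma half_line_prob_integrable:
  fixes f :: "real \<Rightarrow> real"
  assumes M: "half_line_prob M" and f: "continuous_on UNIV f" "\<And>s. \<bar>f s\<bar> \<le> B"
  shows "integrable M f"
proof -
  interpret prob_space M using M by (simp add: half_line_prob_def)
  have "f \<in> borel_measurable M"
    using M borel_measurable_continuous_onI[OF f(1)] by (simp add: half_line_prob_def cong: measurable_cong_sets)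
  then show ?thesis by (intro integrable_const_bound[of _ B]) (use f(2) in auto)
qed

lemma half_line_prob_AE:
  assumes M: "half_line_prob M" and P: "\<And>s. 0 \<le> s \<Longrightarrow> P s"
  shows "AE s in M. P s"
proof -
  have "AE s in M. s \<notin> {..<0::real}"
    by (rule AE_not_in) (use M in \<open>auto simp: half_line_prob_def null_sets_def\<close>)
  then show ?thesis by eventually_elim (use P in auto)
qed

lemma half_line_prob_integral_le:
  fixes f g k :: "real \<Rightarrow> real"
  assumes M: "half_line_prob M" and f: "integrable M f" and g: "integrable M g" and k: "integrable M k"
    and le: "\<And>s. 0 \<le> s \<Longrightarrow> \<bar>f s - g s\<bar> \<le> k s"
  shows "\<bar>(LINT s|M. f s) - (LINT s|M. g s)\<bar> \<le> (LINT s|M. k s)"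
proof -
  have "\<bar>(LINT s|M. f s) - (LINT s|M. g s)\<bar> = \<bar>LINT s|M. f s - g s\<bar>" using f g by simp
  also have "\<dots> \<le> (LINT s|M. \<bar>f s - g s\<bar>)" by (rule integral_abs_bound)
  also have "\<dots> \<le> (LINT s|M. k s)"
    using f g k by (intro integral_mono_AE half_line_prob_AE[OF M] le) auto
  finally show ?thesis .
qed

locale random_half_line_measures =
  fixes P :: "nat \<Rightarrow> 'a pmf" and N :: "nat \<Rightarrow> 'a \<Rightarrow> real measure" and \<nu> :: "real measure"
  assumes N: "\<And>n \<omega>. n \<ge> 2 \<Longrightarrow> half_line_prob (N n \<omega>)" and nu: "half_line_prob \<nu>"
begin

text \<open>Continuity and boundedness are part of the notion so that every test function is
  automatically integrable for all the measures involved.\<close>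

definition conv_prob :: "(real \<Rightarrow> real) \<Rightarrow> bool" where
  "conv_prob f \<longleftrightarrow> continuous_on UNIV f \<and> (\<exists>B. \<forall>s. \<bar>f s\<bar> \<le> B) \<and>
     (\<forall>\<epsilon>>0. (\<lambda>n. measure_pmf.prob (P n) {\<omega>. \<bar>(LINT s|N n \<omega>. f s) - (LINT s|\<nu>. f s)\<bar> \<ge> \<epsilon>}) \<longlonglongrightarrow> 0)"

lemma conv_prob_D:
  assumes "conv_prob f"
  shows "continuous_on UNIV f" "\<exists>B. \<forall>s. \<bar>f s\<bar> \<le> B"
    and "\<epsilon> > 0 \<Longrightarrow> (\<lambda>n. measure_pmf.prob (P n) {\<omega>. \<bar>(LINT s|N n \<omega>. f s) - (LINT s|\<nu>. f s)\<bar> \<ge> \<epsilon>}) \<longlonglongrightarrow> 0"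
  using assms unfolding conv_prob_def by blast+

lemma integrable:
  assumes "continuous_on UNIV f" "\<exists>B. \<forall>s. \<bar>f s\<bar> \<le> (B :: real)"
  shows "n \<ge> 2 \<Longrightarrow> integrable (N n \<omega>) f" "integrable \<nu> f"
  using assms half_line_prob_integrable N nu by blast+

lemma conv_prob_approx:
  assumes cont: "continuous_on UNIV f" and bdd: "\<exists>B. \<forall>s. \<bar>f s\<bar> \<le> B"
    and approx: "\<And>\<delta>. \<delta> > 0 \<Longrightarrow> \<exists>g k. conv_prob g \<and> conv_prob k \<and> (\<forall>s\<ge>0. \<bar>f s - g s\<bar> \<le> k s) \<and> (LINT s|\<nu>. k s) \<le> \<delta>"
  shows "conv_prob f"
  unfolding conv_prob_def
proof (intro conjI allI impI cont bdd)
  fix \<epsilon> :: real assume e: "\<epsilon> > 0"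
  obtain g k where g: "conv_prob g" and k: "conv_prob k" and le: "\<forall>s\<ge>0. \<bar>f s - g s\<bar> \<le> k s" and kd: "(LINT s|\<nu>. k s) \<le> \<epsilon> / 8"
    using approx[of "\<epsilon> / 8"] e by auto
  let ?p = "\<lambda>n h. measure_pmf.prob (P n) {\<omega>. \<bar>(LINT s|N n \<omega>. h s) - (LINT s|\<nu>. h s)\<bar> \<ge> \<epsilon> / 4}"
  have "(\<lambda>n. ?p n g + ?p n k) \<longlonglongrightarrow> 0 + 0"
    by (intro tendsto_add conv_prob_D(3)[OF g] conv_prob_D(3)[OF k]) (use e in simp_all)
  then have lim: "(\<lambda>n. ?p n g + ?p n k) \<longlonglongrightarrow> 0" by simp
  have le_n: "measure_pmf.prob (P n) {\<omega>. \<bar>(LINT s|N n \<omega>. f s) - (LINT s|\<nu>. f s)\<bar> \<ge> \<epsilon>} \<le> ?p n g + ?p n k"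
    if n: "n \<ge> 2" for n
  proof -
    have "{\<omega>. \<bar>(LINT s|N n \<omega>. f s) - (LINT s|\<nu>. f s)\<bar> \<ge> \<epsilon>}
       \<subseteq> {\<omega>. \<bar>(LINT s|N n \<omega>. g s) - (LINT s|\<nu>. g s)\<bar> \<ge> \<epsilon> / 4} \<union> {\<omega>. \<bar>(LINT s|N n \<omega>. k s) - (LINT s|\<nu>. k s)\<bar> \<ge> \<epsilon> / 4}"
    proof (rule subsetI, rule ccontr)
      fix \<omega> assume big: "\<omega> \<in> {\<omega>. \<bar>(LINT s|N n \<omega>. f s) - (LINT s|\<nu>. f s)\<bar> \<ge> \<epsilon>}"
        and "\<omega> \<notin> {\<omega>. \<bar>(LINT s|N n \<omega>. g s) - (LINT s|\<nu>. g s)\<bar> \<ge> \<epsilon> / 4} \<union> {\<omega>. \<bar>(LINT s|N n \<omega>. k s) - (LINT s|\<nu>. k s)\<bar> \<ge> \<epsilon> / 4}"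
      then have small: "\<bar>(LINT s|N n \<omega>. g s) - (LINT s|\<nu>. g s)\<bar> < \<epsilon> / 4" "\<bar>(LINT s|N n \<omega>. k s) - (LINT s|\<nu>. k s)\<bar> < \<epsilon> / 4"
        by auto
      have 1: "\<bar>(LINT s|N n \<omega>. f s) - (LINT s|N n \<omega>. g s)\<bar> \<le> (LINT s|N n \<omega>. k s)"
        using g k cont bdd le unfolding conv_prob_def
        by (intro half_line_prob_integral_le[OF N[OF n]] integrable(1)[OF _ _ n]) auto
      have 2: "\<bar>(LINT s|\<nu>. f s) - (LINT s|\<nu>. g s)\<bar> \<le> (LINT s|\<nu>. k s)"
        using g k cont bdd le unfolding conv_prob_def
        by (intro half_line_prob_integral_le[OF nu] integrable(2)) auto
      have "\<epsilon> \<le> \<bar>(LINT s|N n \<omega>. f s) - (LINT s|\<nu>. f s)\<bar>" using big by simp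
      then show False using 1 2 small kd e by linarith
    qed
    then have "measure_pmf.prob (P n) {\<omega>. \<bar>(LINT s|N n \<omega>. f s) - (LINT s|\<nu>. f s)\<bar> \<ge> \<epsilon>}
      \<le> measure_pmf.prob (P n) ({\<omega>. \<bar>(LINT s|N n \<omega>. g s) - (LINT s|\<nu>. g s)\<bar> \<ge> \<epsilon> / 4} \<union> {\<omega>. \<bar>(LINT s|N n \<omega>. k s) - (LINT s|\<nu>. k s)\<bar> \<ge> \<epsilon> / 4})"
      by (intro measure_pmf.finite_measure_mono) auto
    also have "\<dots> \<le> ?p n g + ?p n k" by (intro measure_Un_le) auto
    finally show ?thesis .
  qed
  have "\<forall>\<^sub>F n in sequentially. measure_pmf.prob (P n) {\<omega>. \<bar>(LINT s|N n \<omega>. f s) - (LINT s|\<nu>. f s)\<bar> \<ge> \<epsilon>} \<le> ?p n g + ?p n k"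
    unfolding eventually_sequentially using le_n by blast
  then show "(\<lambda>n. measure_pmf.prob (P n) {\<omega>. \<bar>(LINT s|N n \<omega>. f s) - (LINT s|\<nu>. f s)\<bar> \<ge> \<epsilon>}) \<longlonglongrightarrow> 0"
    by (rule tendsto_sandwich[OF always_eventually[OF allI[OF measure_nonneg]] _ tendsto_const lim])
qed

lemma conv_prob_const: "conv_prob (\<lambda>_. c)"
proof -
  interpret nu: prob_space \<nu> using nu by (simp add: half_line_prob_def)
  have "(\<lambda>n. measure_pmf.prob (P n) {\<omega>. \<bar>(LINT s|N n \<omega>. c) - (LINT s|\<nu>. c)\<bar> \<ge> \<epsilon>}) \<longlonglongrightarrow> 0" if "\<epsilon> > 0" for \<epsilon>
  proof (rule tendsto_eventually, unfold eventually_sequentially, intro exI[of _ 2] allI impI)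
    fix n :: nat assume "n \<ge> 2"
    then have "prob_space (N n \<omega>)" for \<omega> using N[of n \<omega>] by (simp add: half_line_prob_def)
    then have c1: "(LINT s|N n \<omega>. c) = c" for \<omega> by (simp add: prob_space.prob_space)
    have c2: "(LINT s|\<nu>. c) = c" by (simp add: nu.prob_space)
    have "{\<omega>. \<bar>(LINT s|N n \<omega>. c) - (LINT s|\<nu>. c)\<bar> \<ge> \<epsilon>} = {}"
      unfolding c1 c2 using that by simp
    then show "measure_pmf.prob (P n) {\<omega>. \<bar>(LINT s|N n \<omega>. c) - (LINT s|\<nu>. c)\<bar> \<ge> \<epsilon>} = 0"
      by (simp only: measure_empty)
  qed
  then show ?thesis by (auto simp: conv_prob_def)
qed

lemma conv_prob_lincomb:
  assumes f: "conv_prob f" and g: "conv_prob g"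
  shows "conv_prob (\<lambda>s. a * f s + b * g s)"
proof -
  obtain Bf Bg where B: "\<And>s. \<bar>f s\<bar> \<le> Bf" "\<And>s. \<bar>g s\<bar> \<le> Bg" using f g unfolding conv_prob_def by blast
  have cont: "continuous_on UNIV f" "continuous_on UNIV g" using f g by (auto simp: conv_prob_def)
  have bdd: "\<bar>a * f s + b * g s\<bar> \<le> \<bar>a\<bar> * Bf + \<bar>b\<bar> * Bg" for s
    using B by (intro order_trans[OF abs_triangle_ineq] add_mono) (auto simp: abs_mult intro!: mult_left_mono)
  define c where "c = \<bar>a\<bar> + \<bar>b\<bar> + 1"
  have c: "c > 0" by (simp add: c_def)
  have lim: "(\<lambda>n. measure_pmf.prob (P n) {\<omega>. \<bar>(LINT s|N n \<omega>. a * f s + b * g s) - (LINT s|\<nu>. a * f s + b * g s)\<bar> \<ge> \<epsilon>}) \<longlonglongrightarrow> 0"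
    if e: "\<epsilon> > 0" for \<epsilon>
  proof -
    define \<delta> where "\<delta> = \<epsilon> / c"
    have d: "\<delta> > 0" using e c by (simp add: \<delta>_def)
    let ?p = "\<lambda>n h. measure_pmf.prob (P n) {\<omega>. \<bar>(LINT s|N n \<omega>. h s) - (LINT s|\<nu>. h s)\<bar> \<ge> \<delta>}"
    have "(\<lambda>n. ?p n f + ?p n g) \<longlonglongrightarrow> 0 + 0"
      by (intro tendsto_add conv_prob_D(3)[OF f] conv_prob_D(3)[OF g] d)
    then have lim: "(\<lambda>n. ?p n f + ?p n g) \<longlonglongrightarrow> 0" by simp
    have "measure_pmf.prob (P n) {\<omega>. \<bar>(LINT s|N n \<omega>. a * f s + b * g s) - (LINT s|\<nu>. a * f s + b * g s)\<bar> \<ge> \<epsilon>} \<le> ?p n f + ?p n g"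
      if n: "n \<ge> 2" for n
    proof -
      have "{\<omega>. \<bar>(LINT s|N n \<omega>. a * f s + b * g s) - (LINT s|\<nu>. a * f s + b * g s)\<bar> \<ge> \<epsilon>}
         \<subseteq> {\<omega>. \<bar>(LINT s|N n \<omega>. f s) - (LINT s|\<nu>. f s)\<bar> \<ge> \<delta>} \<union> {\<omega>. \<bar>(LINT s|N n \<omega>. g s) - (LINT s|\<nu>. g s)\<bar> \<ge> \<delta>}"
      proof (rule subsetI, rule ccontr)
        fix \<omega> assume big: "\<omega> \<in> {\<omega>. \<bar>(LINT s|N n \<omega>. a * f s + b * g s) - (LINT s|\<nu>. a * f s + b * g s)\<bar> \<ge> \<epsilon>}"
          and "\<omega> \<notin> {\<omega>. \<bar>(LINT s|N n \<omega>. f s) - (LINT s|\<nu>. f s)\<bar> \<ge> \<delta>} \<union> {\<omega>. \<bar>(LINT s|N n \<omega>. g s) - (LINT s|\<nu>. g s)\<bar> \<ge> \<delta>}"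
        then have small: "\<bar>(LINT s|N n \<omega>. f s) - (LINT s|\<nu>. f s)\<bar> < \<delta>" "\<bar>(LINT s|N n \<omega>. g s) - (LINT s|\<nu>. g s)\<bar> < \<delta>" by auto
        have "(LINT s|N n \<omega>. a * f s + b * g s) - (LINT s|\<nu>. a * f s + b * g s)
           = a * ((LINT s|N n \<omega>. f s) - (LINT s|\<nu>. f s)) + b * ((LINT s|N n \<omega>. g s) - (LINT s|\<nu>. g s))"
          using half_line_prob_integrable[OF N[OF n] cont(1) B(1)] half_line_prob_integrable[OF N[OF n] cont(2) B(2)]
            half_line_prob_integrable[OF nu cont(1) B(1)] half_line_prob_integrable[OF nu cont(2) B(2)]
          by (simp add: algebra_simps)
        also have "\<bar>\<dots>\<bar> \<le> \<bar>a\<bar> * \<delta> + \<bar>b\<bar> * \<delta>"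
          using small by (intro order_trans[OF abs_triangle_ineq] add_mono) (auto simp: abs_mult intro!: mult_left_mono)
        also have "\<dots> < c * \<delta>" using d by (simp add: c_def algebra_simps)
        also have "c * \<delta> = \<epsilon>" using c by (simp add: \<delta>_def)
        finally show False using big by simp
      qed
      then have "measure_pmf.prob (P n) {\<omega>. \<bar>(LINT s|N n \<omega>. a * f s + b * g s) - (LINT s|\<nu>. a * f s + b * g s)\<bar> \<ge> \<epsilon>}
        \<le> measure_pmf.prob (P n) ({\<omega>. \<bar>(LINT s|N n \<omega>. f s) - (LINT s|\<nu>. f s)\<bar> \<ge> \<delta>} \<union> {\<omega>. \<bar>(LINT s|N n \<omega>. g s) - (LINT s|\<nu>. g s)\<bar> \<ge> \<delta>})"
        by (intro measure_pmf.finite_measure_mono) auto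
      also have "\<dots> \<le> ?p n f + ?p n g" by (intro measure_Un_le) auto
      finally show ?thesis .
    qed
    then have "\<forall>\<^sub>F n in sequentially. measure_pmf.prob (P n) {\<omega>. \<bar>(LINT s|N n \<omega>. a * f s + b * g s) - (LINT s|\<nu>. a * f s + b * g s)\<bar> \<ge> \<epsilon>} \<le> ?p n f + ?p n g"
      unfolding eventually_sequentially by blast
    then show ?thesis
      by (rule tendsto_sandwich[OF always_eventually[OF allI[OF measure_nonneg]] _ tendsto_const lim])
  qed
  show ?thesis unfolding conv_prob_def using cont bdd lim by (auto intro!: continuous_intros)
qed

lemma conv_prob_cmult: "conv_prob f \<Longrightarrow> conv_prob (\<lambda>s. a * f s)"
  using conv_prob_lincomb[of f f a 0] by simp

lemma conv_prob_sum: "(\<And>i. i \<in> I \<Longrightarrow> conv_prob (f i)) \<Longrightarrow> conv_prob (\<lambda>s. \<Sum>i\<in>I. a i * f i s)"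
proof (induction I rule: infinite_finite_induct)
  case (insert i I)
  then show ?case using conv_prob_lincomb[of "f i" "\<lambda>s. \<Sum>i\<in>I. a i * f i s" "a i" 1] by simp
qed (use conv_prob_const[of 0] in auto)

lemma conv_prob_uniform:
  assumes "continuous_on UNIV f" "\<exists>B. \<forall>s. \<bar>f s\<bar> \<le> B"
    and "\<And>\<delta>. \<delta> > 0 \<Longrightarrow> \<exists>g. conv_prob g \<and> (\<forall>s\<ge>0. \<bar>f s - g s\<bar> \<le> \<delta>)"
  shows "conv_prob f"
proof (rule conv_prob_approx[OF assms(1,2)])
  fix \<delta> :: real assume "\<delta> > 0"
  interpret nu: prob_space \<nu> using nu by (simp add: half_line_prob_def)
  obtain g where "conv_prob g" "\<forall>s\<ge>0. \<bar>f s - g s\<bar> \<le> \<delta>" using assms(3)[OF \<open>\<delta> > 0\<close>] by blast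
  then show "\<exists>g k. conv_prob g \<and> conv_prob k \<and> (\<forall>s\<ge>0. \<bar>f s - g s\<bar> \<le> k s) \<and> (LINT s|\<nu>. k s) \<le> \<delta>"
    by (intro exI[of _ g] exI[of _ "\<lambda>_. \<delta>"]) (simp add: conv_prob_const nu.prob_space)
qed

section \<open>From the kernels \<open>1 / (s\<^sup>2 + t\<^sup>2)\<close> to all bounded continuous
  functions\<close>

context
  assumes base: "\<And>t. t > 0 \<Longrightarrow> conv_prob (\<lambda>s. 1 / (s\<^sup>2 + t\<^sup>2))"
begin

text \<open>Partial fractions reduce distinct parameters to the base case. The factors of a power of
  \<open>1 / (s\<^sup>2 + 1)\<close> are perturbed into distinct ones, and polynomials in \<open>1 / (s\<^sup>2 + 1)\<close> are dense among
  the continuous functions on the half line that have a limit at infinity.\<close>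

lemma conv_prob_prod:
  assumes "finite T" "T \<noteq> {}" "\<And>t. t \<in> T \<Longrightarrow> t > 0"
  shows "conv_prob (\<lambda>s. \<Prod>t\<in>T. 1 / (s\<^sup>2 + t\<^sup>2))"
  using assms
proof (induction "card T" arbitrary: T rule: less_induct)
  case less
  obtain t where t: "t \<in> T" using less.prems by auto
  show ?case
  proof (cases "T = {t}")
    case True then show ?thesis using base[of t] less.prems by simp
  next
    case False
    then obtain u where u: "u \<in> T" "u \<noteq> t" using t by auto
    have pos: "t > 0" "u > 0" using less.prems t u by auto
    then have ne: "u\<^sup>2 - t\<^sup>2 \<noteq> 0" using u(2) by (simp add: power2_eq_iff)
    have 1: "conv_prob (\<lambda>s. \<Prod>v\<in>T - {u}. 1 / (s\<^sup>2 + v\<^sup>2))" "conv_prob (\<lambda>s. \<Prod>v\<in>T - {t}. 1 / (s\<^sup>2 + v\<^sup>2))"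
    proof -
      show "conv_prob (\<lambda>s. \<Prod>v\<in>T - {u}. 1 / (s\<^sup>2 + v\<^sup>2))"
        using less.prems t u by (intro less.hyps card_Diff1_less) auto
      show "conv_prob (\<lambda>s. \<Prod>v\<in>T - {t}. 1 / (s\<^sup>2 + v\<^sup>2))"
        using less.prems t u by (intro less.hyps card_Diff1_less) auto
    qed
    have eq: "(\<Prod>v\<in>T. 1 / (s\<^sup>2 + v\<^sup>2)) = (1 / (u\<^sup>2 - t\<^sup>2)) * (\<Prod>v\<in>T - {u}. 1 / (s\<^sup>2 + v\<^sup>2)) + (- 1 / (u\<^sup>2 - t\<^sup>2)) * (\<Prod>v\<in>T - {t}. 1 / (s\<^sup>2 + v\<^sup>2))" for s
    proof -
      define Q where "Q = (\<Prod>v\<in>T - {u} - {t}. 1 / (s\<^sup>2 + v\<^sup>2))"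
      have p: "s\<^sup>2 + t\<^sup>2 > 0" "s\<^sup>2 + u\<^sup>2 > 0" using pos by (auto intro: add_nonneg_pos)
      have a: "(\<Prod>v\<in>T - {u}. 1 / (s\<^sup>2 + v\<^sup>2)) = 1 / (s\<^sup>2 + t\<^sup>2) * Q"
        unfolding Q_def using less.prems(1) t u by (intro prod.remove) auto
      have b: "(\<Prod>v\<in>T - {t}. 1 / (s\<^sup>2 + v\<^sup>2)) = 1 / (s\<^sup>2 + u\<^sup>2) * Q"
      proof -
        have "T - {u} - {t} = T - {t} - {u}" by auto
        then show ?thesis unfolding Q_def using less.prems(1) t u by (simp only:) (intro prod.remove, auto)
      qed
      have c: "(\<Prod>v\<in>T. 1 / (s\<^sup>2 + v\<^sup>2)) = 1 / (s\<^sup>2 + u\<^sup>2) * (1 / (s\<^sup>2 + t\<^sup>2) * Q)"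
        unfolding a[symmetric] using less.prems(1) u by (intro prod.remove) auto
      have "1 / (s\<^sup>2 + u\<^sup>2) * (1 / (s\<^sup>2 + t\<^sup>2)) = (1 / (u\<^sup>2 - t\<^sup>2)) * (1 / (s\<^sup>2 + t\<^sup>2)) + (- 1 / (u\<^sup>2 - t\<^sup>2)) * (1 / (s\<^sup>2 + u\<^sup>2))"
      proof -
        have "1 / A * (1 / B) = (1 / (A - B)) * (1 / B) + (- 1 / (A - B)) * (1 / A)" if "A > 0" "B > 0" "A - B \<noteq> 0" for A B :: real
        proof -
          have d: "1 / B - 1 / A = (A - B) / (A * B)" using that by (simp add: field_simps)
          have "(1 / (A - B)) * (1 / B) + (- 1 / (A - B)) * (1 / A) = (1 / (A - B)) * (1 / B - 1 / A)"
            by (simp add: right_diff_distrib)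
          then show ?thesis unfolding d using that by simp
        qed
        from this[OF p(2,1)] show ?thesis using ne by simp
      qed
      then show ?thesis unfolding a b c by (metis (no_types, lifting) distrib_right mult.assoc)
    qed
    show ?thesis unfolding eq by (intro conv_prob_lincomb 1)
  qed
qed

lemma conv_prob_power: "conv_prob (\<lambda>s. (1 / (s\<^sup>2 + 1)) ^ k)"
proof (cases "k = 0")
  case True then show ?thesis using conv_prob_const[of 1] by simp
next
  case False
  have p: "s\<^sup>2 + 1 > 0" for s :: real by (intro add_nonneg_pos) auto
  show ?thesis
  proof (rule conv_prob_uniform)
    show "continuous_on UNIV (\<lambda>s :: real. (1 / (s\<^sup>2 + 1)) ^ k)"
      by (intro continuous_intros) (use p in \<open>auto simp: less_le\<close>)
    show "\<exists>B. \<forall>s :: real. \<bar>(1 / (s\<^sup>2 + 1)) ^ k\<bar> \<le> B"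
      using p by (intro exI[of _ 1] allI) (auto simp: power_abs abs_of_pos intro!: power_le_one)
    fix \<delta> :: real assume d: "\<delta> > 0"
    \<comment> \<open>The \<open>k\<close> perturbed parameters below are distinct and lie between 1
      and 1 + \<eta>. Each factor moves by at most 3 \<eta> k, a crude bound, so the product moves
      by at most 3 \<eta> k^2, which is at most \<delta>.\<close>
    define \<eta> where "\<eta> = min 1 (\<delta> / (3 * k * k))"
    have eta: "\<eta> > 0" "\<eta> \<le> 1" "\<eta> * (3 * k * k) \<le> \<delta>" using d False by (auto simp: \<eta>_def min_def field_simps)
    define f where "f j = 1 + real j * \<eta> / k" for j
    have inj: "inj_on f {..<k}" using eta False by (auto simp: inj_on_def f_def)
    have fpos: "f j > 0" for j using eta by (auto simp: f_def intro!: add_pos_nonneg)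
    define g where "g s = (\<Prod>j<k. 1 / (s\<^sup>2 + (f j)\<^sup>2))" for s :: real
    have "g s = (\<Prod>t\<in>f ` {..<k}. 1 / (s\<^sup>2 + t\<^sup>2))" for s unfolding g_def by (simp add: prod.reindex[OF inj])
    then have "g = (\<lambda>s. \<Prod>t\<in>f ` {..<k}. 1 / (s\<^sup>2 + t\<^sup>2))" by auto
    then have g: "conv_prob g" using conv_prob_prod[of "f ` {..<k}"] False fpos by auto
    have "\<bar>(1 / (s\<^sup>2 + 1)) ^ k - g s\<bar> \<le> \<delta>" for s
    proof -
      have ge1: "1 \<le> f j" for j using eta by (simp add: f_def)
      have y1: "\<bar>1 / (s\<^sup>2 + 1)\<bar> \<le> 1" using p[of s] by (simp add: abs_of_pos)
      have y2: "\<bar>1 / (s\<^sup>2 + (f j)\<^sup>2)\<bar> \<le> 1" for j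
      proof -
        have "1 \<le> s\<^sup>2 + (f j)\<^sup>2" using ge1[of j] by (simp add: add_increasing one_le_power)
        then show ?thesis by simp
      qed
      have diff: "\<bar>1 / (s\<^sup>2 + 1) - 1 / (s\<^sup>2 + (f j)\<^sup>2)\<bar> \<le> 3 * \<eta> * k" if "j < k" for j
      proof -
        have fj: "f j \<le> 1 + \<eta>" using that eta False by (simp add: f_def field_simps)
        have D: "1 \<le> s\<^sup>2 + (f j)\<^sup>2" using ge1[of j] by (simp add: add_increasing one_le_power)
        have e1: "1 / (s\<^sup>2 + 1) - 1 / (s\<^sup>2 + (f j)\<^sup>2) = ((f j)\<^sup>2 - 1) / ((s\<^sup>2 + 1) * (s\<^sup>2 + (f j)\<^sup>2))"
        proof -
          have "1 / A - 1 / B = (B - A) / (A * B)" if "A > 0" "B > 0" for A B :: real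
            using that by (simp add: field_simps)
          from this[of "s\<^sup>2 + 1" "s\<^sup>2 + (f j)\<^sup>2"] show ?thesis using p[of s] D by simp
        qed
        have "\<bar>1 / (s\<^sup>2 + 1) - 1 / (s\<^sup>2 + (f j)\<^sup>2)\<bar> = ((f j)\<^sup>2 - 1) / ((s\<^sup>2 + 1) * (s\<^sup>2 + (f j)\<^sup>2))"
          unfolding e1 using p[of s] D ge1[of j] by (intro abs_of_nonneg divide_nonneg_nonneg mult_nonneg_nonneg) (auto simp: one_le_power)
        also have "\<dots> \<le> ((f j)\<^sup>2 - 1) / 1"
        proof (rule divide_left_mono)
          have "1 * 1 \<le> (s\<^sup>2 + 1) * (s\<^sup>2 + (f j)\<^sup>2)" using D by (intro mult_mono) auto
          then show "1 \<le> (s\<^sup>2 + 1) * (s\<^sup>2 + (f j)\<^sup>2)" "0 < (s\<^sup>2 + 1) * (s\<^sup>2 + (f j)\<^sup>2) * 1" by auto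
          show "0 \<le> (f j)\<^sup>2 - 1" using ge1[of j] by (simp add: one_le_power)
        qed
        also have "((f j)\<^sup>2 - 1) / 1 \<le> (1 + \<eta>)\<^sup>2 - 1"
          using power_mono[OF fj, of 2] ge1[of j] by simp
        also have "(1 + \<eta>)\<^sup>2 - 1 = \<eta> * (2 + \<eta>)" by (simp add: power2_eq_square algebra_simps)
        also have "\<eta> * (2 + \<eta>) \<le> \<eta> * 3" using eta by (intro mult_left_mono) auto
        also have "\<eta> * 3 \<le> 3 * \<eta> * k" using eta False by simp
        finally show ?thesis by simp
      qed
      have "(1 / (s\<^sup>2 + 1)) ^ k - g s = (\<Prod>j<k. 1 / (s\<^sup>2 + 1)) - (\<Prod>j<k. 1 / (s\<^sup>2 + (f j)\<^sup>2))" by (simp add: g_def)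
      then have "\<bar>(1 / (s\<^sup>2 + 1)) ^ k - g s\<bar> \<le> (\<Sum>j<k. \<bar>1 / (s\<^sup>2 + 1) - 1 / (s\<^sup>2 + (f j)\<^sup>2)\<bar>)"
        using norm_prod_diff[of "{..<k}" "\<lambda>_. 1 / (s\<^sup>2 + 1)" "\<lambda>j. 1 / (s\<^sup>2 + (f j)\<^sup>2)"] y1 y2 by simp
      also have "\<dots> \<le> (\<Sum>j<k. 3 * \<eta> * k)" by (intro sum_mono diff) auto
      also have "\<dots> \<le> \<delta>" using eta(3) by (simp add: mult.commute mult.left_commute)
      finally show ?thesis .
    qed
    then show "\<exists>g. conv_prob g \<and> (\<forall>s\<ge>0. \<bar>(1 / (s\<^sup>2 + 1)) ^ k - g s\<bar> \<le> \<delta>)" using g by blast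
  qed
qed

text \<open>The extra factor makes the function vanish at infinity, so after the substitution y = 1
  / (s^2 + 1) it extends continuously to the compact interval from 0 to 1, where the Weierstrass
  theorem applies.\<close>

lemma conv_prob_vanishing:
  assumes cont: "continuous_on UNIV f" and bdd: "\<And>s. \<bar>f s\<bar> \<le> B" and T: "T \<ge> 1"
  shows "conv_prob (\<lambda>s. f s * (T\<^sup>2 / (s\<^sup>2 + T\<^sup>2)))"
proof -
  have B: "B \<ge> 0" using bdd[of 0] by linarith
  have p: "s\<^sup>2 + T\<^sup>2 > 0" "s\<^sup>2 + 1 > 0" for s :: real using T by (auto intro!: add_nonneg_pos)
  \<comment> \<open>The function in the variable y: there s^2 = 1 / y - 1 and T^2 / (s^2 + T^2) =
    T^2 y / (1 + (T^2 - 1) y). The point y = 0 stands for infinity.\<close>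
  define F where "F y = (if y = 0 then 0 else f (sqrt (1 / y - 1)) * (T\<^sup>2 * y / (1 + (T\<^sup>2 - 1) * y)))" for y :: real
  have T1: "T\<^sup>2 - 1 \<ge> 0" using T by (simp add: one_le_power)
  have den: "1 + (T\<^sup>2 - 1) * y \<ge> 1" if "y \<ge> 0" for y using T1 that by simp
  have Fle: "\<bar>F y\<bar> \<le> B * (T\<^sup>2 * y)" if "y \<ge> 0" for y
  proof (cases "y = 0")
    case False
    have "T\<^sup>2 * y / (1 + (T\<^sup>2 - 1) * y) \<le> T\<^sup>2 * y / 1"
      using den[OF that] that by (intro divide_left_mono) auto
    moreover have "0 \<le> T\<^sup>2 * y / (1 + (T\<^sup>2 - 1) * y)" using den[OF that] that by simp
    ultimately have "\<bar>T\<^sup>2 * y / (1 + (T\<^sup>2 - 1) * y)\<bar> \<le> T\<^sup>2 * y" by (simp only: abs_of_nonneg)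
    then have "\<bar>f (sqrt (1 / y - 1))\<bar> * \<bar>T\<^sup>2 * y / (1 + (T\<^sup>2 - 1) * y)\<bar> \<le> B * (T\<^sup>2 * y)"
      using bdd[of "sqrt (1 / y - 1)"] B by (intro mult_mono) simp_all
    then show ?thesis using False by (simp only: F_def abs_mult if_False)
  qed (simp add: F_def)
  have contF: "continuous_on {0..1} F"
    unfolding continuous_on_eq_continuous_within
  proof
    fix y :: real assume y: "y \<in> {0..1}"
    show "continuous (at y within {0..1}) F"
    proof (cases "y = 0")
      case True
      have "((\<lambda>u. B * (T\<^sup>2 * u)) \<longlongrightarrow> B * (T\<^sup>2 * 0)) (at 0 within {0..1})" by (intro tendsto_intros)
      then have "(F \<longlongrightarrow> 0) (at 0 within {0..1})"
        by (intro Lim_null_comparison[of F "\<lambda>u. B * (T\<^sup>2 * u)"]) (auto simp: eventually_at_filter Fle)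
      then show ?thesis using True by (simp add: continuous_within F_def)
    next
      case False
      have "continuous_on {0<..1} (\<lambda>y. f (sqrt (1 / y - 1)) * (T\<^sup>2 * y / (1 + (T\<^sup>2 - 1) * y)))"
      proof (intro continuous_intros ballI)
        show "continuous_on {0<..1} (\<lambda>x. f (sqrt (1 / x - 1)))"
          by (rule continuous_on_compose2[OF cont]) (auto intro!: continuous_intros)
        show "1 + (T\<^sup>2 - 1) * y \<noteq> 0" if "y \<in> {0<..1}" for y using den[of y] that by auto
      qed
      then have "continuous_on {0<..1} F" by (rule continuous_on_cong[THEN iffD1, rotated -1]) (auto simp: F_def)
      then have "continuous (at y within {0<..1}) F" using y False by (simp add: continuous_on_eq_continuous_within)
      moreover have "at y within {0<..1} = at y within {0..1}"
        using y False by (intro at_within_nhd[of y "{0<..}"]) auto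
      ultimately show ?thesis by (simp add: continuous_within)
    qed
  qed
  have FS: "F (1 / (s\<^sup>2 + 1)) = f s * (T\<^sup>2 / (s\<^sup>2 + T\<^sup>2))" if "s \<ge> 0" for s
  proof -
    have "1 / (1 / (s\<^sup>2 + 1)) - 1 = s\<^sup>2" by simp
    then have a: "sqrt (1 / (1 / (s\<^sup>2 + 1)) - 1) = s" using that by simp
    have b: "T\<^sup>2 * (1 / (s\<^sup>2 + 1)) / (1 + (T\<^sup>2 - 1) * (1 / (s\<^sup>2 + 1))) = T\<^sup>2 / (s\<^sup>2 + T\<^sup>2)"
    proof -
      have "1 + (T\<^sup>2 - 1) * (1 / (s\<^sup>2 + 1)) = (s\<^sup>2 + T\<^sup>2) / (s\<^sup>2 + 1)" using p(2)[of s] by (simp add: field_simps)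
      then show ?thesis using p[of s] by simp
    qed
    show ?thesis using p(2)[of s] unfolding F_def a b by simp
  qed
  show ?thesis
  proof (rule conv_prob_uniform)
    show "continuous_on UNIV (\<lambda>s. f s * (T\<^sup>2 / (s\<^sup>2 + T\<^sup>2)))"
      by (intro continuous_intros cont) (use p in \<open>auto simp: less_le\<close>)
    have "\<bar>f s * (T\<^sup>2 / (s\<^sup>2 + T\<^sup>2))\<bar> \<le> B * 1" for s
      unfolding abs_mult using bdd[of s] p(1)[of s] B by (intro mult_mono) (auto simp: abs_of_pos)
    then show "\<exists>B. \<forall>s. \<bar>f s * (T\<^sup>2 / (s\<^sup>2 + T\<^sup>2))\<bar> \<le> B" by blast
    fix \<delta> :: real assume "\<delta> > 0"
    then obtain q where q: "real_polynomial_function q" "\<And>y. y \<in> {0..1} \<Longrightarrow> \<bar>F y - q y\<bar> < \<delta>"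
      using Stone_Weierstrass_real_polynomial_function[of "{0..1}" F \<delta>] contF by auto
    then obtain a m where qa: "q = (\<lambda>x. \<Sum>i\<le>m. a i * x ^ i)"
      unfolding real_polynomial_function_iff_sum by blast
    have "conv_prob (\<lambda>s. q (1 / (s\<^sup>2 + 1)))" unfolding qa by (intro conv_prob_sum conv_prob_power)
    moreover have "\<bar>f s * (T\<^sup>2 / (s\<^sup>2 + T\<^sup>2)) - q (1 / (s\<^sup>2 + 1))\<bar> \<le> \<delta>" if "s \<ge> 0" for s
      using q(2)[of "1 / (s\<^sup>2 + 1)"] FS[OF that] p(2)[of s] by simp
    ultimately show "\<exists>g. conv_prob g \<and> (\<forall>s\<ge>0. \<bar>f s * (T\<^sup>2 / (s\<^sup>2 + T\<^sup>2)) - g s\<bar> \<le> \<delta>)" by blast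
  qed
qed

text \<open>Cut off with \<kappa> T s = T^2 / (s^2 + T^2) and bound the error by B (1 - \<kappa> T).
  Since \<kappa> T is a convergent test function and its \<nu>-integral tends to 1, mass escaping to
  infinity under the random measures is controlled by the limit alone.\<close>

lemma conv_prob_bounded_continuous:
  assumes cont: "continuous_on UNIV f" and bdd: "\<And>s. \<bar>f s\<bar> \<le> B"
  shows "conv_prob f"
proof (rule conv_prob_approx[OF cont])
  show "\<exists>B. \<forall>s. \<bar>f s\<bar> \<le> B" using bdd by blast
  interpret nu: prob_space \<nu> using nu by (simp add: half_line_prob_def)
  have B: "B \<ge> 0" using bdd[of 0] by linarith
  define \<kappa> where "\<kappa> T s = T\<^sup>2 / (s\<^sup>2 + T\<^sup>2)" for T s :: real
  have kap: "0 \<le> \<kappa> T s" "\<kappa> T s \<le> 1" if "T \<ge> 1" for T s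
    using that by (auto simp: \<kappa>_def divide_le_eq_1 add_nonneg_pos)
  have CPk: "conv_prob (\<kappa> T)" if "T \<ge> 1" for T
    using conv_prob_cmult[OF base[of T], of "T\<^sup>2"] that unfolding \<kappa>_def by simp
  have lim: "(\<lambda>n. LINT s|\<nu>. \<kappa> (real (Suc n)) s) \<longlonglongrightarrow> (LINT s|\<nu>. 1)"
  proof (rule integral_dominated_convergence[where w = "\<lambda>_. 1"])
    show "AE s in \<nu>. (\<lambda>n. \<kappa> (real (Suc n)) s) \<longlonglongrightarrow> 1"
    proof (intro AE_I2)
      fix s :: real
      show "(\<lambda>n. \<kappa> (real (Suc n)) s) \<longlonglongrightarrow> 1" unfolding \<kappa>_def by real_asymp
    qed
    show "\<kappa> (real (Suc n)) \<in> borel_measurable \<nu>" for n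
      using integrable(2)[of "\<kappa> (real (Suc n))"] CPk[of "real (Suc n)"] unfolding conv_prob_def by auto
    show "AE s in \<nu>. norm (\<kappa> (real (Suc n)) s) \<le> 1" for n
      using kap[of "real (Suc n)"] by (intro AE_I2) auto
  qed (auto simp: nu.prob_space)
  fix \<delta> :: real assume d: "\<delta> > 0"
  have "eventually (\<lambda>n. \<bar>(LINT s|\<nu>. \<kappa> (real (Suc n)) s) - 1\<bar> < \<delta> / (B + 1)) sequentially"
    using tendstoD[OF lim, of "\<delta> / (B + 1)"] d B by (simp add: dist_real_def nu.prob_space)
  then obtain n where n: "\<bar>(LINT s|\<nu>. \<kappa> (real (Suc n)) s) - 1\<bar> < \<delta> / (B + 1)" unfolding eventually_sequentially by blast
  define T where "T = real (Suc n)"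
  have T: "T \<ge> 1" by (simp add: T_def)
  have int: "integrable \<nu> (\<kappa> T)" using integrable(2)[of "\<kappa> T"] CPk[OF T] unfolding conv_prob_def by auto
  show "\<exists>g k. conv_prob g \<and> conv_prob k \<and> (\<forall>s\<ge>0. \<bar>f s - g s\<bar> \<le> k s) \<and> (LINT s|\<nu>. k s) \<le> \<delta>"
  proof (intro exI conjI)
    show "conv_prob (\<lambda>s. f s * \<kappa> T s)" unfolding \<kappa>_def by (rule conv_prob_vanishing[OF cont bdd T])
    show "conv_prob (\<lambda>s. B * 1 + (- B) * \<kappa> T s)" by (intro conv_prob_lincomb conv_prob_const CPk T)
    show "\<forall>s\<ge>0. \<bar>f s - f s * \<kappa> T s\<bar> \<le> B * 1 + - B * \<kappa> T s"
    proof (intro allI impI)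
      fix s :: real
      have "\<bar>f s - f s * \<kappa> T s\<bar> = \<bar>f s\<bar> * (1 - \<kappa> T s)"
        using kap[OF T, of s] by (simp add: abs_mult flip: right_diff_distrib[of "f s" 1 "\<kappa> T s", simplified])
      also have "\<dots> \<le> B * (1 - \<kappa> T s)" using bdd kap[OF T, of s] by (intro mult_right_mono) auto
      finally show "\<bar>f s - f s * \<kappa> T s\<bar> \<le> B * 1 + - B * \<kappa> T s" by (simp add: algebra_simps)
    qed
    have "(LINT s|\<nu>. B * 1 + (- B) * \<kappa> T s) = B * (1 - (LINT s|\<nu>. \<kappa> T s))"
      using int by (simp add: nu.prob_space algebra_simps)
    also have "\<dots> \<le> B * (\<delta> / (B + 1))" using n B unfolding T_def by (intro mult_left_mono) auto
    also have "\<dots> \<le> \<delta>" using B d by (simp add: field_simps)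
    finally show "(LINT s|\<nu>. B * 1 + (- B) * \<kappa> T s) \<le> \<delta>" .
  qed
qed

theorem weak_conv_in_prob_of_stieltjes: "weak_conv_in_prob P N \<nu>"
  unfolding weak_conv_in_prob_def
proof (intro allI impI)
  fix f :: "real \<Rightarrow> real" and \<epsilon> :: real
  assume f: "continuous_on UNIV f" "bounded (range f)" and e: "\<epsilon> > 0"
  obtain B where "\<And>s. \<bar>f s\<bar> \<le> B" using f(2) unfolding bounded_iff by auto
  then show "(\<lambda>n. measure_pmf.prob (P n) {\<omega>. \<bar>(LINT s|N n \<omega>. f s) - (LINT s|\<nu>. f s)\<bar> \<ge> \<epsilon>}) \<longlonglongrightarrow> 0"
    using conv_prob_bounded_continuous[OF f(1)] e unfolding conv_prob_def by blast
qed

end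
end

section \<open>Convergence of the singular value distributions\<close>

abbreviation entry_bound :: "(nat \<Rightarrow> real mat) \<Rightarrow> nat \<Rightarrow> real" where
  "entry_bound x n \<equiv> Max ((\<lambda>(i, j). \<bar>x n $$ (i, j)\<bar>) ` ({..<n} \<times> {..<n}))"

abbreviation sv_dist :: "(nat \<Rightarrow> real mat) \<Rightarrow> complex \<Rightarrow> nat \<Rightarrow> (nat \<times> nat \<Rightarrow> nat \<times> nat) \<Rightarrow> real measure" where
  "sv_dist x z n \<pi> \<equiv> singular_value_dist (perm_mat (x n) n \<pi> - z \<cdot>\<^sub>m 1\<^sub>m n)"

lemma perm_mat_shifted:
  "perm_mat A n \<pi> - z \<cdot>\<^sub>m 1\<^sub>m n = shifted_mat n z ((\<lambda>c. A $$ c) \<circ> \<pi>)"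
  by (rule eq_matI) (auto simp: perm_mat_def shifted_mat_def)

lemma sv_dist_half_line:
  assumes "n > 0"
  shows "half_line_prob (sv_dist x z n \<pi>)"
  unfolding perm_mat_shifted half_line_prob_def
  using singular_value_dist_basic(1-3)[OF shifted_mat_carrier assms] by simp

lemma sv_dist_integral:
  fixes f :: "real \<Rightarrow> real"
  assumes "n > 0" "f \<in> borel_measurable borel"
  shows "(LINT s|sv_dist x z n \<pi>. f s) = (\<Sum>k<n. f (singular_values (shifted_mat n z ((\<lambda>c. x n $$ c) \<circ> \<pi>)) ! k)) / real n"
  unfolding perm_mat_shifted by (rule singular_value_dist_basic(4)[OF shifted_mat_carrier assms])

lemma admissible_swap_array:
  assumes x: "admissible_array x" and n: "n \<ge> 2" and t: "t > 0"
  shows "swap_array n t (\<lambda>c. x n $$ c) (entry_bound x n)"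
proof
  show "n > 0" "t > 0" using n t by auto
  have "(\<Sum>i<n. \<Sum>j<n. x n $$ (i, j)) = 0" "(\<Sum>i<n. \<Sum>j<n. \<bar>x n $$ (i, j)\<bar>\<^sup>2) = (real n)\<^sup>2"
    using x n by (auto simp: admissible_array_def)
  then show "(\<Sum>c\<in>{..<n} \<times> {..<n}. x n $$ c) = 0" "(\<Sum>c\<in>{..<n} \<times> {..<n}. (x n $$ c)\<^sup>2) = (real n)\<^sup>2"
    by (simp_all add: sum.cartesian_product)
  show "\<bar>x n $$ c\<bar> \<le> entry_bound x n" if "c \<in> {..<n} \<times> {..<n}" for c
    using that by (intro Max_ge) (auto intro!: image_eqI[of _ _ c])
qed

abbreviation perms :: "nat \<Rightarrow> (nat \<times> nat \<Rightarrow> nat \<times> nat) set" where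
  "perms n \<equiv> {\<pi>. \<pi> permutes {..<n} \<times> {..<n}}"

lemma finite_perms: "finite (perms n)" and perms_nonempty: "perms n \<noteq> {}"
  using finite_permutations[of "{..<n} \<times> {..<n}"] permutes_id by blast+

definition rate :: "(nat \<Rightarrow> real mat) \<Rightarrow> complex \<Rightarrow> real \<Rightarrow> nat \<Rightarrow> real" where
  "rate x z t n = 2 * (fixed_point (cmod z) t / t ^ 3)\<^sup>2 * ((t + 1 / t)\<^sup>2 + (cmod z)\<^sup>2) * error_const z t * (entry_bound x n / sqrt (real n) + 1 / real n)"

lemma rate_tendsto:
  assumes "admissible_array x"
  shows "rate x z t \<longlonglongrightarrow> 0"
proof -
  have "(\<lambda>n. entry_bound x n / sqrt (real n)) \<longlonglongrightarrow> 0"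
    using assms unfolding admissible_array_def by (intro smalloD_tendsto) auto
  moreover have "(\<lambda>n. 1 / real n) \<longlonglongrightarrow> 0" by real_asymp
  ultimately have "(\<lambda>n. entry_bound x n / sqrt (real n) + 1 / real n) \<longlonglongrightarrow> 0 + 0" by (rule tendsto_add)
  then have "(\<lambda>n. 2 * (fixed_point (cmod z) t / t ^ 3)\<^sup>2 * ((t + 1 / t)\<^sup>2 + (cmod z)\<^sup>2) * error_const z t * (entry_bound x n / sqrt (real n) + 1 / real n))
     \<longlonglongrightarrow> 2 * (fixed_point (cmod z) t / t ^ 3)\<^sup>2 * ((t + 1 / t)\<^sup>2 + (cmod z)\<^sup>2) * error_const z t * (0 + 0)"
    by (intro tendsto_mult tendsto_const)
  then show ?thesis unfolding rate_def by simp
qed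

lemma stieltjes_measurable: "(\<lambda>s :: real. t / (s\<^sup>2 + t\<^sup>2)) \<in> borel_measurable borel"
  by measurable

lemma sv_dist_mean_square:
  assumes x: "admissible_array x" and n: "n \<ge> 2" and t: "t > 0"
  shows "(\<Sum>\<pi>\<in>perms n. ((LINT s|sv_dist x z n \<pi>. t / (s\<^sup>2 + t\<^sup>2)) - (fixed_point (cmod z) t - t))\<^sup>2) \<le> card (perms n) * rate x z t n"
proof -
  interpret swap_array n z t "\<lambda>c. x n $$ c" "entry_bound x n" by (rule admissible_swap_array[OF x n t])
  have "(LINT s|sv_dist x z n \<pi>. t / (s\<^sup>2 + t\<^sup>2)) = stieltjes ((\<lambda>c. x n $$ c) \<circ> \<pi>)" for \<pi>
    unfolding stieltjes_def using n by (intro sv_dist_integral stieltjes_measurable) auto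
  then show ?thesis using stieltjes_mean_square unfolding rate_def by simp
qed

text \<open>Chebyshev's inequality, carried out by counting the permutations with a large
  deviation.\<close>

lemma sv_dist_stieltjes_in_prob:
  assumes x: "admissible_array x" and t: "t > 0" and e: "\<epsilon> > 0"
  shows "(\<lambda>n. measure_pmf.prob (unif_perm n)
     {\<pi>. \<bar>(LINT s|sv_dist x z n \<pi>. t / (s\<^sup>2 + t\<^sup>2)) - (fixed_point (cmod z) t - t)\<bar> \<ge> \<epsilon>}) \<longlonglongrightarrow> 0"
proof -
  define D where "D n \<pi> = (LINT s|sv_dist x z n \<pi>. t / (s\<^sup>2 + t\<^sup>2)) - (fixed_point (cmod z) t - t)" for n \<pi>
  have le: "measure_pmf.prob (unif_perm n) {\<pi>. \<bar>D n \<pi>\<bar> \<ge> \<epsilon>} \<le> rate x z t n / \<epsilon>\<^sup>2" if n: "n \<ge> 2" for n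
  proof -
    let ?A = "perms n \<inter> {\<pi>. \<bar>D n \<pi>\<bar> \<ge> \<epsilon>}"
    have c: "real (card (perms n)) > 0" using finite_perms perms_nonempty by (simp add: card_gt_0_iff)
    have "real (card ?A) * \<epsilon>\<^sup>2 = (\<Sum>\<pi>\<in>?A. \<epsilon>\<^sup>2)" by simp
    also have "\<dots> \<le> (\<Sum>\<pi>\<in>?A. (D n \<pi>)\<^sup>2)"
      using e by (intro sum_mono) (auto intro!: abs_le_square_iff[THEN iffD1])
    also have "\<dots> \<le> (\<Sum>\<pi>\<in>perms n. (D n \<pi>)\<^sup>2)" by (intro sum_mono2 finite_perms) auto
    also have "\<dots> \<le> card (perms n) * rate x z t n" unfolding D_def by (rule sv_dist_mean_square[OF x n t])
    finally have "real (card ?A) / card (perms n) \<le> rate x z t n / \<epsilon>\<^sup>2"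
      using c e by (simp add: field_simps)
    then show ?thesis unfolding unif_perm_def measure_pmf_of_set[OF perms_nonempty finite_perms] .
  qed
  have "(\<lambda>n. rate x z t n / \<epsilon>\<^sup>2) \<longlonglongrightarrow> 0 / \<epsilon>\<^sup>2"
    using e by (intro tendsto_divide rate_tendsto[OF x] tendsto_const) auto
  then have lim: "(\<lambda>n. rate x z t n / \<epsilon>\<^sup>2) \<longlonglongrightarrow> 0" by simp
  have "\<forall>\<^sub>F n in sequentially. measure_pmf.prob (unif_perm n) {\<pi>. \<bar>D n \<pi>\<bar> \<ge> \<epsilon>} \<le> rate x z t n / \<epsilon>\<^sup>2"
    unfolding eventually_sequentially using le by blast
  then show ?thesis unfolding D_def
    by (rule tendsto_sandwich[OF always_eventually[OF allI[OF measure_nonneg]] _ tendsto_const lim])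
qed

lemma weak_conv_in_prob_stieltjes_criterion:
  fixes N :: "nat \<Rightarrow> 'a \<Rightarrow> real measure"
  assumes N: "\<And>n \<omega>. n \<ge> 2 \<Longrightarrow> half_line_prob (N n \<omega>)" and nu: "half_line_prob \<nu>"
    and conv: "\<And>t \<epsilon>. t > 0 \<Longrightarrow> \<epsilon> > 0 \<Longrightarrow>
      (\<lambda>n. measure_pmf.prob (P n) {\<omega>. \<bar>(LINT s|N n \<omega>. t / (s\<^sup>2 + t\<^sup>2)) - (LINT s|\<nu>. t / (s\<^sup>2 + t\<^sup>2))\<bar> \<ge> \<epsilon>}) \<longlonglongrightarrow> 0"
  shows "weak_conv_in_prob P N \<nu>"
proof -
  interpret random_half_line_measures P N \<nu> using N nu by unfold_locales
  have cp: "conv_prob (\<lambda>s. 1 / (s\<^sup>2 + t\<^sup>2))" if t: "t > 0" for t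
  proof -
    have p: "s\<^sup>2 + t\<^sup>2 > 0" for s using t by (intro add_nonneg_pos) auto
    have "conv_prob (\<lambda>s. t / (s\<^sup>2 + t\<^sup>2))"
      unfolding conv_prob_def
    proof (intro conjI allI impI conv t)
      show "continuous_on UNIV (\<lambda>s. t / (s\<^sup>2 + t\<^sup>2))"
        by (intro continuous_intros) (use p in \<open>auto simp: less_le\<close>)
      have "\<bar>t / (s\<^sup>2 + t\<^sup>2)\<bar> \<le> t / t\<^sup>2" for s
        using t p[of s] by (auto simp: abs_of_pos intro!: divide_left_mono)
      then show "\<exists>B. \<forall>s. \<bar>t / (s\<^sup>2 + t\<^sup>2)\<bar> \<le> B" by blast
    qed
    from conv_prob_cmult[OF this, of "1 / t"] show ?thesis using t by simp
  qed
  show ?thesis by (rule weak_conv_in_prob_of_stieltjes[OF cp])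
qed

text \<open>Formulated for any law with the right transform, so that it applies both to the law
  found by compactness and to the quarter circle law.\<close>

theorem sv_dist_weak_conv:
  assumes x: "admissible_array x" and nu: "half_line_prob \<nu>"
    and st: "\<And>t. t > 0 \<Longrightarrow> (LINT s|\<nu>. t / (s\<^sup>2 + t\<^sup>2)) = fixed_point (cmod z) t - t"
  shows "weak_conv_in_prob unif_perm (sv_dist x z) \<nu>"
  by (rule weak_conv_in_prob_stieltjes_criterion[OF sv_dist_half_line nu])
     (simp_all add: st sv_dist_stieltjes_in_prob[OF x])

text \<open>If some integral differed, the events of deviating by half the difference from either
  value would cover the whole probability space, so their probabilities could not both tend to 0.
  Cosines and sines as test functions then identify the characteristic functions.\<close>

lemma weak_conv_in_prob_unique:
  assumes mu: "half_line_prob \<mu>" and nu: "half_line_prob \<nu>"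
    and c1: "weak_conv_in_prob P N \<mu>" and c2: "weak_conv_in_prob P N \<nu>"
  shows "\<mu> = \<nu>"
proof -
  have eq: "(LINT s|\<mu>. f s) = (LINT s|\<nu>. f s)" if f: "continuous_on UNIV f" "bounded (range f)" for f :: "real \<Rightarrow> real"
  proof (rule ccontr)
    assume ne: "(LINT s|\<mu>. f s) \<noteq> (LINT s|\<nu>. f s)"
    define \<epsilon> where "\<epsilon> = \<bar>(LINT s|\<mu>. f s) - (LINT s|\<nu>. f s)\<bar> / 2"
    have e: "\<epsilon> > 0" using ne by (simp add: \<epsilon>_def)
    let ?p = "\<lambda>n \<mu>. measure_pmf.prob (P n) {\<omega>. \<bar>(LINT s|N n \<omega>. f s) - (LINT s|\<mu>. f s)\<bar> \<ge> \<epsilon>}"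
    have "(\<lambda>n. ?p n \<mu> + ?p n \<nu>) \<longlonglongrightarrow> 0 + 0"
      using c1 c2 f e unfolding weak_conv_in_prob_def by (intro tendsto_add) blast+
    moreover have "1 \<le> ?p n \<mu> + ?p n \<nu>" for n
    proof -
      have "{\<omega>. \<bar>(LINT s|N n \<omega>. f s) - (LINT s|\<mu>. f s)\<bar> \<ge> \<epsilon>} \<union> {\<omega>. \<bar>(LINT s|N n \<omega>. f s) - (LINT s|\<nu>. f s)\<bar> \<ge> \<epsilon>} = UNIV"
      proof -
        have "\<epsilon> \<le> \<bar>a - b\<bar> \<or> \<epsilon> \<le> \<bar>a - c\<bar>" if "\<epsilon> = \<bar>b - c\<bar> / 2" for a b c :: real
        proof -
          have "2 * \<epsilon> = \<bar>b - c\<bar>" using that by simp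
          moreover have "\<bar>b - c\<bar> \<le> \<bar>a - b\<bar> + \<bar>a - c\<bar>" by linarith
          ultimately show ?thesis by linarith
        qed
        from this[OF \<epsilon>_def] show ?thesis by auto
      qed
      then have "1 = measure_pmf.prob (P n) ({\<omega>. \<bar>(LINT s|N n \<omega>. f s) - (LINT s|\<mu>. f s)\<bar> \<ge> \<epsilon>} \<union> {\<omega>. \<bar>(LINT s|N n \<omega>. f s) - (LINT s|\<nu>. f s)\<bar> \<ge> \<epsilon>})"
        by simp
      also have "\<dots> \<le> ?p n \<mu> + ?p n \<nu>" by (intro measure_Un_le) auto
      finally show ?thesis .
    qed
    ultimately have "(1::real) \<le> 0 + 0" by (intro LIMSEQ_le_const[of _ "0 + 0" 1]) auto
    then show False by simp
  qed
  have rd: "real_distribution \<mu>" "real_distribution \<nu>"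
    using mu nu by (auto simp: half_line_prob_def real_distribution_def real_distribution_axioms_def)
  interpret mu: real_distribution \<mu> by (rule rd)
  interpret nu: real_distribution \<nu> by (rule rd)
  show ?thesis
  proof (rule Levy_uniqueness[OF rd], rule ext)
    fix u :: real
    have bd: "continuous_on UNIV (\<lambda>s. cos (u * s))" "bounded (range (\<lambda>s. cos (u * s)))"
      "continuous_on UNIV (\<lambda>s. sin (u * s))" "bounded (range (\<lambda>s. sin (u * s)))"
      by (auto intro!: continuous_intros boundedI[of _ 1])
    have re: "Re (char M u) = (LINT s|M. cos (u * s))" "Im (char M u) = (LINT s|M. sin (u * s))" if "real_distribution M" for M
    proof -
      interpret M: real_distribution M by (rule that)
      have int: "integrable M (\<lambda>s. iexp (u * s))"
        by (intro M.integrable_const_bound[of _ 1]) auto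
      show "Re (char M u) = (LINT s|M. cos (u * s))" unfolding char_def
        by (subst integral_Re[symmetric, OF int]) (simp add: Re_exp)
      show "Im (char M u) = (LINT s|M. sin (u * s))" unfolding char_def
        by (subst integral_Im[symmetric, OF int]) (simp add: Im_exp)
    qed
    show "char \<mu> u = char \<nu> u"
      using eq[OF bd(1,2)] eq[OF bd(3,4)] by (intro complex_eqI) (simp_all add: re rd)
  qed
qed

text \<open>The antisymmetric sign matrix sums to 0. It has n (n - 1) nonzero entries, so the
  squares sum to n^2 after scaling by \<open>c n\<close>, and the entries stay bounded. Without such
  an array the universally quantified convergence in \<open>is_limit_law\<close> would be
  vacuous.\<close>

lemma admissible_array_exists: "\<exists>x. admissible_array x"
proof -
  define c where "c n = sqrt (real n / (real n - 1))" for n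
  define x where "x n = mat n n (\<lambda>(i, j). c n * sgn (real i - real j))" for n
  have c0: "0 \<le> c n" for n by (cases n) (auto simp: c_def)
  have ent: "x n $$ (i, j) = c n * sgn (real i - real j)" if "i < n" "j < n" for n i j
    using that by (simp add: x_def)
  have "x n \<in> carrier_mat n n \<and> (\<Sum>i<n. \<Sum>j<n. x n $$ (i, j)) = 0 \<and> (\<Sum>i<n. \<Sum>j<n. \<bar>x n $$ (i, j)\<bar>\<^sup>2) = (real n)\<^sup>2"
    if n: "n \<ge> 2" for n
  proof (intro conjI)
    show "x n \<in> carrier_mat n n" by (simp add: x_def)
    have "(\<Sum>i<n. \<Sum>j<n. x n $$ (i, j)) = (\<Sum>i<n. \<Sum>j<n. x n $$ (j, i))" by (rule sum.swap)
    also have "\<dots> = (\<Sum>i<n. \<Sum>j<n. - x n $$ (i, j))"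
    proof (intro sum.cong refl)
      fix i j assume "i \<in> {..<n}" "j \<in> {..<n}"
      then show "x n $$ (j, i) = - x n $$ (i, j)" by (simp add: ent sgn_if)
    qed
    finally show "(\<Sum>i<n. \<Sum>j<n. x n $$ (i, j)) = 0" by (simp add: sum_negf)
    have "(\<Sum>i<n. \<Sum>j<n. \<bar>x n $$ (i, j)\<bar>\<^sup>2) = (\<Sum>i<n. \<Sum>j<n. (c n)\<^sup>2 - (if j = i then (c n)\<^sup>2 else 0))"
      by (intro sum.cong refl) (auto simp: ent sgn_if power_mult_distrib)
    also have "\<dots> = (c n)\<^sup>2 * (real n * (real n - 1))"
      by (simp add: sum_subtractf algebra_simps)
    also have "(c n)\<^sup>2 = real n / (real n - 1)" unfolding c_def using n by (intro real_sqrt_pow2) auto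
    also have "real n / (real n - 1) * (real n * (real n - 1)) = (real n)\<^sup>2"
      using n by (simp add: power2_eq_square)
    finally show "(\<Sum>i<n. \<Sum>j<n. \<bar>x n $$ (i, j)\<bar>\<^sup>2) = (real n)\<^sup>2" .
  qed
  moreover have "entry_bound x \<in> o(\<lambda>n. sqrt (real n))"
  proof (rule smalloI_tendsto)
    show "\<forall>\<^sub>F n in sequentially. sqrt (real n) \<noteq> 0" using eventually_gt_at_top[of 0] by eventually_elim auto
    have lim: "(\<lambda>n. c n / sqrt (real n)) \<longlonglongrightarrow> 0" unfolding c_def by real_asymp
    have Mx: "0 \<le> entry_bound x n / sqrt (real n) \<and> entry_bound x n / sqrt (real n) \<le> c n / sqrt (real n)" if n: "n \<ge> 2" for n
    proof -
      let ?A = "(\<lambda>(i, j). \<bar>x n $$ (i, j)\<bar>) ` ({..<n} \<times> {..<n})"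
      have ne: "?A \<noteq> {}" using n by (auto simp: lessThan_empty_iff)
      have fin: "finite ?A" by simp
      have "0 \<le> Max ?A" using Max_in[OF fin ne] by auto
      moreover have "Max ?A \<le> c n"
        using c0[of n] by (subst Max_le_iff[OF fin ne]) (auto simp: ent abs_mult sgn_if)
      ultimately show ?thesis by (auto intro: divide_right_mono)
    qed
    show "(\<lambda>n. entry_bound x n / sqrt (real n)) \<longlonglongrightarrow> 0"
    proof (rule tendsto_sandwich[OF _ _ tendsto_const lim])
      show "\<forall>\<^sub>F n in sequentially. 0 \<le> entry_bound x n / sqrt (real n)"
        "\<forall>\<^sub>F n in sequentially. entry_bound x n / sqrt (real n) \<le> c n / sqrt (real n)"
        unfolding eventually_sequentially using Mx by blast+
    qed
  qed
  ultimately show ?thesis unfolding admissible_array_def by blast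
qed

lemma (in swap_array) sum_singular_values_squared_le:
  assumes "\<pi> permutes S"
  shows "(\<Sum>k<n. (singular_values (M (x \<circ> \<pi>)) ! k)\<^sup>2) \<le> real n * (2 + 2 * (cmod z)\<^sup>2)"
proof -
  define X where "X = x \<circ> \<pi>"
  have ent: "(cmod (M X $$ (i, j)))\<^sup>2 \<le> 2 * (X (i, j))\<^sup>2 / real n + (if j = i then 2 * (cmod z)\<^sup>2 else 0)" if "i < n" "j < n" for i j
  proof -
    have "cmod (M X $$ (i, j)) \<le> \<bar>X (i, j) / sqrt (real n)\<bar> + (if j = i then cmod z else 0)"
      using that norm_triangle_ineq4[of "complex_of_real (X (i, j) / sqrt (real n))" z] unfolding norm_of_real
      by (auto simp: shifted_mat_def simp del: of_real_divide)
    then have "(cmod (M X $$ (i, j)))\<^sup>2 \<le> (\<bar>X (i, j) / sqrt (real n)\<bar> + (if j = i then cmod z else 0))\<^sup>2"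
      by (intro power_mono) auto
    also have "\<dots> \<le> 2 * \<bar>X (i, j) / sqrt (real n)\<bar>\<^sup>2 + 2 * (if j = i then cmod z else 0)\<^sup>2"
      using sum_squares_bound[of "\<bar>X (i, j) / sqrt (real n)\<bar>" "if j = i then cmod z else 0"] by (simp only: power2_sum)
    also have "\<dots> = 2 * (X (i, j))\<^sup>2 / real n + (if j = i then 2 * (cmod z)\<^sup>2 else 0)"
      by (simp add: power_divide)
    finally show ?thesis .
  qed
  have "(\<Sum>k<n. (singular_values (M X) ! k)\<^sup>2) = (\<Sum>i<n. \<Sum>j<n. (cmod (M X $$ (i, j)))\<^sup>2)"
    by (rule sum_singular_values_squared) simp
  also have "\<dots> \<le> (\<Sum>i<n. \<Sum>j<n. 2 * (X (i, j))\<^sup>2 / real n + (if j = i then 2 * (cmod z)\<^sup>2 else 0))"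
    by (intro sum_mono ent) auto
  also have "\<dots> = 2 * (\<Sum>c\<in>S. (X c)\<^sup>2) / real n + real n * (2 * (cmod z)\<^sup>2)"
    by (simp add: sum.distrib sum.cartesian_product sum_divide_distrib sum_distrib_left)
  also have "(\<Sum>c\<in>S. (X c)\<^sup>2) = (real n)\<^sup>2" by (rule X_square[OF assms X_def])
  also have "2 * (real n)\<^sup>2 / real n + real n * (2 * (cmod z)\<^sup>2) = real n * (2 + 2 * (cmod z)\<^sup>2)"
    using n by (simp add: power2_eq_square algebra_simps)
  finally show ?thesis unfolding X_def .
qed

text \<open>The law is a subsequential limit of the mean singular value distributions, which are tight
  because their second moments are bounded.\<close>

theorem limit_law_exists:
  "\<exists>\<nu>. half_line_prob \<nu> \<and> (\<forall>t>0. (LINT s|\<nu>. t / (s\<^sup>2 + t\<^sup>2)) = fixed_point (cmod z) t - t)"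
proof -
  obtain x where x: "admissible_array x" using admissible_array_exists by blast
  define SV where "SV n \<pi> k = singular_values (shifted_mat n z ((\<lambda>c. x n $$ c) \<circ> \<pi>)) ! k" for n \<pi> k
  \<comment> \<open>The mean singular value distribution: the law of a uniformly chosen singular
    value of a uniformly permuted array.\<close>
  define R where "R n = distr (measure_pmf (pmf_of_set (perms n \<times> {..<n}))) borel (\<lambda>(\<pi>, k). SV n \<pi> k)" for n
  have ne: "perms n \<times> {..<n} \<noteq> {}" if "n \<ge> 2" for n using perms_nonempty that by (auto simp: lessThan_empty_iff)
  have fin: "finite (perms n \<times> {..<n})" for n using finite_perms by auto
  have c0: "real (card (perms n)) > 0" for n using finite_perms perms_nonempty by (simp add: card_gt_0_iff)
  have int_R: "(LINT s|R n. f s) = (\<Sum>\<pi>\<in>perms n. LINT s|sv_dist x z n \<pi>. f s) / card (perms n)"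
    if n: "n \<ge> 2" and f: "f \<in> borel_measurable borel" for n and f :: "real \<Rightarrow> real"
  proof -
    have "(LINT s|R n. f s) = (LINT p|measure_pmf (pmf_of_set (perms n \<times> {..<n})). f (case p of (\<pi>, k) \<Rightarrow> SV n \<pi> k))"
      unfolding R_def by (rule integral_distr) (use f in auto)
    also have "\<dots> = (\<Sum>(\<pi>, k)\<in>perms n \<times> {..<n}. f (SV n \<pi> k)) / card (perms n \<times> {..<n})"
      by (subst integral_pmf_of_set[OF ne[OF n] fin]) (simp add: split_def)
    also have "\<dots> = (\<Sum>\<pi>\<in>perms n. (\<Sum>k<n. f (SV n \<pi> k)) / real n) / card (perms n)"
      by (simp add: sum.cartesian_product[symmetric] sum_divide_distrib card_cartesian_product mult.commute)
    also have "\<dots> = (\<Sum>\<pi>\<in>perms n. LINT s|sv_dist x z n \<pi>. f s) / card (perms n)"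
      using n f unfolding SV_def by (subst sv_dist_integral) auto
    finally show ?thesis .
  qed
  \<comment> \<open>The array is constrained only from size 2 on.\<close>
  define \<mu> where "\<mu> n = R (n + 2)" for n
  have rd: "real_distribution (\<mu> n)" for n
    unfolding \<mu>_def R_def real_distribution_def real_distribution_axioms_def by (auto intro!: measure_pmf.prob_space_distr)
  have "tight \<mu>"
    unfolding tight_def
  proof (intro conjI allI impI rd)
    fix \<epsilon> :: real assume e: "\<epsilon> > 0"
    define C where "C = 2 + 2 * (cmod z)\<^sup>2"
    have C: "C > 0" by (simp add: C_def add_pos_nonneg)
    \<comment> \<open>\<open>C\<close> bounds the second moment, so Chebyshev needs C / L^2 <
      \<epsilon>; the added 1 makes the inequality strict.\<close>
    define L where "L = sqrt (C / \<epsilon>) + 1"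
    have L: "L > 0" using C e by (simp add: L_def add_nonneg_pos)
    have "C / \<epsilon> = (sqrt (C / \<epsilon>))\<^sup>2" using C e by simp
    also have "\<dots> < L\<^sup>2" unfolding L_def using C e by (intro power_strict_mono) auto
    finally have CL: "C / L\<^sup>2 < \<epsilon>" using e L by (simp add: field_simps)
    \<comment> \<open>Tightness is phrased with half-open intervals, so the left end lies below 0 to
      include vanishing singular values.\<close>
    have "measure (\<mu> m) {-1<..L} > 1 - \<epsilon>" for m
    proof -
      define n where "n = m + 2"
      have n: "n \<ge> 2" by (simp add: n_def)
      interpret Rm: real_distribution "\<mu> m" by (rule rd)
      interpret sw: swap_array n z 1 "\<lambda>c. x n $$ c" "entry_bound x n" by (rule admissible_swap_array[OF x n]) simp
      have low: "1 - C / L\<^sup>2 \<le> (LINT s|sv_dist x z n \<pi>. indicator {-1<..L} s)" if pi: "\<pi> \<in> perms n" for \<pi>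
      proof -
        have "1 - s\<^sup>2 / L\<^sup>2 \<le> indicator {-1<..L} s" if "s \<ge> 0" for s
        proof (cases "s \<le> L")
          case False
          then have "L\<^sup>2 \<le> s\<^sup>2" using L by (intro power_mono) auto
          then show ?thesis using L False by simp
        qed (use that in simp)
        then have "(\<Sum>k<n. 1 - (SV n \<pi> k)\<^sup>2 / L\<^sup>2) \<le> (\<Sum>k<n. indicator {-1<..L} (SV n \<pi> k))"
          unfolding SV_def by (intro sum_mono) (auto intro!: singular_value_nonneg(1)[OF shifted_mat_carrier])
        moreover have "(\<Sum>k<n. 1 - (SV n \<pi> k)\<^sup>2 / L\<^sup>2) = real n - (\<Sum>k<n. (SV n \<pi> k)\<^sup>2) / L\<^sup>2"
          by (simp add: sum_subtractf sum_divide_distrib)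
        moreover have "(\<Sum>k<n. (SV n \<pi> k)\<^sup>2) / L\<^sup>2 \<le> real n * C / L\<^sup>2"
          using sw.sum_singular_values_squared_le[of \<pi>] pi L unfolding SV_def C_def by (intro divide_right_mono) auto
        ultimately have "real n - real n * C / L\<^sup>2 \<le> (\<Sum>k<n. indicator {-1<..L} (SV n \<pi> k))" by linarith
        then have "(real n - real n * C / L\<^sup>2) / real n \<le> (\<Sum>k<n. indicator {-1<..L} (SV n \<pi> k)) / real n"
          by (rule divide_right_mono) simp
        moreover have "(real n - real n * C / L\<^sup>2) / real n = 1 - C / L\<^sup>2" using n by (simp add: diff_divide_distrib)
        ultimately show ?thesis using n by (subst sv_dist_integral) (auto simp: SV_def)
      qed
      have "1 - \<epsilon> < 1 - C / L\<^sup>2" using CL by simp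
      also have "\<dots> = (\<Sum>\<pi>\<in>perms n. 1 - C / L\<^sup>2) / card (perms n)" using c0[of n] by simp
      also have "\<dots> \<le> (\<Sum>\<pi>\<in>perms n. LINT s|sv_dist x z n \<pi>. indicator {-1<..L} s) / card (perms n)"
        by (intro divide_right_mono sum_mono low) auto
      also have "\<dots> = (LINT s|\<mu> m. indicator {-1<..L} s)" unfolding \<mu>_def n_def[symmetric] by (subst int_R[OF n]) auto
      also have "\<dots> = measure (\<mu> m) {-1<..L}" by simp
      finally show ?thesis .
    qed
    then show "\<exists>a b. a < b \<and> (\<forall>n. 1 - \<epsilon> < measure (\<mu> n) {a<..b})" using L by (intro exI[of _ "-1"] exI[of _ L]) auto
  qed
  from tight_imp_convergent_subsubsequence[OF this strict_mono_id]
  obtain r \<nu> where r: "strict_mono (r :: nat \<Rightarrow> nat)" and nu: "real_distribution \<nu>" and conv: "weak_conv_m (\<mu> \<circ> r) \<nu>"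
    by auto
  interpret nu: real_distribution \<nu> by (rule nu)
  have lim: "(\<lambda>m. LINT s|\<mu> (r m). f s) \<longlonglongrightarrow> (LINT s|\<nu>. f s)"
    if "\<And>s. isCont f s" "\<And>s. \<bar>f s\<bar> \<le> B" for f :: "real \<Rightarrow> real" and B
    using weak_conv_imp_integral_bdd_continuous_conv[OF _ nu conv, of f B] rd that by simp
  have st: "(LINT s|\<nu>. t / (s\<^sup>2 + t\<^sup>2)) = fixed_point (cmod z) t - t" if t: "t > 0" for t
  proof -
    define h where "h = fixed_point (cmod z) t - t"
    have p: "s\<^sup>2 + t\<^sup>2 > 0" for s using t by (intro add_nonneg_pos) auto
    have l1: "(\<lambda>m. LINT s|\<mu> (r m). t / (s\<^sup>2 + t\<^sup>2)) \<longlonglongrightarrow> (LINT s|\<nu>. t / (s\<^sup>2 + t\<^sup>2))"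
    proof (rule lim)
      show "isCont (\<lambda>s. t / (s\<^sup>2 + t\<^sup>2)) s" for s
        by (intro continuous_intros) (use p[of s] in auto)
      show "\<bar>t / (s\<^sup>2 + t\<^sup>2)\<bar> \<le> t / t\<^sup>2" for s
        using t p[of s] by (auto simp: abs_of_pos intro!: divide_left_mono)
    qed
    \<comment> \<open>The deviation of a mean is at most the root mean square deviation, so the mean
      square bound transfers to the averaged measures.\<close>
    have bound: "\<bar>(LINT s|\<mu> m. t / (s\<^sup>2 + t\<^sup>2)) - h\<bar> \<le> sqrt (rate x z t (m + 2))" for m
    proof -
      define n where "n = m + 2"
      have n: "n \<ge> 2" by (simp add: n_def)
      define D where "D \<pi> = (LINT s|sv_dist x z n \<pi>. t / (s\<^sup>2 + t\<^sup>2)) - h" for \<pi>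
      have "(LINT s|\<mu> m. t / (s\<^sup>2 + t\<^sup>2)) = (\<Sum>\<pi>\<in>perms n. LINT s|sv_dist x z n \<pi>. t / (s\<^sup>2 + t\<^sup>2)) / card (perms n)"
        unfolding \<mu>_def n_def[symmetric] by (rule int_R[OF n stieltjes_measurable])
      then have eq: "(LINT s|\<mu> m. t / (s\<^sup>2 + t\<^sup>2)) - h = (\<Sum>\<pi>\<in>perms n. D \<pi>) / card (perms n)"
        using c0[of n] unfolding D_def by (simp add: sum_subtractf diff_divide_distrib)
      have "((\<Sum>\<pi>\<in>perms n. D \<pi>) / card (perms n))\<^sup>2 = (\<Sum>\<pi>\<in>perms n. D \<pi>)\<^sup>2 / (card (perms n))\<^sup>2" by (simp add: power_divide)
      also have "\<dots> \<le> ((\<Sum>\<pi>\<in>perms n. (D \<pi>)\<^sup>2) * card (perms n)) / (card (perms n))\<^sup>2"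
        by (intro divide_right_mono sum_squared_le_sum_of_squares) auto
      also have "\<dots> = (\<Sum>\<pi>\<in>perms n. (D \<pi>)\<^sup>2) / card (perms n)" using c0[of n] by (simp add: power2_eq_square)
      also have "\<dots> \<le> (card (perms n) * rate x z t n) / card (perms n)"
        unfolding D_def h_def by (intro divide_right_mono sv_dist_mean_square[OF x n t]) auto
      also have "\<dots> = rate x z t n" using c0[of n] by simp
      finally have "((LINT s|\<mu> m. t / (s\<^sup>2 + t\<^sup>2)) - h)\<^sup>2 \<le> rate x z t n" unfolding eq .
      then show ?thesis unfolding n_def[symmetric] using real_sqrt_le_mono by fastforce
    qed
    have "(\<lambda>m. sqrt (rate x z t (m + 2))) \<longlonglongrightarrow> sqrt 0"
      by (intro tendsto_real_sqrt LIMSEQ_ignore_initial_segment rate_tendsto x)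
    then have lim0: "(\<lambda>m. sqrt (rate x z t (m + 2))) \<longlonglongrightarrow> 0" by simp
    have "\<forall>\<^sub>F m in sequentially. norm ((LINT s|\<mu> m. t / (s\<^sup>2 + t\<^sup>2)) - h) \<le> sqrt (rate x z t (m + 2))"
      unfolding real_norm_def by (intro always_eventually allI bound)
    then have "(\<lambda>m. (LINT s|\<mu> m. t / (s\<^sup>2 + t\<^sup>2)) - h) \<longlonglongrightarrow> 0"
      by (rule Lim_null_comparison[OF _ lim0])
    then have "(\<lambda>m. LINT s|\<mu> m. t / (s\<^sup>2 + t\<^sup>2)) \<longlonglongrightarrow> h" by (simp add: LIM_zero_iff)
    then have "(\<lambda>m. LINT s|\<mu> (r m). t / (s\<^sup>2 + t\<^sup>2)) \<longlonglongrightarrow> h"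
      using LIMSEQ_subseq_LIMSEQ[OF _ r, of "\<lambda>m. LINT s|\<mu> m. t / (s\<^sup>2 + t\<^sup>2)" h] by (simp add: comp_def)
    with l1 show ?thesis unfolding h_def by (rule LIMSEQ_unique)
  qed
  have "emeasure \<nu> {..<0} = 0"
  proof -
    \<comment> \<open>A bounded continuous function that is positive exactly on the negative axis;
      its integral is 0 along the sequence and therefore in the limit.\<close>
    define f where "f s = min 1 (max 0 (- s))" for s :: real
    have fm: "f \<in> borel_measurable borel" unfolding f_def by measurable
    have "(LINT s|\<mu> m. f s) = 0" for m
    proof -
      have "f (SV n \<pi> k) = 0" if "k < n" for n \<pi> k
        using singular_value_nonneg(1)[OF shifted_mat_carrier that, of z "(\<lambda>c. x n $$ c) \<circ> \<pi>"] unfolding SV_def f_def by simp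
      then have "(LINT s|sv_dist x z (m + 2) \<pi>. f s) = 0" for \<pi>
        by (subst sv_dist_integral[OF _ fm]) (auto simp: SV_def)
      then show ?thesis unfolding \<mu>_def by (subst int_R[OF _ fm]) auto
    qed
    moreover have "(\<lambda>m. LINT s|\<mu> (r m). f s) \<longlonglongrightarrow> (LINT s|\<nu>. f s)"
    proof (rule lim[of f 1])
      have "continuous_on UNIV f" unfolding f_def by (intro continuous_intros)
      then show "isCont f s" for s by (simp add: continuous_on_eq_continuous_at)
    qed (auto simp: f_def)
    ultimately have "(LINT s|\<nu>. f s) = 0" by (simp add: LIMSEQ_const_iff)
    moreover have "integrable \<nu> f"
      by (rule nu.integrable_const_bound[of _ 1]) (use fm in \<open>auto simp: f_def\<close>)
    ultimately have "AE s in \<nu>. f s = 0"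
      by (subst (asm) integral_nonneg_eq_0_iff_AE) (auto simp: f_def)
    then have "AE s in \<nu>. s \<notin> {..<0}" by eventually_elim (auto simp: f_def min_def max_def split: if_splits)
    then show ?thesis by (subst (asm) AE_iff_null_sets[symmetric]) auto
  qed
  then have "half_line_prob \<nu>" unfolding half_line_prob_def by (simp add: nu.prob_space_axioms)
  then show ?thesis using st by blast
qed

section \<open>Absolute continuity\<close>

text \<open>A quadratic remainder bound that is uniform in a parameter can be integrated over that
  parameter. This replaces differentiation under the integral sign, here for the Cauchy transform
  and later for \<open>log_energy\<close>.\<close>

lemma quadratic_error_derivative:
  fixes F :: "'a::real_normed_field \<Rightarrow> 'a"
  assumes d: "\<delta> > 0" and C: "\<And>y. norm (y - x) < \<delta> \<Longrightarrow> norm (F y - F x - D * (y - x)) \<le> C * (norm (y - x))\<^sup>2"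
  shows "(F has_field_derivative D) (at x)"
proof -
  have "((\<lambda>y. C * norm (y - x)) \<longlongrightarrow> C * norm (x - x)) (at x)" by (intro tendsto_intros)
  then have lim: "((\<lambda>y. C * norm (y - x)) \<longlongrightarrow> 0) (at x)" by simp
  have ev: "\<forall>\<^sub>F y in at x. norm ((F y - F x) / (y - x) - D) \<le> C * norm (y - x)"
    unfolding eventually_at
  proof (intro exI[of _ \<delta>] conjI d ballI impI)
    fix y assume y: "y \<noteq> x \<and> dist y x < \<delta>"
    then have ne: "y - x \<noteq> 0" by simp
    have "(F y - F x) / (y - x) - D = (F y - F x - D * (y - x)) / (y - x)" using ne by (simp add: diff_divide_distrib)
    then have "norm ((F y - F x) / (y - x) - D) = norm (F y - F x - D * (y - x)) / norm (y - x)" by (simp add: norm_divide)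
    also have "\<dots> \<le> C * (norm (y - x))\<^sup>2 / norm (y - x)" using y by (intro divide_right_mono C) (auto simp: dist_norm)
    also have "\<dots> = C * norm (y - x)" using ne by (simp add: power2_eq_square)
    finally show "norm ((F y - F x) / (y - x) - D) \<le> C * norm (y - x)" .
  qed
  have "((\<lambda>y. (F y - F x) / (y - x) - D) \<longlongrightarrow> 0) (at x)" by (rule Lim_null_comparison[OF ev lim])
  then show ?thesis unfolding has_field_derivative_iff by (simp add: LIM_zero_iff)
qed

section \<open>Cauchy transforms on the upper half plane\<close>

lemma Im_le_norm_diff: "\<bar>Im \<eta>\<bar> \<le> cmod (complex_of_real a - \<eta>)"
  using abs_Im_le_cmod[of "complex_of_real a - \<eta>"] by simp

context
  fixes M :: "real measure" and \<phi> :: "real \<Rightarrow> real"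
  assumes M: "prob_space M" and phi: "\<phi> \<in> borel_measurable M"
begin

text \<open>The map \<phi> is later the identity or its negative, the two halves of the symmetrized
  law.\<close>

lemma cauchy_kernel_integrable:
  assumes "Im \<eta> > 0"
  shows "complex_integrable M (\<lambda>s. 1 / (complex_of_real (\<phi> s) - \<eta>))"
    and "complex_integrable M (\<lambda>s. 1 / (complex_of_real (\<phi> s) - \<eta>)\<^sup>2)"
proof -
  interpret prob_space M by (rule M)
  have le: "Im \<eta> \<le> cmod (complex_of_real (\<phi> s) - \<eta>)" for s using Im_le_norm_diff[of \<eta> "\<phi> s"] assms by simp
  have pos: "0 < cmod (complex_of_real (\<phi> s) - \<eta>)" for s using le[of s] assms by linarith
  show "complex_integrable M (\<lambda>s. 1 / (complex_of_real (\<phi> s) - \<eta>))"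
  proof (rule integrable_const_bound[of _ "1 / Im \<eta>"])
    have "cmod (1 / (complex_of_real (\<phi> s) - \<eta>)) \<le> 1 / Im \<eta>" for s
      unfolding norm_divide norm_one using le[of s] pos[of s] assms by (intro divide_left_mono mult_pos_pos) auto
    then show "AE s in M. cmod (1 / (complex_of_real (\<phi> s) - \<eta>)) \<le> 1 / Im \<eta>" by simp
  qed (use phi in measurable)
  show "complex_integrable M (\<lambda>s. 1 / (complex_of_real (\<phi> s) - \<eta>)\<^sup>2)"
  proof (rule integrable_const_bound[of _ "1 / (Im \<eta>)\<^sup>2"])
    have "cmod (1 / (complex_of_real (\<phi> s) - \<eta>)\<^sup>2) \<le> 1 / (Im \<eta>)\<^sup>2" for s
      unfolding norm_divide norm_one norm_power using le[of s] pos[of s] assms by (intro divide_left_mono mult_pos_pos power_mono) auto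
    then show "AE s in M. cmod (1 / (complex_of_real (\<phi> s) - \<eta>)\<^sup>2) \<le> 1 / (Im \<eta>)\<^sup>2" by simp
  qed (use phi in measurable)
qed

lemma cauchy_transform_holomorphic:
  "(\<lambda>\<eta>. CLINT s|M. 1 / (complex_of_real (\<phi> s) - \<eta>)) holomorphic_on {\<eta>. Im \<eta> > 0}"
proof -
  interpret prob_space M by (rule M)
  have "((\<lambda>\<eta>. CLINT s|M. 1 / (complex_of_real (\<phi> s) - \<eta>)) has_field_derivative
      (CLINT s|M. 1 / (complex_of_real (\<phi> s) - \<eta>)\<^sup>2)) (at \<eta>)" if eta: "Im \<eta> > 0" for \<eta>
  proof (rule quadratic_error_derivative[where \<delta> = "Im \<eta> / 2" and C = "2 / (Im \<eta>) ^ 3"])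
    show "Im \<eta> / 2 > 0" using eta by simp
    fix y assume y: "cmod (y - \<eta>) < Im \<eta> / 2"
    have Imy: "Im y > Im \<eta> / 2" using y abs_Im_le_cmod[of "y - \<eta>"] by (simp add: abs_le_iff)
    then have Imy0: "Im y > 0" using eta by linarith
    note int = cauchy_kernel_integrable(1)[OF Imy0] cauchy_kernel_integrable[OF eta]
    \<comment> \<open>The remainder equals (y - \<eta>)^2 / (A B^2). On the disc of radius Im \<eta>
      / 2 the factors are at least Im \<eta> / 2 and Im \<eta>, uniformly in
      \<open>a\<close>.\<close>
    have pt: "cmod (1 / (complex_of_real a - y) - 1 / (complex_of_real a - \<eta>) - 1 / (complex_of_real a - \<eta>)\<^sup>2 * (y - \<eta>))
       \<le> 2 / (Im \<eta>) ^ 3 * (cmod (y - \<eta>))\<^sup>2" for a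
    proof -
      define A where "A = complex_of_real a - y"
      define B where "B = complex_of_real a - \<eta>"
      have A: "Im \<eta> / 2 \<le> cmod A" using Im_le_norm_diff[of y a] Imy by (simp add: A_def)
      have B: "Im \<eta> \<le> cmod B" using Im_le_norm_diff[of \<eta> a] eta by (simp add: B_def)
      have nz: "A \<noteq> 0" "B \<noteq> 0" using A B eta by auto
      have yd: "y - \<eta> = B - A" by (simp add: A_def B_def)
      have "1 / A - 1 / B - 1 / B\<^sup>2 * (y - \<eta>) = (y - \<eta>)\<^sup>2 / (A * B\<^sup>2)"
        unfolding yd using nz by (simp add: field_simps power2_eq_square)
      then have "cmod (1 / A - 1 / B - 1 / B\<^sup>2 * (y - \<eta>)) = (cmod (y - \<eta>))\<^sup>2 / (cmod A * (cmod B)\<^sup>2)"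
        by (simp add: norm_divide norm_mult norm_power)
      also have "\<dots> \<le> (cmod (y - \<eta>))\<^sup>2 / (Im \<eta> / 2 * (Im \<eta>)\<^sup>2)"
        using A B eta nz by (intro divide_left_mono mult_mono power_mono mult_pos_pos) auto
      also have "\<dots> = 2 / (Im \<eta>) ^ 3 * (cmod (y - \<eta>))\<^sup>2" by (simp add: power2_eq_square power3_eq_cube ac_simps)
      finally show ?thesis unfolding A_def B_def .
    qed
    have "(CLINT s|M. 1 / (complex_of_real (\<phi> s) - y)) - (CLINT s|M. 1 / (complex_of_real (\<phi> s) - \<eta>))
        - (CLINT s|M. 1 / (complex_of_real (\<phi> s) - \<eta>)\<^sup>2) * (y - \<eta>)
      = (CLINT s|M. 1 / (complex_of_real (\<phi> s) - y) - 1 / (complex_of_real (\<phi> s) - \<eta>) - 1 / (complex_of_real (\<phi> s) - \<eta>)\<^sup>2 * (y - \<eta>))"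
      by (subst Bochner_Integration.integral_diff Bochner_Integration.integral_mult_left; (intro Bochner_Integration.integrable_diff integrable_mult_left int)?)+ simp
    also have "cmod \<dots> \<le> (LINT s|M. 2 / (Im \<eta>) ^ 3 * (cmod (y - \<eta>))\<^sup>2)"
    proof (rule Bochner_Integration.integral_norm_bound_integral)
      show "complex_integrable M (\<lambda>s. 1 / (complex_of_real (\<phi> s) - y) - 1 / (complex_of_real (\<phi> s) - \<eta>) - 1 / (complex_of_real (\<phi> s) - \<eta>)\<^sup>2 * (y - \<eta>))"
        by (intro Bochner_Integration.integrable_diff integrable_mult_left int)
    qed (use pt in simp_all)
    also have "\<dots> = 2 / (Im \<eta>) ^ 3 * (cmod (y - \<eta>))\<^sup>2" by (simp add: prob_space)
    finally show "cmod ((CLINT s|M. 1 / (complex_of_real (\<phi> s) - y)) - (CLINT s|M. 1 / (complex_of_real (\<phi> s) - \<eta>))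
        - (CLINT s|M. 1 / (complex_of_real (\<phi> s) - \<eta>)\<^sup>2) * (y - \<eta>)) \<le> 2 / (Im \<eta>) ^ 3 * (cmod (y - \<eta>))\<^sup>2" .
  qed
  then show ?thesis
    unfolding holomorphic_on_def field_differentiable_def by (blast intro: has_field_derivative_at_within)
qed

lemma cauchy_transform_Im:
  assumes "Im \<eta> > 0"
  shows "Im (CLINT s|M. 1 / (complex_of_real (\<phi> s) - \<eta>)) = (LINT s|M. Im \<eta> / ((\<phi> s - Re \<eta>)\<^sup>2 + (Im \<eta>)\<^sup>2))"
    and "integrable M (\<lambda>s. Im \<eta> / ((\<phi> s - Re \<eta>)\<^sup>2 + (Im \<eta>)\<^sup>2))"
proof -
  have "Im (1 / (complex_of_real (\<phi> s) - \<eta>)) = Im \<eta> / ((\<phi> s - Re \<eta>)\<^sup>2 + (Im \<eta>)\<^sup>2)" for s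
    by (simp add: Im_divide)
  then show "Im (CLINT s|M. 1 / (complex_of_real (\<phi> s) - \<eta>)) = (LINT s|M. Im \<eta> / ((\<phi> s - Re \<eta>)\<^sup>2 + (Im \<eta>)\<^sup>2))"
    "integrable M (\<lambda>s. Im \<eta> / ((\<phi> s - Re \<eta>)\<^sup>2 + (Im \<eta>)\<^sup>2))"
    using integral_Im[OF cauchy_kernel_integrable(1)[OF assms]] integrable_Im[OF cauchy_kernel_integrable(1)[OF assms]] by simp_all
qed

end

text \<open>By partial fractions, m is minus the mean of the inverses of w - r and w + r, where w =
  \<eta> + m. With P the mean of their squared moduli, Im m = P Im w; since Im w exceeds Im m, this
  gives P < 1. Convexity of the square gives |m|^2 at most P.\<close>

lemma self_consistent_Im_le:
  fixes \<eta> m :: complex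
  assumes eta: "Im \<eta> > 0" and m: "Im m \<ge> 0" and eq: "m * ((\<eta> + m)\<^sup>2 - (of_real r)\<^sup>2) + (\<eta> + m) = 0"
  shows "Im m \<le> 1"
proof -
  define w where "w = \<eta> + m"
  define a where "a = w - of_real r"
  define b where "b = w + of_real r"
  have Imw: "Im w > 0" using eta m by (simp add: w_def)
  have ab: "a \<noteq> 0" "b \<noteq> 0" using Imw by (auto simp: a_def b_def complex_eq_iff)
  have "m * (a * b) + w = 0" using eq unfolding a_def b_def w_def by (simp add: power2_eq_square algebra_simps)
  moreover have "w = (a + b) / 2" by (simp add: a_def b_def)
  ultimately have mab: "m * (a * b) = - ((a + b) / 2)" by (simp add: eq_neg_iff_add_eq_0)
  have "m = (m * (a * b)) / (a * b)" using ab by simp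
  then have "m = - ((a + b) / 2) / (a * b)" unfolding mab .
  also have "\<dots> = - (1 / a + 1 / b) / 2" using ab by (simp add: field_simps)
  finally have meq: "m = - (1 / a + 1 / b) / 2" .
  define P where "P = (1 / (cmod a)\<^sup>2 + 1 / (cmod b)\<^sup>2) / 2"
  have Ima: "Im (1 / a) = - Im w / (cmod a)\<^sup>2" "Im (1 / b) = - Im w / (cmod b)\<^sup>2"
    by (simp_all add: Im_divide cmod_power2 a_def b_def)
  have "Im m = Im w * P" unfolding meq P_def by (simp add: Ima add_divide_distrib distrib_left)
  then have "Im w * P < Im w" using eta by (simp add: w_def)
  then have P1: "P < 1" using Imw by simp
  have "cmod m = cmod (1 / a + 1 / b) / 2"
    unfolding meq by (simp only: norm_divide norm_minus_cancel norm_numeral)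
  then have "cmod m \<le> (1 / cmod a + 1 / cmod b) / 2"
    using norm_triangle_ineq[of "1 / a" "1 / b"] by (simp add: norm_divide)
  then have "(cmod m)\<^sup>2 \<le> ((1 / cmod a + 1 / cmod b) / 2)\<^sup>2" by (intro power_mono) auto
  also have "\<dots> \<le> ((1 / cmod a)\<^sup>2 + (1 / cmod b)\<^sup>2) / 2"
    using sum_squares_bound[of "1 / cmod a" "1 / cmod b"] unfolding power_divide power2_sum by (simp add: algebra_simps)
  also have "\<dots> = P" by (simp add: P_def power_divide)
  finally have "(cmod m)\<^sup>2 \<le> 1\<^sup>2" using P1 by simp
  then have "cmod m \<le> 1" by (rule power2_le_imp_le) simp
  then show ?thesis using abs_Im_le_cmod[of m] by linarith
qed

locale stieltjes_law =
  fixes \<nu> :: "real measure" and r :: real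
  assumes nu: "half_line_prob \<nu>"
    and st: "\<And>t. t > 0 \<Longrightarrow> (LINT s|\<nu>. t / (s\<^sup>2 + t\<^sup>2)) = fixed_point r t - t"
begin

sublocale prob_space \<nu> using nu by (simp add: half_line_prob_def)

lemma sets_nu [measurable_cong, simp]: "sets \<nu> = sets borel" using nu by (simp add: half_line_prob_def)

lemma space_nu [simp]: "space \<nu> = UNIV" using sets_eq_imp_space_eq[OF sets_nu] by simp

text \<open>The Cauchy transform of the symmetrization of \<open>\<nu>\<close>.\<close>

definition cauchy :: "complex \<Rightarrow> complex" where
  "cauchy \<eta> = ((CLINT s|\<nu>. 1 / (complex_of_real s - \<eta>)) + (CLINT s|\<nu>. 1 / (complex_of_real (- s) - \<eta>))) / 2"

text \<open>At \<eta> = \<i> t the transform is \<i> (w - t), and the equation becomes the fixed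
  point equation for w. The positive imaginary axis has limit points inside the half plane, so the
  holomorphic left-hand side vanishes everywhere.\<close>

lemma cauchy_self_consistent:
  assumes "Im \<eta> > 0"
  shows "cauchy \<eta> * ((\<eta> + cauchy \<eta>)\<^sup>2 - (of_real r)\<^sup>2) + (\<eta> + cauchy \<eta>) = 0"
proof -
  define \<Phi> where "\<Phi> \<eta> = cauchy \<eta> * ((\<eta> + cauchy \<eta>)\<^sup>2 - (of_real r)\<^sup>2) + (\<eta> + cauchy \<eta>)" for \<eta>
  let ?S = "{\<eta>. Im \<eta> > 0}"
  let ?U = "(\<lambda>t. \<i> * complex_of_real t) ` {0<..}"
  have hol: "cauchy holomorphic_on ?S"
    unfolding cauchy_def
    by (intro holomorphic_intros cauchy_transform_holomorphic prob_space_axioms) auto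
  have holP: "\<Phi> holomorphic_on ?S" unfolding \<Phi>_def by (intro holomorphic_intros hol)
  have zero: "\<Phi> (\<i> * of_real t) = 0" if t: "t > 0" for t
  proof -
    define w where "w = fixed_point r t"
    have w: "w > 0" "w - w / (w\<^sup>2 + r\<^sup>2) = t" using fixed_point[OF t, of r] by (auto simp: w_def fixed_map_def)
    have I: "Im (\<i> * complex_of_real t) > 0" using t by simp
    have "cauchy (\<i> * of_real t) = (CLINT s|\<nu>. (1 / (complex_of_real s - \<i> * of_real t) + 1 / (complex_of_real (- s) - \<i> * of_real t)) / 2)"
      unfolding cauchy_def
      using cauchy_kernel_integrable(1)[OF prob_space_axioms _ I, of "\<lambda>s. s"] cauchy_kernel_integrable(1)[OF prob_space_axioms _ I, of uminus]
      by simp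
    also have "\<dots> = (CLINT s|\<nu>. \<i> * complex_of_real (t / (s\<^sup>2 + t\<^sup>2)))"
    proof (intro Bochner_Integration.integral_cong refl)
      fix s
      define A where "A = complex_of_real s - \<i> * of_real t"
      define B where "B = complex_of_real (- s) - \<i> * of_real t"
      have nz: "A \<noteq> 0" "B \<noteq> 0" using t by (auto simp: A_def B_def complex_eq_iff)
      have den: "complex_of_real (s\<^sup>2 + t\<^sup>2) = - (A * B)" by (simp add: A_def B_def algebra_simps power2_eq_square)
      have num: "A + B = - 2 * (\<i> * of_real t)" by (simp add: A_def B_def)
      have "(1 / A + 1 / B) / 2 = (A + B) / (A * B) / 2" using nz by (simp add: field_simps)
      also have "\<dots> = \<i> * complex_of_real (t / (s\<^sup>2 + t\<^sup>2))" unfolding num of_real_divide den by simp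
      finally show "(1 / (complex_of_real s - \<i> * of_real t) + 1 / (complex_of_real (- s) - \<i> * of_real t)) / 2 = \<i> * complex_of_real (t / (s\<^sup>2 + t\<^sup>2))"
        unfolding A_def B_def .
    qed
    also have "\<dots> = \<i> * of_real (w - t)" unfolding w_def st[OF t, symmetric] by (simp only: integral_mult_right_zero integral_complex_of_real)
    finally have c: "cauchy (\<i> * of_real t) = \<i> * of_real (w - t)" .
    have h: "w = (w - t) * (w\<^sup>2 + r\<^sup>2)"
    proof -
      have "w\<^sup>2 + r\<^sup>2 > 0" using w(1) by (intro add_pos_nonneg) auto
      moreover have "w - t = w / (w\<^sup>2 + r\<^sup>2)" using w(2) by simp
      ultimately show ?thesis by simp
    qed
    have "\<Phi> (\<i> * of_real t) = \<i> * (of_real w - of_real ((w - t) * (w\<^sup>2 + r\<^sup>2)))"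
      unfolding \<Phi>_def c by (simp add: algebra_simps power2_eq_square)
    then show ?thesis unfolding h[symmetric] by simp
  qed
  have "\<Phi> \<eta> = 0"
  proof (rule analytic_continuation[OF holP, of ?U \<i>])
    show "open ?S" by (rule open_halfspace_Im_gt)
    show "connected ?S" by (intro convex_connected convex_halfspace_Im_gt)
    show "\<i> islimpt ?U"
      unfolding islimpt_approachable
    proof (intro allI impI)
      fix e :: real assume "e > 0"
      then show "\<exists>x'\<in>?U. x' \<noteq> \<i> \<and> dist x' \<i> < e"
      proof (intro bexI[of _ "\<i> * complex_of_real (1 + e / 2)"] conjI)
        have "\<i> * complex_of_real (1 + e / 2) - \<i> = \<i> * complex_of_real (e / 2)" by (simp add: algebra_simps)
        then show "dist (\<i> * complex_of_real (1 + e / 2)) \<i> < e"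
          unfolding dist_norm using \<open>e > 0\<close> by (simp only: norm_mult norm_ii norm_of_real)
        show "\<i> * complex_of_real (1 + e / 2) \<noteq> \<i>" using \<open>e > 0\<close> by (simp add: complex_eq_iff)
        show "\<i> * complex_of_real (1 + e / 2) \<in> ?U" using \<open>e > 0\<close> by (intro imageI) simp
      qed
    qed
  qed (use assms zero in auto)
  then show ?thesis unfolding \<Phi>_def .
qed

text \<open>On the interval the Poisson kernel at height y is at least 1 / (2 y). Its \<nu>-integral
  is at most 2: it is one of two nonnegative halves of 2 Im (cauchy \<eta>), and that imaginary part
  is at most 1.\<close>

lemma measure_interval_le:
  assumes y: "y > 0"
  shows "measure \<nu> {x - y..x + y} \<le> 4 * y"
proof -
  define \<eta> where "\<eta> = Complex x y"
  have I: "Im \<eta> > 0" "Re \<eta> = x" "Im \<eta> = y" using y by (auto simp: \<eta>_def)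
  let ?k = "\<lambda>s. y / ((s - x)\<^sup>2 + y\<^sup>2)"
  note f1 = cauchy_transform_Im[OF prob_space_axioms _ I(1), of "\<lambda>s. s", unfolded I(2,3)]
  note f2 = cauchy_transform_Im[OF prob_space_axioms _ I(1), of "\<lambda>s. - s", unfolded I(2,3)]
  have i1: "integrable \<nu> ?k" using f1(2) by simp
  have n1: "0 \<le> (LINT s|\<nu>. ?k s)" using y by (intro integral_nonneg_AE) auto
  have n2: "0 \<le> (LINT s|\<nu>. y / ((- s - x)\<^sup>2 + y\<^sup>2))" using y by (intro integral_nonneg_AE) auto
  have Im: "Im (cauchy \<eta>) = ((LINT s|\<nu>. ?k s) + (LINT s|\<nu>. y / ((- s - x)\<^sup>2 + y\<^sup>2))) / 2"
    unfolding cauchy_def using f1(1) f2(1) by simp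
  then have "Im (cauchy \<eta>) \<ge> 0" using n1 n2 by simp
  from self_consistent_Im_le[OF I(1) this cauchy_self_consistent[OF I(1)]]
  have le2: "(LINT s|\<nu>. ?k s) \<le> 2" using Im n1 n2 by simp
  have "measure \<nu> {x - y..x + y} / (2 * y) = (LINT s|\<nu>. indicator {x - y..x + y} s / (2 * y))" by simp
  also have "\<dots> \<le> (LINT s|\<nu>. ?k s)"
  proof (rule integral_mono)
    show "integrable \<nu> (\<lambda>s. indicator {x - y..x + y} s / (2 * y) :: real)" by (intro integrable_divide integrable_real_indicator) (auto simp: less_top[symmetric])
    fix s
    show "indicator {x - y..x + y} s / (2 * y) \<le> ?k s"
    proof (cases "s \<in> {x - y..x + y}")
      case True
      then have "\<bar>s - x\<bar> \<le> \<bar>y\<bar>" using y by (auto simp: abs_le_iff)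
      then have "(s - x)\<^sup>2 \<le> y\<^sup>2" by (rule abs_le_square_iff[THEN iffD1])
      then have "y / (2 * y\<^sup>2) \<le> y / ((s - x)\<^sup>2 + y\<^sup>2)" using y by (intro divide_left_mono mult_pos_pos add_nonneg_pos) auto
      then show ?thesis using True y by (simp add: power2_eq_square)
    qed (use y in auto)
  qed (rule i1)
  finally have "measure \<nu> {x - y..x + y} / (2 * y) \<le> 2" using le2 by linarith
  then show ?thesis using y by (simp add: pos_divide_le_eq)
qed

section \<open>From the interval bound to Lebesgue null sets\<close>

lemma singleton_null: "measure \<nu> {x} = 0"
proof (rule ccontr)
  assume "measure \<nu> {x} \<noteq> 0"
  then have pos: "measure \<nu> {x} > 0" using measure_nonneg[of \<nu> "{x}"] by linarith
  define y where "y = measure \<nu> {x} / 8"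
  have y: "y > 0" using pos by (simp add: y_def)
  have "measure \<nu> {x} \<le> measure \<nu> {x - y..x + y}" using y by (intro finite_measure_mono) auto
  also have "\<dots> \<le> 4 * y" by (rule measure_interval_le[OF y])
  finally show False using pos by (simp add: y_def)
qed

lemma emeasure_box_le: "emeasure \<nu> (box c d) \<le> 2 * emeasure lborel (box c d)"
proof (cases "c < d")
  case True
  have "measure \<nu> {c<..<d} \<le> measure \<nu> {(c + d) / 2 - (d - c) / 2..(c + d) / 2 + (d - c) / 2}"
    by (intro finite_measure_mono) (auto simp: field_simps)
  also have "\<dots> \<le> 4 * ((d - c) / 2)" using True by (intro measure_interval_le) auto
  finally have "ennreal (measure \<nu> {c<..<d}) \<le> ennreal (2 * (d - c))" by (intro ennreal_leI) simp
  moreover have "2 * ennreal (d - c) = ennreal (2 * (d - c))" using ennreal_mult'[of 2 "d - c"] by simp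
  moreover have "emeasure lborel (box c d) = ennreal (d - c)" using True by (simp add: box_real)
  moreover have "emeasure \<nu> (box c d) = ennreal (measure \<nu> {c<..<d})" by (simp add: emeasure_eq_measure box_real)
  ultimately show ?thesis by simp
qed (simp add: box_real)

lemma countable_null: "countable C \<Longrightarrow> emeasure \<nu> C = 0"
proof -
  assume C: "countable C"
  have "(\<Union>x\<in>C. {x}) \<in> null_sets \<nu>"
    using C by (intro null_sets_UN') (auto simp: null_sets_def emeasure_eq_measure singleton_null)
  then show ?thesis by (simp add: null_sets_def)
qed

text \<open>The set is covered, inside an open set of small Lebesgue measure, by countably many
  intervals with disjoint interiors, so the bound for open intervals adds up. Their endpoints form a
  countable set, which is null because there are no atoms.\<close>

lemma null_bounded:
  assumes N: "N \<in> sets borel" "N \<subseteq> cbox a b" "box a b \<noteq> {}" and null: "emeasure lborel N = 0"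
  shows "emeasure \<nu> N = 0"
proof -
  have "emeasure \<nu> N \<le> 0 + ennreal e" if e: "e > 0" for e
  proof -
    obtain T where T: "open T" "N \<subseteq> T" "emeasure lborel (T - N) \<le> ennreal (e / 2)"
      using outer_regular_lborel_le[OF N(1), of "e / 2"] e by auto
    have Tm: "emeasure lborel T \<le> ennreal (e / 2)"
    proof -
      have "emeasure lborel T \<le> emeasure lborel ((T - N) \<union> N)" using T N by (intro emeasure_mono) auto
      also have "\<dots> \<le> emeasure lborel (T - N) + emeasure lborel N" using T N by (intro emeasure_subadditive) auto
      finally show ?thesis using T(3) null by simp
    qed
    \<comment> \<open>Each interval of the cover contains a point of \<open>N\<close> and lies in
      the gauge set at that point, hence in \<open>T\<close>.\<close>
    define g where "g x = (if x \<in> N then T else UNIV)" for x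
    have "gauge g" using T by (auto simp: gauge_def g_def)
    from covering_lemma[OF N(2,3) this] obtain D where D: "countable D"
      and box: "\<And>K. K \<in> D \<Longrightarrow> interior K \<noteq> {} \<and> (\<exists>c d. K = cbox c d)"
      and disj: "pairwise (\<lambda>A B. interior A \<inter> interior B = {}) D"
      and sub: "\<And>K. K \<in> D \<Longrightarrow> \<exists>x\<in>N \<inter> K. K \<subseteq> g x" and cover: "N \<subseteq> \<Union>D" by metis
    have KT: "K \<subseteq> T" if "K \<in> D" for K using sub[OF that] by (auto simp: g_def)
    define I where "I = (\<Union>K\<in>D. interior K)"
    define C where "C = (\<Union>K\<in>D. K - interior K)"
    have Cc: "countable C"
      unfolding C_def
    proof (intro countable_UN D)
      fix K assume "K \<in> D"
      then obtain c d where "K = cbox c d" using box by blast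
      then have "K - interior K \<subseteq> {c, d}" by (auto simp: interior_cbox box_real cbox_interval)
      then show "countable (K - interior K)" by (meson countable_finite finite.emptyI finite.insertI finite_subset)
    qed
    have Iset: "I \<in> sets borel" unfolding I_def by (intro borel_open open_UN) auto
    have Cs: "C \<in> sets borel" by (rule sets.countable[OF _ Cc]) simp
    have dj: "disjoint_family_on interior D" using disj by (auto simp: disjoint_family_on_def pairwise_def)
    have "emeasure \<nu> N \<le> emeasure \<nu> (I \<union> C)"
      using cover Iset Cs by (intro emeasure_mono) (auto simp: I_def C_def)
    also have "\<dots> \<le> emeasure \<nu> I + emeasure \<nu> C"
      using Iset Cs by (intro emeasure_subadditive) auto
    also have "emeasure \<nu> C = 0" by (rule countable_null[OF Cc])
    also have "emeasure \<nu> I = (\<integral>\<^sup>+K. emeasure \<nu> (interior K) \<partial>count_space D)"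
      unfolding I_def by (intro emeasure_UN_countable D dj) auto
    also have "\<dots> \<le> (\<integral>\<^sup>+K. 2 * emeasure lborel (interior K) \<partial>count_space D)"
    proof (intro nn_integral_mono)
      fix K assume "K \<in> space (count_space D)"
      then obtain c d where "K = cbox c d" using box unfolding space_count_space by blast
      then show "emeasure \<nu> (interior K) \<le> 2 * emeasure lborel (interior K)" by (simp only: interior_cbox emeasure_box_le)
    qed
    also have "\<dots> = 2 * (\<integral>\<^sup>+K. emeasure lborel (interior K) \<partial>count_space D)" by (intro nn_integral_cmult) auto
    also have "(\<integral>\<^sup>+K. emeasure lborel (interior K) \<partial>count_space D) = emeasure lborel I"
      unfolding I_def by (intro emeasure_UN_countable[symmetric] D dj) auto
    also have "emeasure lborel I \<le> emeasure lborel T"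
      using KT interior_subset T(1) by (intro emeasure_mono) (auto simp: I_def)
    also have "\<dots> \<le> ennreal (e / 2)" by (rule Tm)
    also have "2 * ennreal (e / 2) + 0 = ennreal e" using e by (simp add: ennreal_mult[symmetric] flip: ennreal_numeral)
    finally show ?thesis by (simp add: mult_left_mono)
  qed
  then show ?thesis by (metis ennreal_le_epsilon le_zero_eq)
qed

theorem absolutely_continuous: "absolutely_continuous lborel \<nu>"
  unfolding absolutely_continuous_def
proof
  fix N assume N: "N \<in> null_sets (lborel :: real measure)"
  then have Nb: "N \<in> sets borel" and N0: "emeasure lborel N = 0" by auto
  define Nk where "Nk k = N \<inter> cbox (- real (Suc k)) (real (Suc k))" for k
  have "emeasure \<nu> (Nk k) = 0" for k
  proof (rule null_bounded)
    show "Nk k \<in> sets borel" using Nb by (auto simp: Nk_def)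
    show "Nk k \<subseteq> cbox (- real (Suc k)) (real (Suc k))" by (auto simp: Nk_def)
    show "box (- real (Suc k)) (real (Suc k)) \<noteq> {}" by (simp add: box_real)
    have "emeasure lborel (Nk k) \<le> emeasure lborel N" using Nb by (intro emeasure_mono) (auto simp: Nk_def)
    then show "emeasure lborel (Nk k) = 0" using N0 by simp
  qed
  then have "(\<Union>k. Nk k) \<in> null_sets \<nu>" using Nb by (intro null_sets_UN) (auto simp: null_sets_def Nk_def)
  moreover have "N = (\<Union>k. Nk k)"
  proof -
    have "\<exists>k. x \<in> cbox (- real (Suc k)) (real (Suc k))" for x :: real
    proof -
      obtain k where "\<bar>x\<bar> \<le> real k" using real_arch_simple by blast
      then show ?thesis by (intro exI[of _ k]) (auto simp: cbox_interval abs_le_iff)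
    qed
    then show ?thesis by (auto simp: Nk_def)
  qed
  ultimately show "N \<in> null_sets \<nu>" by simp
qed

end

section \<open>The logarithmic integral\<close>

text \<open>The primitive of h in the variable v. Put h = v / (v^2 + r^2) and t = v - h; then h dt =
  h dv - h dh, which integrates to ln (v^2 + r^2) / 2 - h^2 / 2.\<close>

definition log_potential :: "real \<Rightarrow> real \<Rightarrow> real" where
  "log_potential r v = ln (v\<^sup>2 + r\<^sup>2) / 2 - (v / (v\<^sup>2 + r\<^sup>2))\<^sup>2 / 2"

text \<open>The value of v = t + h(t) in the limit t = 0: the largest zero of
  \<open>fixed_map r\<close> on the nonnegative axis. It is 0 outside the unit disc and satisfies
  v^2 + r^2 = 1 inside.\<close>

definition edge :: "real \<Rightarrow> real" where
  "edge r = (if r > 1 then 0 else sqrt (1 - r\<^sup>2))"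

lemma edge_nonneg: "r \<ge> 0 \<Longrightarrow> 0 \<le> edge r"
  by (auto simp: edge_def abs_square_le_1)

lemma edge_square:
  assumes "r \<ge> 0"
  shows "1 \<le> (edge r)\<^sup>2 + r\<^sup>2"
  using assms by (auto simp: edge_def abs_square_le_1 intro!: one_le_power)

lemma above_edge:
  assumes r: "r \<ge> 0" and v: "v > edge r"
  shows "v > 0" "v\<^sup>2 + r\<^sup>2 > 1" "fixed_map r v > 0"
proof -
  show v0: "v > 0" using edge_nonneg[OF r] v by linarith
  have "(edge r)\<^sup>2 < v\<^sup>2" using edge_nonneg[OF r] v by (intro power_strict_mono) auto
  then show g: "v\<^sup>2 + r\<^sup>2 > 1" using edge_square[OF r] by linarith
  have "fixed_map r v = v * (1 - 1 / (v\<^sup>2 + r\<^sup>2))" by (simp add: fixed_map_def algebra_simps)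
  also have "\<dots> > 0" using v0 g by (intro mult_pos_pos) auto
  finally show "fixed_map r v > 0" .
qed

lemma fixed_map_mono:
  assumes r: "r \<ge> 0" and u: "u > edge r" and v: "u \<le> v"
  shows "fixed_map r u \<le> fixed_map r v"
proof -
  have F: "fixed_map r v = v * (1 - 1 / (v\<^sup>2 + r\<^sup>2))" for v by (simp add: fixed_map_def algebra_simps)
  note au = above_edge[OF r u]
  have "u\<^sup>2 + r\<^sup>2 \<le> v\<^sup>2 + r\<^sup>2" using au v by (simp add: power_mono)
  then have "1 / (v\<^sup>2 + r\<^sup>2) \<le> 1 / (u\<^sup>2 + r\<^sup>2)" using au by (intro divide_left_mono mult_pos_pos) auto
  then show ?thesis unfolding F using au v by (intro mult_mono) auto
qed

text \<open>A second order Taylor bound uniform in s. With y = (u^2 - t^2) / (s^2 + t^2), the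
  logarithmic remainder gives y^2 and thus 9 / t^2, and the quadratic part of y gives 1 / t^2. The
  radius t / 8 keeps |y| below 1 / 2.\<close>

lemma log_square_expansion:
  fixes s t u :: real
  assumes t: "t > 0" and u: "\<bar>u - t\<bar> < t / 8"
  shows "\<bar>ln (s\<^sup>2 + u\<^sup>2) / 2 - ln (s\<^sup>2 + t\<^sup>2) / 2 - t / (s\<^sup>2 + t\<^sup>2) * (u - t)\<bar> \<le> (9 / t\<^sup>2 + 1 / t\<^sup>2) * (u - t)\<^sup>2"
proof -
  define D where "D = s\<^sup>2 + t\<^sup>2"
  define y where "y = (u\<^sup>2 - t\<^sup>2) / D"
  have u0: "u > 0" "u + t \<le> 3 * t" using t u unfolding abs_diff_less_iff by linarith+
  have D: "D > 0" "t\<^sup>2 \<le> D" using t by (auto simp: D_def intro: add_nonneg_pos)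
  have su: "s\<^sup>2 + u\<^sup>2 > 0" using u0 by (intro add_nonneg_pos) auto
  have "1 + y = (D + (u\<^sup>2 - t\<^sup>2)) / D" using D by (simp add: y_def add_divide_distrib)
  also have "D + (u\<^sup>2 - t\<^sup>2) = s\<^sup>2 + u\<^sup>2" by (simp add: D_def)
  finally have ln1: "ln (s\<^sup>2 + u\<^sup>2) - ln D = ln (1 + y)" using ln_divide_pos[OF su D(1)] by simp
  have ay: "\<bar>y\<bar> \<le> 3 * \<bar>u - t\<bar> / t"
  proof -
    have "u\<^sup>2 - t\<^sup>2 = (u - t) * (u + t)" by (simp add: power2_eq_square algebra_simps)
    then have "\<bar>u\<^sup>2 - t\<^sup>2\<bar> = \<bar>u - t\<bar> * (u + t)" using u0 t by (simp only: abs_mult)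
    then have "\<bar>y\<bar> = \<bar>u - t\<bar> * (u + t) / D" using D by (simp add: y_def abs_divide)
    also have "\<dots> \<le> \<bar>u - t\<bar> * (3 * t) / t\<^sup>2" using u0 D t by (intro frac_le mult_left_mono) auto
    finally show ?thesis using t by (simp add: power2_eq_square mult.commute)
  qed
  also have "\<dots> \<le> 3 * (t / 8) / t" using u t by (intro divide_right_mono mult_left_mono) auto
  finally have y2: "\<bar>y\<bar> \<le> 1 / 2" using t by simp
  have 1: "\<bar>ln (1 + y) - y\<bar> \<le> 2 * y\<^sup>2" by (rule abs_ln_one_plus_x_minus_x_bound[OF y2])
  have y3: "y\<^sup>2 \<le> 9 / t\<^sup>2 * (u - t)\<^sup>2"
  proof -
    have "\<bar>y\<bar>\<^sup>2 \<le> (3 * \<bar>u - t\<bar> / t)\<^sup>2" using ay by (intro power_mono) auto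
    then show ?thesis by (simp add: power_divide power_mult_distrib)
  qed
  have "y / 2 - t / D * (u - t) = (u - t)\<^sup>2 / (2 * D)" using D by (simp add: y_def field_simps power2_eq_square)
  also have "\<dots> \<le> (u - t)\<^sup>2 / t\<^sup>2" using D t by (intro frac_le) auto
  finally have 2: "y / 2 - t / D * (u - t) \<le> 1 / t\<^sup>2 * (u - t)\<^sup>2" by simp
  have 3: "0 \<le> y / 2 - t / D * (u - t)"
  proof -
    have "y / 2 - t / D * (u - t) = (u - t)\<^sup>2 / (2 * D)" using D by (simp add: y_def field_simps power2_eq_square)
    then show ?thesis using D by simp
  qed
  have eq: "ln (s\<^sup>2 + u\<^sup>2) / 2 - ln D / 2 - t / D * (u - t) = (ln (1 + y) - y) / 2 + (y / 2 - t / D * (u - t))"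
    using ln1 by (simp add: field_simps)
  have "\<bar>(ln (1 + y) - y) / 2 + (y / 2 - t / D * (u - t))\<bar> \<le> \<bar>(ln (1 + y) - y) / 2\<bar> + \<bar>y / 2 - t / D * (u - t)\<bar>" by (rule abs_triangle_ineq)
  also have "\<bar>(ln (1 + y) - y) / 2\<bar> = \<bar>ln (1 + y) - y\<bar> / 2" by simp
  also have "\<dots> \<le> y\<^sup>2" using 1 by simp
  also have "\<dots> \<le> 9 / t\<^sup>2 * (u - t)\<^sup>2" by (rule y3)
  also have "\<bar>y / 2 - t / D * (u - t)\<bar> \<le> 1 / t\<^sup>2 * (u - t)\<^sup>2" using 2 3 by linarith
  finally have "\<bar>(ln (1 + y) - y) / 2 + (y / 2 - t / D * (u - t))\<bar> \<le> 9 / t\<^sup>2 * (u - t)\<^sup>2 + 1 / t\<^sup>2 * (u - t)\<^sup>2" by simp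
  then show ?thesis unfolding eq[symmetric] unfolding D_def by (simp only: distrib_right)
qed

context stieltjes_law
begin

text \<open>Subtracting the value at t = 1 makes the integrand bounded by |ln t|, so the integral
  exists before anything is known about integrability of the logarithm.\<close>

definition log_energy :: "real \<Rightarrow> real" where
  "log_energy t = (LINT s|\<nu>. ln (s\<^sup>2 + t\<^sup>2) / 2 - ln (s\<^sup>2 + 1) / 2)"

lemma log_difference_integrable:
  assumes t: "t > 0"
  shows "integrable \<nu> (\<lambda>s. ln (s\<^sup>2 + t\<^sup>2) / 2 - ln (s\<^sup>2 + 1) / 2)"
proof (rule integrable_const_bound[of _ "\<bar>ln t\<bar>"])
  have "\<bar>ln (s\<^sup>2 + t\<^sup>2) / 2 - ln (s\<^sup>2 + 1) / 2\<bar> \<le> \<bar>ln t\<bar>" for s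
  proof -
    have p: "s\<^sup>2 + t\<^sup>2 > 0" "s\<^sup>2 + 1 > 0" using t by (auto intro: add_nonneg_pos)
    have pp: "t\<^sup>2 * (s\<^sup>2 + 1) > 0" using p t by simp
    have lt: "ln (t\<^sup>2) = 2 * ln t" using t by (simp add: ln_realpow)
    show ?thesis
    proof (cases "t \<ge> 1")
      case True
      then have t2: "t\<^sup>2 \<ge> 1" by (simp add: one_le_power)
      have "ln (s\<^sup>2 + 1) \<le> ln (s\<^sup>2 + t\<^sup>2)" using p t2 by simp
      moreover have "ln (s\<^sup>2 + t\<^sup>2) \<le> ln (t\<^sup>2 * (s\<^sup>2 + 1))"
        using p t t2 mult_right_mono[OF t2, of "s\<^sup>2"] by (subst ln_le_cancel_iff[OF p(1) pp]) (simp add: algebra_simps)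
      moreover have "ln (t\<^sup>2 * (s\<^sup>2 + 1)) = 2 * ln t + ln (s\<^sup>2 + 1)" using p t by (subst ln_mult_pos) (auto simp: lt)
      ultimately show ?thesis using True by (simp add: abs_le_iff)
    next
      case False
      then have t2: "t\<^sup>2 \<le> 1" using t by (simp add: power_le_one)
      have "ln (s\<^sup>2 + t\<^sup>2) \<le> ln (s\<^sup>2 + 1)" using p t2 by simp
      moreover have "ln (t\<^sup>2 * (s\<^sup>2 + 1)) \<le> ln (s\<^sup>2 + t\<^sup>2)"
        using p t t2 mult_right_mono[OF t2, of "s\<^sup>2"] by (subst ln_le_cancel_iff[OF pp p(1)]) (simp add: algebra_simps)
      moreover have "ln (t\<^sup>2 * (s\<^sup>2 + 1)) = 2 * ln t + ln (s\<^sup>2 + 1)" using p t by (subst ln_mult_pos) (auto simp: lt)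
      moreover have "ln t \<le> 0" using False t by simp
      ultimately show ?thesis by (simp add: abs_le_iff)
    qed
  qed
  then show "AE s in \<nu>. norm (ln (s\<^sup>2 + t\<^sup>2) / 2 - ln (s\<^sup>2 + 1) / 2) \<le> \<bar>ln t\<bar>" by simp
qed measurable

lemma stieltjes_integrable:
  assumes t: "t > 0"
  shows "integrable \<nu> (\<lambda>s. t / (s\<^sup>2 + t\<^sup>2))"
proof (rule integrable_const_bound[of _ "t / t\<^sup>2"])
  have "norm (t / (s\<^sup>2 + t\<^sup>2)) \<le> t / t\<^sup>2" for s
  proof -
    have "s\<^sup>2 + t\<^sup>2 > 0" using t by (intro add_nonneg_pos) auto
    then show ?thesis using t by (auto intro!: divide_left_mono)
  qed
  then show "AE s in \<nu>. norm (t / (s\<^sup>2 + t\<^sup>2)) \<le> t / t\<^sup>2" by simp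
qed measurable

lemma log_energy_derivative:
  assumes t: "t > 0"
  shows "(log_energy has_field_derivative (fixed_point r t - t)) (at t)"
proof (rule quadratic_error_derivative[where \<delta> = "t / 8" and C = "9 / t\<^sup>2 + 1 / t\<^sup>2"])
  show "t / 8 > 0" using t by simp
  fix u assume u: "norm (u - t) < t / 8"
  then have u': "\<bar>u - t\<bar> < t / 8" by simp
  then have u0: "u > 0" using t unfolding abs_diff_less_iff by linarith
  note i1 = log_difference_integrable[OF u0] and i2 = log_difference_integrable[OF t]
    and i3 = integrable_mult_left[OF stieltjes_integrable[OF t], of "u - t"]
  have pU: "prob UNIV = 1" using prob_space by simp
  have eq: "log_energy u - log_energy t - (fixed_point r t - t) * (u - t)
    = (LINT s|\<nu>. (ln (s\<^sup>2 + u\<^sup>2) / 2 - ln (s\<^sup>2 + 1) / 2) - (ln (s\<^sup>2 + t\<^sup>2) / 2 - ln (s\<^sup>2 + 1) / 2) - t / (s\<^sup>2 + t\<^sup>2) * (u - t))"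
    unfolding log_energy_def st[OF t, symmetric] Bochner_Integration.integral_diff[OF Bochner_Integration.integrable_diff[OF i1 i2] i3]
      Bochner_Integration.integral_diff[OF i1 i2] integral_mult_left_zero ..
  have "norm (LINT s|\<nu>. (ln (s\<^sup>2 + u\<^sup>2) / 2 - ln (s\<^sup>2 + 1) / 2) - (ln (s\<^sup>2 + t\<^sup>2) / 2 - ln (s\<^sup>2 + 1) / 2) - t / (s\<^sup>2 + t\<^sup>2) * (u - t))
     \<le> (LINT s|\<nu>. (9 / t\<^sup>2 + 1 / t\<^sup>2) * (u - t)\<^sup>2)"
  proof (rule Bochner_Integration.integral_norm_bound_integral)
    show "integrable \<nu> (\<lambda>s. (ln (s\<^sup>2 + u\<^sup>2) / 2 - ln (s\<^sup>2 + 1) / 2) - (ln (s\<^sup>2 + t\<^sup>2) / 2 - ln (s\<^sup>2 + 1) / 2) - t / (s\<^sup>2 + t\<^sup>2) * (u - t))"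
      by (intro Bochner_Integration.integrable_diff integrable_mult_left log_difference_integrable stieltjes_integrable u0 t)
    show "norm ((ln (s\<^sup>2 + u\<^sup>2) / 2 - ln (s\<^sup>2 + 1) / 2) - (ln (s\<^sup>2 + t\<^sup>2) / 2 - ln (s\<^sup>2 + 1) / 2) - t / (s\<^sup>2 + t\<^sup>2) * (u - t)) \<le> (9 / t\<^sup>2 + 1 / t\<^sup>2) * (u - t)\<^sup>2" for s
      using log_square_expansion[OF t u', of s] by simp
  qed simp
  also have "\<dots> = (9 / t\<^sup>2 + 1 / t\<^sup>2) * (norm (u - t))\<^sup>2" by (simp add: pU)
  finally show "norm (log_energy u - log_energy t - (fixed_point r t - t) * (u - t)) \<le> (9 / t\<^sup>2 + 1 / t\<^sup>2) * (norm (u - t))\<^sup>2"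
    unfolding eq .
qed

text \<open>Parametrizing \<open>t\<close> by \<open>v = t + h(t)\<close> makes the primitive of \<open>h\<close> explicit.\<close>

lemma log_energy_log_potential:
  assumes r: "r \<ge> 0"
  shows "\<exists>c. \<forall>v>edge r. log_energy (fixed_map r v) = log_potential r v + c"
proof -
  have "((\<lambda>v. log_energy (fixed_map r v) - log_potential r v) has_field_derivative 0) (at v)" if v: "v > edge r" for v
  proof -
    note av = above_edge[OF r v]
    define R where "R = v\<^sup>2 + r\<^sup>2"
    have R: "R > 0" using av by (simp add: R_def)
    define q where "q = v / R"
    define q' where "q' = (R - v * (2 * v)) / (R * R)"
    have dR: "((\<lambda>v. v\<^sup>2 + r\<^sup>2) has_field_derivative 2 * v) (at v)" by (auto intro!: derivative_eq_intros)
    have dq: "((\<lambda>v. v / (v\<^sup>2 + r\<^sup>2)) has_field_derivative q') (at v)"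
      unfolding q'_def R_def by (rule derivative_eq_intros dR refl)+ (use R in \<open>auto simp: R_def\<close>)
    have dF: "(fixed_map r has_field_derivative (1 - q')) (at v)"
      unfolding fixed_map_def by (intro DERIV_diff DERIV_ident dq)
    have fp: "fixed_point r (fixed_map r v) = v" by (rule fixed_point_unique[OF av(3,1) refl])
    have "(log_energy has_field_derivative (v - fixed_map r v)) (at (fixed_map r v))" using log_energy_derivative[OF av(3)] unfolding fp .
    then have dV: "((\<lambda>v. log_energy (fixed_map r v)) has_field_derivative (v - fixed_map r v) * (1 - q')) (at v)"
      by (rule DERIV_chain2[OF _ dF])
    have dl: "((\<lambda>v. ln (v\<^sup>2 + r\<^sup>2) / 2) has_field_derivative q) (at v)"
    proof -
      have "((\<lambda>v. ln (v\<^sup>2 + r\<^sup>2)) has_field_derivative (1 / R * (2 * v))) (at v)"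
        using DERIV_ln_divide[OF R] dR unfolding R_def by (rule DERIV_chain2)
      from DERIV_cdivide[OF this, of 2] show ?thesis by (simp add: q_def)
    qed
    have dp: "((\<lambda>v. (v / (v\<^sup>2 + r\<^sup>2))\<^sup>2 / 2) has_field_derivative q * q') (at v)"
    proof -
      have "of_nat 2 * (d * y ^ (2 - Suc 0)) / 2 = y * d" for y d :: real by simp
      from DERIV_cong[OF DERIV_cdivide[OF DERIV_power[OF dq, of 2], of 2] this] show ?thesis unfolding q_def R_def .
    qed
    have "(log_potential r has_field_derivative (q - q * q')) (at v)"
      unfolding log_potential_def by (intro DERIV_diff dl dp)
    moreover have vq: "v - fixed_map r v = q" by (simp add: fixed_map_def q_def R_def)
    ultimately show ?thesis by (intro DERIV_cong[OF DERIV_diff[OF dV[unfolded vq]]]) (auto simp: algebra_simps)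
  qed
  then have "\<exists>c. \<forall>v\<in>{edge r<..}. log_energy (fixed_map r v) - log_potential r v = c"
    by (intro has_field_derivative_zero_constant) (auto intro: has_field_derivative_at_within)
  then obtain c where "\<forall>v\<in>{edge r<..}. log_energy (fixed_map r v) - log_potential r v = c" by blast
  then have "\<forall>v>edge r. log_energy (fixed_map r v) = log_potential r v + c" by (auto simp: algebra_simps)
  then show ?thesis by blast
qed

text \<open>The logarithm is approached through ln (s^2 + t^2) / 2, whose limit for t tending to 0
  has to be taken at s > 0; hence the origin must carry no mass.\<close>

lemma nu_pos: "AE s in \<nu>. s > 0"
proof -
  have "AE s in \<nu>. s \<ge> 0" by (rule half_line_prob_AE[OF nu]) simp
  moreover have "AE s in \<nu>. s \<notin> {0}"
    by (rule AE_not_in) (simp add: null_sets_def emeasure_eq_measure singleton_null)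
  ultimately show ?thesis by eventually_elim auto
qed

text \<open>Two monotone limits. Letting t tend to infinity determines the unknown constant
  \<open>c\<close> and shows that ln (s^2 + 1) / 2 is integrable; letting t tend to 0 gives the
  integral of ln (s^2 + 1) / 2 - ln s. In the difference \<open>c\<close> cancels.\<close>

theorem log_integral:
  assumes r: "r \<ge> 0"
  shows "integrable \<nu> ln" "(LINT s|\<nu>. ln s) = log_potential r (edge r)"
proof -
  obtain c where c: "\<And>v. v > edge r \<Longrightarrow> log_energy (fixed_map r v) = log_potential r v + c" using log_energy_log_potential[OF r] by blast
  define v where "v n = edge r + 1 + real n" for n
  define T where "T n = fixed_map r (v n)" for n
  have vn: "v n > edge r" for n by (simp add: v_def)
  have T0: "T n > 0" for n unfolding T_def by (rule above_edge(3)[OF r vn])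
  have Tmono: "T m \<le> T n" if "m \<le> n" for m n unfolding T_def by (rule fixed_map_mono[OF r vn]) (use that in \<open>simp add: v_def\<close>)
  have Tinf: "filterlim T at_top sequentially" unfolding T_def v_def fixed_map_def by real_asymp
  \<comment> \<open>Up to sign and the constant ln (T n) this is the integrand of
    \<open>log_energy\<close> at \<open>T n\<close>, arranged to increase to ln (s^2 + 1) /
    2.\<close>
  define f where "f n s = ln (s\<^sup>2 + 1) / 2 - ln (s\<^sup>2 / (T n)\<^sup>2 + 1) / 2" for n s
  have f_eq: "f n s = ln (T n) - (ln (s\<^sup>2 + (T n)\<^sup>2) / 2 - ln (s\<^sup>2 + 1) / 2)" for n s
  proof -
    have T2: "(T n)\<^sup>2 > 0" using T0[of n] by simp
    have "s\<^sup>2 / (T n)\<^sup>2 + 1 = (s\<^sup>2 + (T n)\<^sup>2) / (T n)\<^sup>2" using T2 by (simp add: field_simps)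
    moreover have "s\<^sup>2 + (T n)\<^sup>2 > 0" using T2 by (intro add_nonneg_pos) auto
    ultimately have "ln (s\<^sup>2 / (T n)\<^sup>2 + 1) = ln (s\<^sup>2 + (T n)\<^sup>2) - 2 * ln (T n)"
      using T2 T0[of n] by (simp add: ln_div ln_realpow)
    then show ?thesis by (simp add: f_def diff_divide_distrib)
  qed
  have f_int: "integrable \<nu> (f n)" for n
    unfolding f_eq using log_difference_integrable[OF T0[of n]] by simp
  have pU: "prob UNIV = 1" using prob_space by simp
  have f_val: "(LINT s|\<nu>. f n s) = ln (T n) - log_potential r (v n) - c" for n
    unfolding f_eq using log_difference_integrable[OF T0[of n]] c[OF vn[of n]] by (simp add: pU log_energy_def[symmetric] T_def[symmetric])
  have pos1: "0 < s\<^sup>2 / (T n)\<^sup>2 + 1" for s n by (intro add_nonneg_pos) auto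
  have f_mono: "mono (\<lambda>n. f n s)" for s
  proof (rule monoI)
    fix m n :: nat assume mn: "m \<le> n"
    have "s\<^sup>2 / (T n)\<^sup>2 \<le> s\<^sup>2 / (T m)\<^sup>2"
      using T0[of m] T0[of n] Tmono[OF mn] by (intro divide_left_mono power_mono mult_pos_pos) auto
    then have "ln (s\<^sup>2 / (T n)\<^sup>2 + 1) \<le> ln (s\<^sup>2 / (T m)\<^sup>2 + 1)"
      by (subst ln_le_cancel_iff[OF pos1 pos1]) simp
    then show "f m s \<le> f n s" by (simp add: f_def)
  qed
  have f_lim: "(\<lambda>n. f n s) \<longlonglongrightarrow> ln (s\<^sup>2 + 1) / 2" for s
  proof -
    have "(\<lambda>n. s\<^sup>2 / (T n)\<^sup>2) \<longlonglongrightarrow> 0"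
      by (rule real_tendsto_divide_at_top[OF tendsto_const filterlim_pow_at_top[OF _ Tinf]]) simp
    then have "(\<lambda>n. f n s) \<longlonglongrightarrow> ln (s\<^sup>2 + 1) / 2 - ln (0 + 1) / 2"
      unfolding f_def by (intro tendsto_intros) auto
    then show ?thesis by simp
  qed
  \<comment> \<open>For large v both ln t and \<open>log_potential r v\<close> are ln v + o(1), so
    the limit of the integrals is exactly - c.\<close>
  have lim0: "(\<lambda>n. ln (T n) - log_potential r (v n)) \<longlonglongrightarrow> 0"
    unfolding T_def v_def fixed_map_def log_potential_def by real_asymp
  have f_ilim: "(\<lambda>n. LINT s|\<nu>. f n s) \<longlonglongrightarrow> - c"
    using tendsto_diff[OF lim0 tendsto_const[of c]] unfolding f_val by simp
  have I1: "integrable \<nu> (\<lambda>s. ln (s\<^sup>2 + 1) / 2)" "(LINT s|\<nu>. ln (s\<^sup>2 + 1) / 2) = - c"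
    using integrable_monotone_convergence[of \<nu> f "\<lambda>s. ln (s\<^sup>2 + 1) / 2" "- c", OF f_int _ _ f_ilim]
      integral_monotone_convergence[of \<nu> f "\<lambda>s. ln (s\<^sup>2 + 1) / 2" "- c", OF f_int _ _ f_ilim] f_mono f_lim by auto
  \<comment> \<open>Decreasing to the edge, so that the corresponding \<open>t n\<close> decrease to
    0.\<close>
  define u where "u n = edge r + 1 / (1 + real n)" for n
  define t where "t n = fixed_map r (u n)" for n
  have un: "u n > edge r" for n by (simp add: u_def)
  have t0: "t n > 0" for n unfolding t_def by (rule above_edge(3)[OF r un])
  have tmono: "t n \<le> t m" if "m \<le> n" for m n
    unfolding t_def by (rule fixed_map_mono[OF r un]) (use that in \<open>simp add: u_def field_simps\<close>)
  define g where "g n s = - (ln (s\<^sup>2 + (t n)\<^sup>2) / 2 - ln (s\<^sup>2 + 1) / 2)" for n s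
  have g_int: "integrable \<nu> (g n)" for n
    unfolding g_def by (intro integrable_minus log_difference_integrable t0)
  have g_val: "(LINT s|\<nu>. g n s) = - log_potential r (u n) - c" for n
    unfolding g_def integral_minus log_energy_def[symmetric] using c[OF un[of n]] by (simp add: t_def)
  have g_mono: "mono (\<lambda>n. g n s)" for s
  proof (rule monoI)
    fix m n :: nat assume mn: "m \<le> n"
    have p: "s\<^sup>2 + (t n)\<^sup>2 > 0" "s\<^sup>2 + (t m)\<^sup>2 > 0" using t0[of n] t0[of m] by (auto intro: add_nonneg_pos)
    have "(t n)\<^sup>2 \<le> (t m)\<^sup>2" using tmono[OF mn] t0[of n] by (intro power_mono) auto
    then have "ln (s\<^sup>2 + (t n)\<^sup>2) \<le> ln (s\<^sup>2 + (t m)\<^sup>2)" using p by (subst ln_le_cancel_iff) auto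
    then show "g m s \<le> g n s" by (simp add: g_def)
  qed
  have ulim: "u \<longlonglongrightarrow> edge r" unfolding u_def by real_asymp
  have e1: "(edge r)\<^sup>2 + r\<^sup>2 > 0" using edge_square[OF r] by linarith
  have F0: "fixed_map r (edge r) = 0"
  proof (cases "r > 1")
    case False
    then have "(edge r)\<^sup>2 + r\<^sup>2 = 1" using r by (simp add: edge_def abs_square_le_1)
    then show ?thesis by (simp add: fixed_map_def)
  qed (simp add: edge_def fixed_map_def)
  have "t \<longlonglongrightarrow> fixed_map r (edge r)"
    unfolding t_def fixed_map_def by (intro tendsto_intros ulim) (use e1 in linarith)
  then have tlim: "t \<longlonglongrightarrow> 0" unfolding F0 .
  have g_lim: "AE s in \<nu>. (\<lambda>n. g n s) \<longlonglongrightarrow> ln (s\<^sup>2 + 1) / 2 - ln s"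
    using nu_pos
  proof eventually_elim
    fix s :: real assume s: "s > 0"
    have "(\<lambda>n. g n s) \<longlonglongrightarrow> - (ln (s\<^sup>2 + 0\<^sup>2) / 2 - ln (s\<^sup>2 + 1) / 2)"
      unfolding g_def using s by (intro tendsto_intros tlim) auto
    then show "(\<lambda>n. g n s) \<longlonglongrightarrow> ln (s\<^sup>2 + 1) / 2 - ln s" using s by (simp add: ln_realpow)
  qed
  have "(\<lambda>n. log_potential r (u n)) \<longlonglongrightarrow> log_potential r (edge r)"
    unfolding log_potential_def by (intro tendsto_intros ulim) (use e1 in linarith)+
  then have g_ilim: "(\<lambda>n. LINT s|\<nu>. g n s) \<longlonglongrightarrow> - log_potential r (edge r) - c"
    unfolding g_val by (intro tendsto_intros)
  have I2: "integrable \<nu> (\<lambda>s. ln (s\<^sup>2 + 1) / 2 - ln s)" "(LINT s|\<nu>. ln (s\<^sup>2 + 1) / 2 - ln s) = - log_potential r (edge r) - c"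
    using integrable_monotone_convergence[of \<nu> g "\<lambda>s. ln (s\<^sup>2 + 1) / 2 - ln s", OF g_int _ g_lim g_ilim]
      integral_monotone_convergence[of \<nu> g "\<lambda>s. ln (s\<^sup>2 + 1) / 2 - ln s", OF g_int _ g_lim g_ilim] g_mono by auto
  have eq: "ln = (\<lambda>s :: real. ln (s\<^sup>2 + 1) / 2 - (ln (s\<^sup>2 + 1) / 2 - ln s))" by auto
  show "integrable \<nu> ln" by (subst eq) (intro Bochner_Integration.integrable_diff I1 I2)
  show "(LINT s|\<nu>. ln s) = log_potential r (edge r)"
    using Bochner_Integration.integral_diff[OF I1(1) I2(1)] I1(2) I2(2) by simp
qed

end

section \<open>The quarter circle law\<close>

definition quarter_circle :: "real measure" where
  "quarter_circle = density lborel (\<lambda>x. ennreal (1 / pi * sqrt (4 - x\<^sup>2) * indicator {0..2} x))"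

lemma quarter_circle_density_nonneg: "0 \<le> 1 / pi * sqrt (4 - x\<^sup>2) * indicator {0..2} (x :: real)"
proof (cases "x \<in> {0..2}")
  case True
  then have "x\<^sup>2 \<le> 2\<^sup>2" by (intro power_mono) auto
  then show ?thesis by simp
qed simp

text \<open>Transfers a gauge integral over the interval, computed by the fundamental theorem of
  calculus, to an integral against the density.\<close>

lemma integral_quarter_circle:
  fixes f :: "real \<Rightarrow> real"
  assumes f: "f \<in> borel_measurable borel" and cont: "continuous_on {0..2} f"
    and I: "((\<lambda>s. 1 / pi * sqrt (4 - s\<^sup>2) * f s) has_integral I) {0..2}"
  shows "(LINT s|quarter_circle. f s) = I" "integrable lborel (\<lambda>s. 1 / pi * sqrt (4 - s\<^sup>2) * indicator {0..2} s * f s)"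
proof -
  let ?h = "\<lambda>s. 1 / pi * sqrt (4 - s\<^sup>2) * f s"
  have "set_integrable lborel {0..2} ?h"
    by (rule borel_integrable_atLeastAtMost') (intro continuous_intros cont)
  then have si: "set_integrable lborel {0..2} ?h" .
  have eq: "(\<lambda>s. 1 / pi * sqrt (4 - s\<^sup>2) * indicator {0..2} s * f s) = (\<lambda>s. indicator {0..2} s *\<^sub>R ?h s)"
    by (auto simp: indicator_def)
  show "integrable lborel (\<lambda>s. 1 / pi * sqrt (4 - s\<^sup>2) * indicator {0..2} s * f s)"
    unfolding eq using si unfolding set_integrable_def .
  have "(LINT s|quarter_circle. f s) = (LINT s|lborel. (1 / pi * sqrt (4 - s\<^sup>2) * indicator {0..2} s) *\<^sub>R f s)"
    unfolding quarter_circle_def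
    by (rule integral_density) (use f quarter_circle_density_nonneg in \<open>auto intro!: AE_I2\<close>)
  also have "\<dots> = (LINT s|lborel. indicator {0..2} s *\<^sub>R ?h s)" using eq by (simp only: real_scaleR_def)
  also have "\<dots> = (LINT s:{0..2}|lborel. ?h s)" by (simp only: set_lebesgue_integral_def)
  also have "\<dots> = integral {0..2} ?h" by (rule set_borel_integral_eq_integral(2)[OF si])
  also have "\<dots> = I" using I by (rule integral_unique)
  finally show "(LINT s|quarter_circle. f s) = I" .
qed

lemma has_integral_quarter_circle:
  "((\<lambda>s. 1 / pi * sqrt (4 - s\<^sup>2) * 1) has_integral 1) {0..2}"
proof -
  \<comment> \<open>The classical primitive of sqrt (4 - s^2): area of a triangle plus area of a
    circular sector.\<close>
  define F where "F s = 1 / pi * (s * sqrt (4 - s\<^sup>2) / 2 + 2 * arcsin (s / 2))" for s :: real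
  have "((\<lambda>s. 1 / pi * sqrt (4 - s\<^sup>2) * 1) has_integral (F 2 - F 0)) {0..2}"
  proof (rule fundamental_theorem_of_calculus_interior)
    show "continuous_on {0..2} F" unfolding F_def by (intro continuous_intros) auto
    fix s :: real assume s: "s \<in> {0<..<2}"
    then have "s\<^sup>2 < 2\<^sup>2" by (intro power_strict_mono) auto
    then have p: "4 - s\<^sup>2 > 0" by simp
    define q where "q = sqrt (4 - s\<^sup>2)"
    have q: "q > 0" "q\<^sup>2 = 4 - s\<^sup>2" using p by (auto simp: q_def)
    have q2: "sqrt (1 - (s / 2)\<^sup>2) = q / 2"
    proof -
      have "1 - (s / 2)\<^sup>2 = (q / 2)\<^sup>2" by (simp add: power_divide q(2) field_simps)
      then show ?thesis using q by simp
    qed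
    have dq: "((\<lambda>s. sqrt (4 - s\<^sup>2)) has_real_derivative (- 2 * s / (2 * q))) (at s)"
    proof -
      have "((\<lambda>s :: real. 4 - s\<^sup>2) has_real_derivative (- 2 * s)) (at s)" by (auto intro!: derivative_eq_intros)
      from DERIV_chain2[where f = sqrt and g = "\<lambda>s. 4 - s\<^sup>2" and x = s, OF DERIV_real_sqrt[OF p] this]
      show ?thesis by (rule DERIV_cong) (simp add: q_def field_simps)
    qed
    have da: "((\<lambda>s. arcsin (s / 2)) has_real_derivative inverse (q / 2) * (1 / 2)) (at s)"
    proof -
      have "((\<lambda>s :: real. s / 2) has_real_derivative 1 / 2) (at s)" by (auto intro!: derivative_eq_intros)
      from DERIV_chain2[where f = arcsin and g = "\<lambda>s. s / 2" and x = s, OF DERIV_arcsin[of "s / 2"] this] s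
      show ?thesis unfolding q2 by auto
    qed
    have dm: "((\<lambda>s. s * sqrt (4 - s\<^sup>2)) has_real_derivative (1 * q + s * (- 2 * s / (2 * q)))) (at s)"
      by (rule DERIV_cong[OF DERIV_mult[OF DERIV_ident dq]]) (simp add: q_def)
    have "(F has_real_derivative 1 / pi * ((1 * q + s * (- 2 * s / (2 * q))) / 2 + 2 * (inverse (q / 2) * (1 / 2)))) (at s)"
      unfolding F_def by (intro DERIV_cmult DERIV_add DERIV_cdivide dm da)
    moreover have "(1 * q + s * (- 2 * s / (2 * q))) / 2 + 2 * (inverse (q / 2) * (1 / 2)) = q"
    proof -
      have "(1 * q + s * (- 2 * s / (2 * q))) / 2 + 2 * (inverse (q / 2) * (1 / 2)) = (q\<^sup>2 - s\<^sup>2 + 4) / (2 * q)"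
        using q(1) by (simp add: field_simps power2_eq_square)
      also have "\<dots> = (2 * q\<^sup>2) / (2 * q)" using q(2) by simp
      finally show ?thesis using q(1) by (simp add: power2_eq_square)
    qed
    ultimately show "(F has_vector_derivative 1 / pi * sqrt (4 - s\<^sup>2) * 1) (at s)"
      unfolding has_real_derivative_iff_has_vector_derivative[symmetric] q_def by simp
  qed simp
  then show ?thesis by (simp add: F_def)
qed

text \<open>With q^2 = 4 - s^2, D^2 = s^2 + t^2 and c^2 = t^2 + 4 one has c^2 - D^2 = q^2, so the
  integrand q t / D^2 splits as c^2 t / (q D^2) - t / q. Both parts integrate to arcsines, the first
  with argument \<open>A s\<close>. At s = 2 both arguments equal 1.\<close>

lemma has_integral_quarter_circle_stieltjes:
  assumes t: "t > 0"
  shows "((\<lambda>s. 1 / pi * sqrt (4 - s\<^sup>2) * (t / (s\<^sup>2 + t\<^sup>2))) has_integral (sqrt (t\<^sup>2 + 4) - t) / 2) {0..2}"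
proof -
  define c where "c = sqrt (t\<^sup>2 + 4)"
  have c: "c > 0" "c\<^sup>2 = t\<^sup>2 + 4" by (auto simp: c_def add_nonneg_pos)
  define A where "A s = c * s / (2 * sqrt (s\<^sup>2 + t\<^sup>2))" for s
  define F where "F s = 1 / pi * (c * arcsin (A s) - t * arcsin (s / 2))" for s :: real
  have pos: "s\<^sup>2 + t\<^sup>2 > 0" for s using t by (intro add_nonneg_pos) auto
  have Asq: "1 - (A s)\<^sup>2 = t\<^sup>2 * (4 - s\<^sup>2) / (4 * (s\<^sup>2 + t\<^sup>2))" for s
  proof -
    have "(A s)\<^sup>2 = (t\<^sup>2 + 4) * s\<^sup>2 / (4 * (s\<^sup>2 + t\<^sup>2))"
      using pos[of s] by (simp add: A_def power_divide power_mult_distrib c(2))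
    then have "1 - (A s)\<^sup>2 = (4 * (s\<^sup>2 + t\<^sup>2) - (t\<^sup>2 + 4) * s\<^sup>2) / (4 * (s\<^sup>2 + t\<^sup>2))"
      using pos[of s] by (simp add: diff_divide_distrib)
    then show ?thesis by (simp add: algebra_simps)
  qed
  have Ale: "\<bar>A s\<bar> \<le> 1" if "s \<in> {0..2}" for s
  proof -
    have "s\<^sup>2 \<le> 2\<^sup>2" using that by (intro power_mono) auto
    then have "0 \<le> 1 - (A s)\<^sup>2" unfolding Asq using pos[of s] by (intro divide_nonneg_nonneg mult_nonneg_nonneg) auto
    then show ?thesis by (simp add: abs_square_le_1)
  qed
  have "((\<lambda>s. 1 / pi * sqrt (4 - s\<^sup>2) * (t / (s\<^sup>2 + t\<^sup>2))) has_integral (F 2 - F 0)) {0..2}"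
  proof (rule fundamental_theorem_of_calculus_interior)
    have contA: "continuous_on {0..2} A" unfolding A_def
      by (intro continuous_intros) (use pos in \<open>auto simp: less_le\<close>)
    show "continuous_on {0..2} F" unfolding F_def
      by (intro continuous_intros contA) (use Ale in \<open>auto simp: abs_le_iff\<close>)
    fix s :: real assume s: "s \<in> {0<..<2}"
    then have "s\<^sup>2 < 2\<^sup>2" by (intro power_strict_mono) auto
    then have p: "4 - s\<^sup>2 > 0" by simp
    define q where "q = sqrt (4 - s\<^sup>2)"
    define D where "D = sqrt (s\<^sup>2 + t\<^sup>2)"
    have q: "q > 0" "q\<^sup>2 = 4 - s\<^sup>2" using p by (auto simp: q_def)
    have D: "D > 0" "D\<^sup>2 = s\<^sup>2 + t\<^sup>2" using pos[of s] by (auto simp: D_def)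
    have q2: "sqrt (1 - (s / 2)\<^sup>2) = q / 2"
    proof -
      have "1 - (s / 2)\<^sup>2 = (q / 2)\<^sup>2" by (simp add: power_divide q(2) field_simps)
      then show ?thesis using q by simp
    qed
    have qA: "sqrt (1 - (A s)\<^sup>2) = t * q / (2 * D)"
    proof -
      have "1 - (A s)\<^sup>2 = (t * q / (2 * D))\<^sup>2" unfolding Asq by (simp add: power_divide power_mult_distrib q(2) D(2))
      then show ?thesis using q D t by simp
    qed
    have A1: "- 1 < A s" "A s < 1"
    proof -
      have "0 < 1 - (A s)\<^sup>2" unfolding Asq using p pos[of s] t by (intro divide_pos_pos mult_pos_pos) auto
      then have "\<bar>A s\<bar> < 1" by (simp add: abs_square_less_1)
      then show "- 1 < A s" "A s < 1" by (auto simp: abs_less_iff)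
    qed
    have dD: "((\<lambda>s. sqrt (s\<^sup>2 + t\<^sup>2)) has_real_derivative s / D) (at s)"
    proof -
      have "((\<lambda>s :: real. s\<^sup>2 + t\<^sup>2) has_real_derivative (2 * s)) (at s)" by (auto intro!: derivative_eq_intros)
      from DERIV_chain2[where f = sqrt and g = "\<lambda>s. s\<^sup>2 + t\<^sup>2" and x = s, OF DERIV_real_sqrt[OF pos] this]
      show ?thesis by (rule DERIV_cong) (simp add: D_def field_simps)
    qed
    have dA: "(A has_real_derivative c * t\<^sup>2 / (2 * D ^ 3)) (at s)"
    proof -
      have "((\<lambda>s. c * s / (2 * sqrt (s\<^sup>2 + t\<^sup>2))) has_real_derivative (c * (2 * D) - c * s * (2 * (s / D))) / ((2 * D) * (2 * D))) (at s)"
      proof -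
        have num: "((\<lambda>s. c * s) has_real_derivative c) (at s)" by (auto intro!: derivative_eq_intros)
        have "2 * sqrt (s\<^sup>2 + t\<^sup>2) \<noteq> 0" unfolding D_def[symmetric] using D(1) by simp
        from DERIV_divide[OF num DERIV_cmult[OF dD, of 2] this] show ?thesis unfolding D_def[symmetric] .
      qed
      moreover have "(c * (2 * D) - c * s * (2 * (s / D))) / ((2 * D) * (2 * D)) = c * t\<^sup>2 / (2 * D ^ 3)"
      proof -
        have "(c * (2 * D) - c * s * (2 * (s / D))) / ((2 * D) * (2 * D)) = c * (D\<^sup>2 - s\<^sup>2) / (2 * D ^ 3)"
          using D(1) by (simp add: field_simps power2_eq_square power3_eq_cube)
        then show ?thesis unfolding D(2) by simp
      qed
      ultimately show ?thesis unfolding A_def by simp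
    qed
    have d1: "((\<lambda>s. arcsin (A s)) has_real_derivative inverse (t * q / (2 * D)) * (c * t\<^sup>2 / (2 * D ^ 3))) (at s)"
      using DERIV_chain2[OF DERIV_arcsin[OF A1] dA] unfolding qA .
    have d2: "((\<lambda>s. arcsin (s / 2)) has_real_derivative inverse (q / 2) * (1 / 2)) (at s)"
    proof -
      have "((\<lambda>s :: real. s / 2) has_real_derivative 1 / 2) (at s)" by (auto intro!: derivative_eq_intros)
      from DERIV_chain2[where f = arcsin and g = "\<lambda>s. s / 2" and x = s, OF DERIV_arcsin[of "s / 2"] this] s
      show ?thesis unfolding q2 by auto
    qed
    have dF: "(F has_real_derivative 1 / pi * (c * (inverse (t * q / (2 * D)) * (c * t\<^sup>2 / (2 * D ^ 3))) - t * (inverse (q / 2) * (1 / 2)))) (at s)"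
      unfolding F_def by (intro DERIV_cmult DERIV_diff d1 d2)
    have val: "c * (inverse (t * q / (2 * D)) * (c * t\<^sup>2 / (2 * D ^ 3))) - t * (inverse (q / 2) * (1 / 2)) = q * (t / D\<^sup>2)"
    proof -
      have e1: "c * (inverse (t * q / (2 * D)) * (c * t\<^sup>2 / (2 * D ^ 3))) = c\<^sup>2 * t / (q * D\<^sup>2)"
        using q(1) D(1) t by (simp add: field_simps power2_eq_square power3_eq_cube)
      have e2: "t * (inverse (q / 2) * (1 / 2)) = t * D\<^sup>2 / (q * D\<^sup>2)" using q(1) D(1) by (simp add: field_simps)
      have "c * (inverse (t * q / (2 * D)) * (c * t\<^sup>2 / (2 * D ^ 3))) - t * (inverse (q / 2) * (1 / 2)) = t * (c\<^sup>2 - D\<^sup>2) / (q * D\<^sup>2)"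
        unfolding e1 e2 diff_divide_distrib[symmetric] by (simp only: right_diff_distrib mult.commute)
      also have "c\<^sup>2 - D\<^sup>2 = q * q" using q(2) unfolding c(2) D(2) by (simp add: power2_eq_square)
      finally show ?thesis using q(1) D(1) by (simp add: field_simps)
    qed
    show "(F has_vector_derivative 1 / pi * sqrt (4 - s\<^sup>2) * (t / (s\<^sup>2 + t\<^sup>2))) (at s)"
      unfolding has_real_derivative_iff_has_vector_derivative[symmetric] q_def[symmetric] D(2)[symmetric]
      by (rule DERIV_cong[OF dF]) (simp only: val mult.assoc)
  qed simp
  moreover have "A 2 = 1"
  proof -
    have "sqrt (2\<^sup>2 + t\<^sup>2) = c" by (simp add: c_def add.commute)
    then show ?thesis using c(1) by (simp add: A_def)
  qed
  then have "F 2 - F 0 = (sqrt (t\<^sup>2 + 4) - t) / 2" by (simp add: F_def A_def c_def[symmetric] field_simps)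
  ultimately show ?thesis by simp
qed

lemma quarter_circle_half_line: "half_line_prob quarter_circle"
proof -
  have one: "(\<lambda>_. 1 :: real) \<in> borel_measurable borel" "continuous_on {0..2} (\<lambda>_ :: real. 1 :: real)" by auto
  note I = integral_quarter_circle[OF one has_integral_quarter_circle]
  have int: "integrable lborel (\<lambda>s. 1 / pi * sqrt (4 - s\<^sup>2) * indicator {0..2} s)" using I(2) by simp
  have val: "(LINT s|lborel. 1 / pi * sqrt (4 - s\<^sup>2) * indicator {0..2} s) = 1"
  proof -
    have "(LINT s|quarter_circle. 1 :: real) = (LINT s|lborel. (1 / pi * sqrt (4 - s\<^sup>2) * indicator {0..2} s) *\<^sub>R 1)"
      unfolding quarter_circle_def
      by (subst integral_density) (use quarter_circle_density_nonneg in \<open>auto intro!: AE_I2\<close>)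
    then show ?thesis unfolding I(1) real_scaleR_def mult_1_right by (rule sym)
  qed
  have "prob_space quarter_circle"
  proof
    have "emeasure quarter_circle (space quarter_circle) = (\<integral>\<^sup>+s. ennreal (1 / pi * sqrt (4 - s\<^sup>2) * indicator {0..2} s) \<partial>lborel)"
      unfolding quarter_circle_def by (subst emeasure_density) (auto simp: space_density)
    also have "\<dots> = ennreal (LINT s|lborel. 1 / pi * sqrt (4 - s\<^sup>2) * indicator {0..2} s)"
      by (rule nn_integral_eq_integral[OF int]) (simp only: quarter_circle_density_nonneg AE_I2)
    finally show "emeasure quarter_circle (space quarter_circle) = 1" unfolding val by simp
  qed
  moreover have "emeasure quarter_circle {..<0} = 0"
  proof -
    have "emeasure quarter_circle {..<0} = (\<integral>\<^sup>+s. ennreal (1 / pi * sqrt (4 - s\<^sup>2) * indicator {0..2} s) * indicator {..<0} s \<partial>lborel)"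
      unfolding quarter_circle_def by (subst emeasure_density) auto
    also have "\<dots> = (\<integral>\<^sup>+s. 0 \<partial>(lborel :: real measure))" by (intro nn_integral_cong) (auto simp: indicator_def)
    finally show ?thesis by simp
  qed
  ultimately show ?thesis unfolding half_line_prob_def by (simp add: quarter_circle_def)
qed

lemma fixed_point_zero:
  assumes t: "t > 0"
  shows "fixed_point 0 t = (sqrt (t\<^sup>2 + 4) + t) / 2"
proof (rule fixed_point_unique[OF t])
  define c where "c = sqrt (t\<^sup>2 + 4)"
  have c: "c > 0" "c\<^sup>2 = t\<^sup>2 + 4" by (auto simp: c_def add_nonneg_pos)
  show "(sqrt (t\<^sup>2 + 4) + t) / 2 > 0" unfolding c_def[symmetric] using t c(1) by simp
  define w where "w = (c + t) / 2"
  have w: "w > 0" using t c(1) by (simp add: w_def)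
  have weq: "w - 1 / w = t"
  proof -
    have "(c - t) * (c + t) = 4" using c(2) by (simp add: algebra_simps power2_eq_square)
    then have "1 / ((c + t) / 2) = (c - t) / 2" using t c(1) by (simp add: field_simps)
    then show ?thesis unfolding w_def by (simp add: field_simps)
  qed
  have "w / (w\<^sup>2 + 0\<^sup>2) = 1 / w" using w by (simp add: power2_eq_square)
  then show "fixed_map 0 ((sqrt (t\<^sup>2 + 4) + t) / 2) = t"
    unfolding c_def[symmetric] w_def[symmetric] fixed_map_def using weq by simp
qed

lemma quarter_circle_stieltjes:
  assumes t: "t > 0"
  shows "(LINT s|quarter_circle. t / (s\<^sup>2 + t\<^sup>2)) = fixed_point 0 t - t"
proof -
  have pos: "s\<^sup>2 + t\<^sup>2 > 0" for s using t by (intro add_nonneg_pos) auto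
  have "(LINT s|quarter_circle. t / (s\<^sup>2 + t\<^sup>2)) = (sqrt (t\<^sup>2 + 4) - t) / 2"
  proof (rule integral_quarter_circle(1)[OF _ _ has_integral_quarter_circle_stieltjes[OF t]])
    show "continuous_on {0..2} (\<lambda>s. t / (s\<^sup>2 + t\<^sup>2))"
      by (intro continuous_intros) (use pos in \<open>auto simp: less_le\<close>)
  qed measurable
  then show ?thesis unfolding fixed_point_zero[OF t] by (simp add: field_simps)
qed

section \<open>The limit law\<close>

text \<open>Outside the unit disc v = 0 leaves ln (r^2) / 2. Inside, v^2 + r^2 = 1 removes the
  logarithm and leaves - v^2 / 2.\<close>

lemma log_potential_edge:
  assumes "r \<ge> 0"
  shows "log_potential r (edge r) = (if r > 1 then ln r else - (1 - r\<^sup>2) / 2)"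
proof (cases "r > 1")
  case True
  then show ?thesis by (simp add: edge_def log_potential_def ln_realpow)
next
  case False
  then have "r\<^sup>2 \<le> 1" using assms by (simp add: abs_square_le_1)
  then show ?thesis using False by (simp add: edge_def log_potential_def field_simps)
qed

lemma is_limit_law_exists: "\<exists>\<nu>. is_limit_law z \<nu>"
proof -
  obtain \<nu> where nu: "half_line_prob \<nu>"
    and st: "\<And>t. t > 0 \<Longrightarrow> (LINT s|\<nu>. t / (s\<^sup>2 + t\<^sup>2)) = fixed_point (cmod z) t - t"
    using limit_law_exists by blast
  interpret stieltjes_law \<nu> "cmod z" by unfold_locales (fact nu, fact st)
  have sets: "sets \<nu> = sets borel" using nu by (simp add: half_line_prob_def)
  have li: "integrable \<nu> ln" "(LINT s|\<nu>. ln s) = log_potential (cmod z) (edge (cmod z))"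
    by (rule log_integral, simp)+
  have "set_integrable \<nu> {0..} ln"
    unfolding set_integrable_def using li(1) by (intro integrable_mult_indicator) (simp add: sets)
  moreover have "(LINT s:{0..}|\<nu>. ln s) = (LINT s|\<nu>. ln s)"
    unfolding set_lebesgue_integral_def
  proof (rule integral_cong_AE)
    \<comment> \<open>The law lives on the positive axis, so restricting the integral to the half
      line changes nothing.\<close>
    show "AE s in \<nu>. indicator {0..} s *\<^sub>R ln s = ln s" using nu_pos by eventually_elim simp
  qed (use li(1) calculation in \<open>auto simp: set_integrable_def dest: borel_measurable_integrable\<close>)
  moreover have "- log_potential (cmod z) (edge (cmod z)) = (if cmod z > 1 then - ln (cmod z) else (1 - (cmod z)\<^sup>2) / 2)"
    unfolding log_potential_edge[OF norm_ge_zero] by (simp only: minus_divide_left minus_minus if_distrib[of uminus])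
  ultimately have "is_limit_law z \<nu>"
    unfolding is_limit_law_def using nu absolutely_continuous sv_dist_weak_conv[OF _ nu st] li(2)
    by (auto simp only: half_line_prob_def)
  then show ?thesis ..
qed

text \<open>Both laws are weak limits in probability along the same admissible array. The second law
  is only assumed to have this property, so the quarter circle law can be inserted directly.\<close>

lemma is_limit_law_weak_conv_unique:
  assumes "is_limit_law z \<mu>" "half_line_prob \<nu>"
    and "\<And>x. admissible_array x \<Longrightarrow> weak_conv_in_prob unif_perm (sv_dist x z) \<nu>"
  shows "\<mu> = \<nu>"
proof -
  obtain x where x: "admissible_array x" using admissible_array_exists by blast
  show ?thesis
    by (rule weak_conv_in_prob_unique[OF _ assms(2) _ assms(3)[OF x]])
       (use assms(1) x in \<open>auto simp: is_limit_law_def half_line_prob_def\<close>)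
qed

theorem theorem2p1:
  shows "(\<forall>z. \<exists>!\<nu>. is_limit_law z \<nu>) \<and>
    (\<forall>\<nu>. is_limit_law 0 \<nu> \<longrightarrow>
       \<nu> = density lborel (\<lambda>x. ennreal (1 / pi * sqrt (4 - x\<^sup>2) * indicator {0..2} x)))"
proof (intro conjI allI impI)
  fix z
  obtain \<nu> where nu: "is_limit_law z \<nu>" using is_limit_law_exists by blast
  have "\<mu> = \<nu>" if "is_limit_law z \<mu>" for \<mu>
    by (rule is_limit_law_weak_conv_unique[OF that])
       (use nu in \<open>simp_all add: is_limit_law_def half_line_prob_def\<close>)
  with nu show "\<exists>!\<nu>. is_limit_law z \<nu>" by blast
next
  fix \<nu> assume nu: "is_limit_law 0 \<nu>"
  have st: "(LINT s|quarter_circle. t / (s\<^sup>2 + t\<^sup>2)) = fixed_point (cmod 0) t - t" if "t > 0" for t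
    using quarter_circle_stieltjes[OF that] by simp
  \<comment> \<open>The quarter circle law has the transform belonging to z = 0 and is therefore
    also a weak limit for every admissible array.\<close>
  have "\<nu> = quarter_circle"
    using sv_dist_weak_conv[OF _ quarter_circle_half_line st]
    by (intro is_limit_law_weak_conv_unique[OF nu quarter_circle_half_line])
  then show "\<nu> = density lborel (\<lambda>x. ennreal (1 / pi * sqrt (4 - x\<^sup>2) * indicator {0..2} x))"
    by (simp only: quarter_circle_def)
qed

end
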